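(* There are precisely ten mutation-equivalence classes of Fano polygons $P$ such that the toric del Pezzo surface $X_P$ has only $T$-singularities. They are in bijective correspondence with the ten families of smooth del Pezzo surfaces.
   Context: Let $N\cong\mathbb{Z}^2$, $N_{\mathbb{Q}}=N\otimes_{\mathbb{Z}}\mathbb{Q}$, $M=\operatorname{Hom}(N,\mathbb{Z})$. A Fano polygon is a convex polygon $P\subset N_{\mathbb{Q}}$ whose vertices are primitive lattice points of $N$ and which contains the origin in its strict interior; polygons are considered up to $GL_2(\mathbb{Z})$-equivalence. $X_P$ is the toric surface (over $\mathbb{C}$) of the spanning fan of $P$, i.e. the fan whose cones are spanned by the faces of $P$; it is a toric del Pezzo surface with cyclic quotient singularities corresponding to the cones over the edges of $P$. $T$-singularities. For an edge $E$ with primitive inner normal $w_E\in M$, the height is $r_E=-w_E(E)>0$ and the width is $k_E=|E\cap N|-1$. The cyclic quotient singularity given by the cone over $E$ is a $T$-singularity if and only if $r_E$ divides $k_E$; equivalently it has the form $\frac{1}{nr^2}(1,nrc-1)$ with $\gcd(r,c)=1$, $n\geq 1$ (this convention includes smooth points, $n=r=1$). "$X_P$ has only $T$-singularities" means $r_E\mid k_E$ for every edge $E$ of $P$. Mutation. Let $w\in M$ be the primitive inner normal vector of an edge $E$ of $P$, let $h_{\min}=\min_{v\in P}w(v)=-r_E<0$ and $h_{\max}=\max_{v\in P}w(v)>0$. For $h\in\mathbb{Z}$ let $w_h(P)$ be the (possibly empty) convex hull of $\{v\in P\cap N: w(v)=h\}$. Let $v_E\in N$ be primitive with $w(v_E)=0$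 (unique up to sign) and $F=\operatorname{conv}\{0,v_E\}$. Suppose that for every integer $h$ with $h_{\min}\leq h<0$ there is a (possibly empty) lattice polytope $G_h\subset N_{\mathbb{Q}}$ with $\{v \text{ a vertex of } P: w(v)=h\}\subseteq G_h+|h|F\subseteq w_h(P)$ (Minkowski sum, with $\varnothing+Q=\varnothing$). Then the mutation of $P$ is $\operatorname{mut}_w(P,F)=\operatorname{conv}\big(\bigcup_{h=h_{\min}}^{-1}G_h\cup\bigcup_{h=0}^{h_{\max}}(w_h(P)+hF)\big)$. It is again a Fano polygon, is independent of the choice of $\{G_h\}$, and up to $GL_2(\mathbb{Z})$ is independent of the sign of $v_E$. Two Fano polygons are mutation-equivalent if, up to $GL_2(\mathbb{Z})$-equivalence, they are connected by a finite sequence of mutations. The ten (deformation) families of smooth del Pezzo surfaces are $\mathbb{P}^1\times\mathbb{P}^1$ and the blow-ups of $\mathbb{P}^2$ in $i$ general points, $0\le i\le 8$. *)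

theory Defs
  imports "HOL-Analysis.Analysis"
begin

(* N is the standard lattice in the plane.  M is identified with N through the dual basis, so
   that w(v) is the inner product of w and v.  Polygons are taken in the real plane instead of
   the rational one, because the library's convexity notions need a real vector space; a lattice
   polygon is determined by its (finitely many, lattice) vertices in either setting. *)

type_synonym plane = "real \<times> real"

definition lattice_pts :: "plane set" where
  "lattice_pts = {(of_int a, of_int b) | a b. True}"

definition primitive :: "plane \<Rightarrow> bool" where
  "primitive v \<longleftrightarrow> (\<exists>a b :: int. coprime a b \<and> v = (of_int a, of_int b))"

definition lattice_polytope :: "plane set \<Rightarrow> bool" where
  "lattice_polytope G \<longleftrightarrow> (\<exists>S. finite S \<and> S \<subseteq> lattice_pts \<and> G = convex hull S)"

definition fano_polygon :: "plane set \<Rightarrow> bool" where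
  "fano_polygon P \<longleftrightarrow>
     polytope P \<and> (\<forall>v. v extreme_point_of P \<longrightarrow> primitive v) \<and> 0 \<in> interior P"

definition gl2_equivalent :: "plane set \<Rightarrow> plane set \<Rightarrow> bool" where
  "gl2_equivalent P Q \<longleftrightarrow>
     (\<exists>f :: plane \<Rightarrow> plane. linear f \<and> f ` lattice_pts = lattice_pts \<and> Q = f ` P)"


definition inner_normal :: "plane set \<Rightarrow> plane set \<Rightarrow> plane \<Rightarrow> bool" where
  "inner_normal P E w \<longleftrightarrow> primitive w \<and> E = {v \<in> P. \<forall>u\<in>P. w \<bullet> v \<le> w \<bullet> u}"

definition edge_height :: "plane set \<Rightarrow> plane set \<Rightarrow> nat" where
  "edge_height P E = (THE r. \<exists>w. inner_normal P E w \<and> (\<forall>v\<in>E. w \<bullet> v = - real r))"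

definition edge_width :: "plane set \<Rightarrow> nat" where
  "edge_width E = card (E \<inter> lattice_pts) - 1"

definition only_T_singularities :: "plane set \<Rightarrow> bool" where
  "only_T_singularities P \<longleftrightarrow> (\<forall>E. E edge_of P \<longrightarrow> edge_height P E dvd edge_width E)"


definition slice :: "plane \<Rightarrow> plane set \<Rightarrow> int \<Rightarrow> plane set" where
  "slice w P h = convex hull {v \<in> P \<inter> lattice_pts. w \<bullet> v = of_int h}"

definition neg_heights :: "plane \<Rightarrow> plane set \<Rightarrow> int set" where
  "neg_heights w P = {h. (INF v\<in>P. w \<bullet> v) \<le> of_int h \<and> h < 0}"

definition nonneg_heights :: "plane \<Rightarrow> plane set \<Rightarrow> int set" where
  "nonneg_heights w P = {h. 0 \<le> h \<and> of_int h \<le> (SUP v\<in>P. w \<bullet> v)}"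

definition mutation_data :: "plane \<Rightarrow> plane set \<Rightarrow> plane set \<Rightarrow> (int \<Rightarrow> plane set) \<Rightarrow> bool" where
  "mutation_data w P F G \<longleftrightarrow> (\<forall>h \<in> neg_heights w P.
     lattice_polytope (G h) \<and>
     {v. v extreme_point_of P \<and> w \<bullet> v = of_int h} \<subseteq> G h + (*\<^sub>R) (of_int \<bar>h\<bar>) ` F \<and>
     G h + (*\<^sub>R) (of_int \<bar>h\<bar>) ` F \<subseteq> slice w P h)"

definition mut :: "plane \<Rightarrow> plane set \<Rightarrow> plane set \<Rightarrow> (int \<Rightarrow> plane set) \<Rightarrow> plane set" where
  "mut w P F G = convex hull
     ((\<Union>h \<in> neg_heights w P. G h) \<union>
      (\<Union>h \<in> nonneg_heights w P. slice w P h + (*\<^sub>R) (of_int h) ` F))"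

definition is_mutation :: "plane set \<Rightarrow> plane set \<Rightarrow> bool" where
  "is_mutation P Q \<longleftrightarrow>
     (\<exists>E w v G. E edge_of P \<and> inner_normal P E w \<and> primitive v \<and> w \<bullet> v = 0 \<and>
        mutation_data w P (convex hull {0, v}) G \<and> Q = mut w P (convex hull {0, v}) G)"

(* A mutation of a Fano polygon is again Fano and can be undone by a mutation, so neither the
   restriction of the steps to Fano polygons nor the symmetric closure identifies more or fewer
   polygons than chains of mutations and GL_2(Z)-equivalences do. *)
definition mutation_step :: "plane set \<Rightarrow> plane set \<Rightarrow> bool" where
  "mutation_step P Q \<longleftrightarrow>
     fano_polygon P \<and> fano_polygon Q \<and> (gl2_equivalent P Q \<or> is_mutation P Q)"

definition mutation_equivalence :: "(plane set \<times> plane set) set" where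
  "mutation_equivalence =
     {(P, Q). fano_polygon P \<and> fano_polygon Q \<and> equivclp mutation_step P Q}"

definition T_classes :: "plane set set set" where
  "T_classes = {P. fano_polygon P \<and> only_T_singularities P} // mutation_equivalence"


(* Blowup i stands for the family of blow-ups of the projective plane in i general points. *)
datatype surface_family = P1xP1 | Blowup nat

definition smooth_del_pezzo_families :: "surface_family set" where
  "smooth_del_pezzo_families = insert P1xP1 (Blowup ` {0..8})"

fun euler_number :: "surface_family \<Rightarrow> nat" where
  "euler_number P1xP1 = 4"
| "euler_number (Blowup i) = 3 + i"

(* The topological Euler number of a Q-Gorenstein smoothing of X_P, when X_P has only
   T-singularities.  X_P has Euler number the number of edges of P (its torus-fixed points), and
   smoothing the point 1/(n r^2) (1, n r c - 1), whose Milnor number is n - 1, adds n - 1.  For the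
   cone over an edge of height r and width k one has n = k / r. *)
definition smoothing_euler_number :: "plane set \<Rightarrow> nat" where
  "smoothing_euler_number P = (\<Sum>E | E edge_of P. edge_width E div edge_height P E)"

(* The polygons of the smooth toric del Pezzo surfaces, up to three blow-ups: the last three
   vectors in the list are the sums of two neighbouring vectors among the first three, i.e. the
   rays that subdivide the three cones of the fan of the projective plane. *)
definition smooth_toric_families :: "surface_family set" where
  "smooth_toric_families = insert P1xP1 (Blowup ` {0..3})"

fun toric_polygon :: "surface_family \<Rightarrow> plane set" where
  "toric_polygon P1xP1 = convex hull {(1, 0), (0, 1), (-1, 0), (0, -1)}"
| "toric_polygon (Blowup i) = convex hull
     set (take (3 + i) [(1, 0), (0, 1), (-1, -1), (0, -1), (-1, 0), (1, 1)])"

end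

theory Submission
  imports Defs
begin

text \<open>
  A polygon is handled through its support function on the dual lattice. The mutation in direction
  \<open>w\<close> with factor \<open>v\<close> acts there by the piecewise linear map \<open>u - min(0, u \<bullet> v) w\<close>. It carries over
  all normals other than \<open>w\<close> and \<open>-w\<close> with their heights and lengths, shortens the edge with normal
  \<open>w\<close> by its height and lengthens the opposite edge by its height. Hence the sum of the numbers
  length/height over all edges is invariant, and so is the property that all normals agree
  modulo 2, which separates the two families where that sum is 4.

  Conversely, mutations that decrease the boundary length end in a polygon where no edge is higher
  than the polygon is on the opposite side. In such a polygon an edge of maximal height is as long as
  the polygon is wide; up to \<open>GL\<^sub>2(\<int>)\<close> this leaves the polygons in the strip
  \<open>\<bar>y\<bar> \<le> 1\<close> and a few triangles, and explicit mutations join these to ten polygons.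
\<close>

section \<open>Lattice points and primitive vectors\<close>

text \<open>The definition of a mutation depends on a choice of pieces \<open>G\<close>, and vertex
  lists change irregularly under it. The relation \<open>same_hgt\<close> removes both difficulties:
  it prescribes the new support function in every direction, so it determines the result, and for a
  proposed vertex list it follows from finitely many membership tests. Lengths of edges can be read
  from the support function too, from its growth along rays \<open>real m *\<^sub>R u + z\<close>.

  Equivalence is generated by steps in both directions through arbitrary Fano polygons. The
  invariants are therefore formulated for all of them; lengths are divided by heights with rounding
  down.

  The T-condition has two effects. Every edge is at least as long as high, so each edge can be
  mutated and the descent stops only when the heights forbid it. And in a terminal polygon the
  length of each edge is a multiple \<open>m * h\<close> of its height; together with the
  coprimality of vertex coordinates, the resulting divisibility conditions leave, up to unimodular
  maps, only seven triangles outside the strip.\<close>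

definition quarter_turn :: "plane \<Rightarrow> plane" where
  "quarter_turn u = (snd u, - fst u)"

lemma inner_plane: "(x :: plane) \<bullet> y = fst x * fst y + snd x * snd y"
  by (simp add: inner_prod_def)

lemma lattice_ptsE:
  assumes "x \<in> lattice_pts"
  obtains a b :: int where "x = (of_int a, of_int b)"
  using assms by (auto simp: lattice_pts_def)

lemma lattice_pts_of_int [simp]: "(of_int a, of_int b) \<in> lattice_pts"
  by (auto simp: lattice_pts_def)

lemma lattice_pts_iff: "x \<in> lattice_pts \<longleftrightarrow> fst x \<in> \<int> \<and> snd x \<in> \<int>"
  by (cases x) (auto simp: lattice_pts_def Ints_def)

lemma lattice_pts_add: "x \<in> lattice_pts \<Longrightarrow> y \<in> lattice_pts \<Longrightarrow> x + y \<in> lattice_pts"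
  and lattice_pts_diff: "x \<in> lattice_pts \<Longrightarrow> y \<in> lattice_pts \<Longrightarrow> x - y \<in> lattice_pts"
  and lattice_pts_minus: "x \<in> lattice_pts \<Longrightarrow> - x \<in> lattice_pts"
  and lattice_pts_scale: "x \<in> lattice_pts \<Longrightarrow> c \<in> \<int> \<Longrightarrow> c *\<^sub>R x \<in> lattice_pts"
  and lattice_pts_inner: "x \<in> lattice_pts \<Longrightarrow> y \<in> lattice_pts \<Longrightarrow> x \<bullet> y \<in> \<int>"
  and lattice_pts_quarter_turn: "x \<in> lattice_pts \<Longrightarrow> quarter_turn x \<in> lattice_pts"
  by (auto simp: lattice_pts_iff inner_plane quarter_turn_def)

lemma lattice_pts_0 [simp]: "0 \<in> lattice_pts"
  by (simp add: lattice_pts_iff)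

text \<open>Bezout. A lattice vector pairing to 1 is a witness that can be transported, which is how
  primitivity is carried through unimodular maps, \<open>bend\<close> and shears.\<close>

lemma primitive_iff: "primitive u \<longleftrightarrow> u \<in> lattice_pts \<and> (\<exists>x\<in>lattice_pts. u \<bullet> x = 1)"
proof
  assume "primitive u"
  then obtain a b :: int where ab: "coprime a b" "u = (of_int a, of_int b)"
    by (auto simp: primitive_def)
  obtain s t where "s * a + t * b = 1"
    using ab(1) bezout_int[of a b] by (metis coprime_imp_gcd_eq_1)
  then have "real_of_int (s * a + t * b) = 1" by simp
  then have "u \<bullet> (of_int s, of_int t) = 1"
    by (simp add: ab inner_plane algebra_simps)
  then show "u \<in> lattice_pts \<and> (\<exists>x\<in>lattice_pts. u \<bullet> x = 1)"
    using ab(2) by (metis lattice_pts_of_int)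
next
  assume "u \<in> lattice_pts \<and> (\<exists>x\<in>lattice_pts. u \<bullet> x = 1)"
  then obtain a b s t :: int where u: "u = (of_int a, of_int b)"
    and "u \<bullet> (of_int s, of_int t) = 1"
    by (metis lattice_ptsE)
  then have "real_of_int (a * s + b * t) = 1"
    by (simp add: inner_plane)
  then have "a * s + b * t = 1" by linarith
  then have "coprime a b"
    by (intro coprimeI) (metis dvd_add dvd_mult2)
  then show "primitive u" using u by (auto simp: primitive_def)
qed

lemma primitive_lattice: "primitive u \<Longrightarrow> u \<in> lattice_pts"
  by (simp add: primitive_iff)

lemma primitive_nonzero: "primitive u \<Longrightarrow> u \<noteq> 0"
  by (auto simp: primitive_iff)

lemma primitive_minus [simp]: "primitive (- u) \<longleftrightarrow> primitive u"
proof -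
  have "primitive (- u)" if "primitive u" for u
    using that lattice_pts_minus unfolding primitive_iff
    by (metis inner_minus_left inner_minus_right minus_minus)
  then show ?thesis by (metis minus_minus)
qed

lemma quarter_turn_quarter_turn [simp]: "quarter_turn (quarter_turn u) = - u"
  by (cases u) (simp add: quarter_turn_def)

lemma quarter_turn_linear:
  "quarter_turn (x + y) = quarter_turn x + quarter_turn y"
  "quarter_turn (x - y) = quarter_turn x - quarter_turn y"
  "quarter_turn (- x) = - quarter_turn x"
  "quarter_turn (c *\<^sub>R x) = c *\<^sub>R quarter_turn x"
  by (simp_all add: quarter_turn_def prod_eq_iff)

lemma inner_quarter_turn [simp]: "u \<bullet> quarter_turn u = 0" "quarter_turn u \<bullet> u = 0"
  by (simp_all add: quarter_turn_def inner_plane)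

lemma inner_quarter_turn_left: "quarter_turn x \<bullet> y = - (x \<bullet> quarter_turn y)"
  by (simp add: quarter_turn_def inner_plane)

lemma primitive_quarter_turn [simp]: "primitive (quarter_turn u) \<longleftrightarrow> primitive u"
proof -
  have "primitive (quarter_turn u)" if "primitive u" for u
  proof -
    obtain x where "u \<in> lattice_pts" "x \<in> lattice_pts" "u \<bullet> x = 1"
      using \<open>primitive u\<close> by (auto simp: primitive_iff)
    then show ?thesis
      unfolding primitive_iff
      by (intro conjI bexI[of _ "quarter_turn x"] lattice_pts_quarter_turn)
         (simp_all add: inner_quarter_turn_left)
  qed
  then show ?thesis by (metis quarter_turn_quarter_turn primitive_minus)
qed

lemma primitive_complement:
  assumes "primitive u"
  obtains z where "z \<in> lattice_pts" "z \<bullet> quarter_turn u = 1"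
  using assms by (metis inner_commute primitive_iff primitive_quarter_turn)

lemma orthogonal_multiple:
  assumes "(u :: plane) \<bullet> d = 0" "u \<noteq> 0"
  obtains c where "d = c *\<^sub>R quarter_turn u"
proof -
  obtain a b where u: "u = (a, b)" by (cases u)
  obtain x y where d: "d = (x, y)" by (cases d)
  have e: "a * x + b * y = 0" using assms(1) by (simp add: u d inner_plane)
  have "a \<noteq> 0 \<or> b \<noteq> 0" using assms(2) by (auto simp: u zero_prod_def)
  then show thesis
  proof
    assume "a \<noteq> 0"
    then have "d = (- y / a) *\<^sub>R quarter_turn u"
      using e by (simp add: u d quarter_turn_def field_simps)
    then show thesis ..
  next
    assume "b \<noteq> 0"
    then have "d = (x / b) *\<^sub>R quarter_turn u"
      using e by (simp add: u d quarter_turn_def field_simps)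
    then show thesis ..
  qed
qed

text \<open>Pairing with a lattice vector \<open>z\<close> such that
  \<open>z \<bullet> quarter_turn u = 1\<close> reads off the coefficient, which is therefore an
  integer.\<close>

lemma lattice_orthogonal_multiple:
  assumes "primitive u" "d \<in> lattice_pts" "u \<bullet> d = 0"
  obtains k :: int where "d = of_int k *\<^sub>R quarter_turn u"
proof -
  obtain c where c: "d = c *\<^sub>R quarter_turn u"
    using orthogonal_multiple assms primitive_nonzero by metis
  obtain z where z: "z \<in> lattice_pts" "z \<bullet> quarter_turn u = 1"
    using primitive_complement assms(1) by metis
  have "z \<bullet> d = c" using z by (simp add: c)
  then have "c \<in> \<int>" using lattice_pts_inner z(1) assms(2) by metis
  then show thesis using that c by (auto elim: Ints_cases)
qed

lemma primitive_orthogonal: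
  assumes "primitive w" "primitive v" "w \<bullet> v = 0"
  obtains "v = quarter_turn w" | "v = - quarter_turn w"
proof -
  obtain k where k: "v = of_int k *\<^sub>R quarter_turn w"
    using lattice_orthogonal_multiple assms primitive_lattice by metis
  obtain x where x: "x \<in> lattice_pts" "v \<bullet> x = 1"
    using assms(2) by (auto simp: primitive_iff)
  have "quarter_turn w \<bullet> x \<in> \<int>"
    using primitive_lattice[OF assms(1)] x(1) by (intro lattice_pts_inner lattice_pts_quarter_turn)
  then obtain i where i: "quarter_turn w \<bullet> x = of_int i" by (auto elim: Ints_cases)
  have "real_of_int (k * i) = 1" using x(2) by (simp add: k i)
  then have "k * i = 1" by linarith
  then have "k = 1 \<or> k = - 1" using zmult_eq_1_iff by blast
  then show thesis using k that by auto
qed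

lemma primitive_parallel:
  assumes "primitive u" "primitive u'" "u \<bullet> quarter_turn u' = 0"
  shows "u = u' \<or> u = - u'"
proof -
  have "quarter_turn u' \<bullet> u = 0" using assms(3) by (simp add: inner_commute)
  then consider "u = quarter_turn (quarter_turn u')" | "u = - quarter_turn (quarter_turn u')"
    using primitive_orthogonal[of "quarter_turn u'" u] assms by auto
  then show ?thesis by cases auto
qed

lemma primitive_direction:
  assumes "d \<in> lattice_pts" "d \<noteq> 0"
  obtains e and k :: nat where "primitive e" "k > 0" "d = real k *\<^sub>R e"
proof -
  obtain a b :: int where d: "d = (of_int a, of_int b)" using assms(1) by (rule lattice_ptsE)
  have ab: "a \<noteq> 0 \<or> b \<noteq> 0" using assms(2) by (auto simp: d zero_prod_def)
  define g where "g = gcd a b"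
  have g: "g > 0" using ab by (simp add: g_def)
  obtain a' b' where "a = a' * g" "b = b' * g" "coprime a' b'"
    using g gcd_coprime_exists[of a b] unfolding g_def by (metis less_irrefl)
  then show thesis
    using that[of "(of_int a', of_int b')" "nat g"] g
    by (auto simp: d primitive_def mult.commute)
qed

section \<open>Support functions and edges\<close>

text \<open>The sign makes this positive around an interior origin; at the inner normal of an edge
  it is the height of that edge.\<close>

definition hgt :: "plane set \<Rightarrow> plane \<Rightarrow> real" where
  "hgt P u = - (INF x\<in>P. u \<bullet> x)"

definition face :: "plane set \<Rightarrow> plane \<Rightarrow> plane set" where
  "face P u = {x \<in> P. \<forall>y\<in>P. u \<bullet> x \<le> u \<bullet> y}"

text \<open>For a lattice polygon this makes sense in every primitive direction: it is 0 where the
  face is a vertex and positive exactly at inner normals of edges.\<close>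

definition wid :: "plane set \<Rightarrow> plane \<Rightarrow> nat" where
  "wid P u = edge_width (face P u)"

definition normals :: "plane set \<Rightarrow> plane set" where
  "normals P = {u. primitive u \<and> wid P u > 0}"

lemma finite_argmin:
  fixes f :: "'a \<Rightarrow> real"
  assumes "finite A" "A \<noteq> {}"
  shows "\<exists>x\<in>A. \<forall>y\<in>A. f x \<le> f y"
  using arg_min_if_finite[OF assms, of f] by (metis not_le)

lemma hgt_attained:
  assumes "compact P" "P \<noteq> {}"
  obtains x where "x \<in> P" "u \<bullet> x = - hgt P u" "\<And>y. y \<in> P \<Longrightarrow> u \<bullet> x \<le> u \<bullet> y"
proof -
  have "continuous_on P (\<lambda>x. u \<bullet> x)" by (intro continuous_intros)
  then obtain x where x: "x \<in> P" "\<forall>y\<in>P. u \<bullet> x \<le> u \<bullet> y"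
    using continuous_attains_inf[OF assms] by blast
  have "(INF x\<in>P. u \<bullet> x) = u \<bullet> x"
    using x by (intro cInf_eq_minimum) auto
  then show thesis using that x by (auto simp: hgt_def)
qed

lemma hgt_le:
  assumes "compact P" "x \<in> P"
  shows "- hgt P u \<le> u \<bullet> x"
  using hgt_attained[of P u] assms by (metis empty_iff)

lemma hgt_eqI:
  assumes "x \<in> P" "u \<bullet> x = - c" "\<And>y. y \<in> P \<Longrightarrow> - c \<le> u \<bullet> y"
  shows "hgt P u = c"
proof -
  have "(INF x\<in>P. u \<bullet> x) = - c"
    using assms by (intro cInf_eq_minimum) (auto simp: image_iff intro!: bexI[of _ x])
  then show ?thesis by (simp add: hgt_def)
qed

lemma face_eq: "compact P \<Longrightarrow> face P u = P \<inter> {x. u \<bullet> x = - hgt P u}"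
  using hgt_attained[of P u] hgt_le[of P _ u] unfolding face_def
  by (smt (verit) Collect_cong Int_def empty_iff mem_Collect_eq)

lemma face_face_of: "compact P \<Longrightarrow> convex P \<Longrightarrow> face P u face_of P"
  by (subst face_eq)
     (auto intro!: face_of_Int_supporting_hyperplane_ge dest: hgt_le)

lemma compact_face: "compact P \<Longrightarrow> convex P \<Longrightarrow> compact (face P u)"
  using face_face_of face_of_imp_compact by blast

lemma face_nonempty: "compact P \<Longrightarrow> P \<noteq> {} \<Longrightarrow> face P u \<noteq> {}"
proof -
  assume "compact P" "P \<noteq> {}"
  then obtain x where "x \<in> P" "\<And>y. y \<in> P \<Longrightarrow> u \<bullet> x \<le> u \<bullet> y" using hgt_attained by blast
  then have "x \<in> face P u" by (simp add: face_def)
  then show ?thesis by blast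
qed

lemma convex_hull_inner_ge:
  assumes "x \<in> convex hull V" "\<And>y. y \<in> V \<Longrightarrow> c \<le> u \<bullet> y"
  shows "c \<le> u \<bullet> x"
proof -
  have "convex hull V \<subseteq> {x. c \<le> u \<bullet> x}"
    using assms(2) by (intro hull_minimal) (auto simp: convex_halfspace_ge)
  then show ?thesis using assms(1) by auto
qed

lemma face_convex_hull:
  assumes "finite V"
  shows "face (convex hull V) u = convex hull (V \<inter> face (convex hull V) u)"
proof (rule antisym)
  let ?P = "convex hull V"
  have comp: "compact ?P" using assms by (simp add: compact_convex_hull finite_imp_compact)
  then obtain S where S: "S \<subseteq> V" "face ?P u = convex hull S"
    using face_of_convex_hull_subset[of V "face ?P u"] face_face_of[of ?P u] assms
    by (auto simp: finite_imp_compact)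
  have "S \<subseteq> V \<inter> face ?P u" using S by (auto intro: hull_inc)
  then show "face ?P u \<subseteq> convex hull (V \<inter> face ?P u)" using S hull_mono by metis
  have "convex (face ?P u)" using comp face_face_of face_of_imp_convex by blast
  then show "convex hull (V \<inter> face ?P u) \<subseteq> face ?P u" by (simp add: hull_minimal)
qed

lemma hull_face_vertex:
  assumes "finite V" "V \<noteq> {}"
  obtains p where "p \<in> V" "p \<in> face (convex hull V) u"
proof -
  have "compact (convex hull V)" using assms by (simp add: compact_convex_hull finite_imp_compact)
  then have "face (convex hull V) u \<noteq> {}" using assms face_nonempty by auto
  then show thesis using face_convex_hull[OF assms(1), of u] that
    by (metis Int_iff convex_hull_eq_empty equals0I)
qed

text \<open>By separation: a point outside a compact convex set violates one of its supporting
  half-planes. Equality of polygons thus becomes equality of support functions.\<close>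

lemma convex_compact_eqI:
  fixes P Q :: "plane set"
  assumes "compact P" "convex P" "P \<noteq> {}" "compact Q" "convex Q" "Q \<noteq> {}"
    and "\<And>u. hgt P u = hgt Q u"
  shows "P = Q"
proof -
  have "P \<subseteq> Q" if P: "compact P" and Q: "compact Q" "convex Q" "Q \<noteq> {}" and h: "\<And>u. hgt P u = hgt Q u" for P Q
  proof (rule ccontr)
    assume "\<not> P \<subseteq> Q"
    then obtain x where x: "x \<in> P" "x \<notin> Q" by auto
    then obtain a b where ab: "a \<bullet> x < b" "\<forall>y\<in>Q. a \<bullet> y > b"
      using separating_hyperplane_closed_point[of Q x] Q compact_imp_closed by blast
    obtain y where "y \<in> Q" "a \<bullet> y = - hgt Q a" using hgt_attained[of Q a] Q by metis
    then have "- hgt Q a > b" using ab by auto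
    moreover have "- hgt P a \<le> a \<bullet> x" using hgt_le P x(1) by blast
    ultimately show False using ab(1) h[of a] by linarith
  qed
  then show ?thesis using assms by (metis subset_antisym)
qed

text \<open>If \<open>u\<close> is the inner normal of an edge, \<open>quarter_turn u\<close> points
  along it in anticlockwise order. The ends are the extremal generators in that direction, and since
  this vector is primitive the lattice points of the face are equally spaced by it.\<close>

lemma face_ends:
  assumes V: "finite V" "V \<noteq> {}" "V \<subseteq> lattice_pts" and u: "primitive u"
  defines "P \<equiv> convex hull V"
  obtains p where "p \<in> V" "p + real (wid P u) *\<^sub>R quarter_turn u \<in> V"
    "face P u = {p + t *\<^sub>R quarter_turn u | t. 0 \<le> t \<and> t \<le> real (wid P u)}"
proof -
  let ?J = "quarter_turn u" and ?F = "face P u"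
  have comp: "compact P" using V by (simp add: P_def compact_convex_hull finite_imp_compact)
  have conv: "convex P" by (simp add: P_def)
  have VF: "finite (V \<inter> ?F)" "V \<inter> ?F \<noteq> {}" "?F = convex hull (V \<inter> ?F)"
    using V(1) hull_face_vertex[OF V(1,2), of u] face_convex_hull[OF V(1), of u] unfolding P_def by blast+
  obtain p where p: "p \<in> V \<inter> ?F" "\<And>x. x \<in> V \<inter> ?F \<Longrightarrow> ?J \<bullet> p \<le> ?J \<bullet> x"
    using finite_argmin[OF VF(1,2), of "\<lambda>x. ?J \<bullet> x"] by blast
  obtain q where q: "q \<in> V \<inter> ?F" "\<And>x. x \<in> V \<inter> ?F \<Longrightarrow> ?J \<bullet> x \<le> ?J \<bullet> q"
    using finite_argmin[OF VF(1,2), of "\<lambda>x. - (?J \<bullet> x)"] by auto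
  have pF: "p \<in> ?F" and qF: "q \<in> ?F" using p q by auto
  have line: "u \<bullet> x = u \<bullet> p" if "x \<in> ?F" for x
    using that pF comp by (auto simp: face_eq)
  have J0: "?J \<bullet> ?J > 0" using u by (simp add: primitive_nonzero)
  have "p \<in> lattice_pts" "q \<in> lattice_pts" using p(1) q(1) V(3) by auto
  then have "q - p \<in> lattice_pts" by (simp add: lattice_pts_diff)
  moreover have "u \<bullet> (q - p) = 0" using line[OF qF] by (simp add: inner_diff_right)
  ultimately obtain k :: int where k: "q - p = of_int k *\<^sub>R ?J"
    using lattice_orthogonal_multiple[OF u] by metis
  have "?J \<bullet> (q - p) \<ge> 0" using p(2)[OF q(1)] by (simp add: inner_diff_right)
  then have k0: "k \<ge> 0" using J0 by (simp add: k zero_le_mult_iff)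
  define n where "n = nat k"
  have qn: "q = p + real n *\<^sub>R ?J" using k k0 by (simp add: n_def algebra_simps)
  have F: "?F = {p + t *\<^sub>R ?J | t. 0 \<le> t \<and> t \<le> real n}"
  proof (intro set_eqI iffI)
    fix x assume x: "x \<in> ?F"
    have "u \<bullet> (x - p) = 0" using line[OF x] by (simp add: inner_diff_right)
    then obtain c where c: "x - p = c *\<^sub>R ?J" 
      using orthogonal_multiple[of u] u primitive_nonzero by metis
    then have x': "x = p + c *\<^sub>R ?J" by (simp add: algebra_simps)
    have "x \<in> convex hull (V \<inter> ?F)" using x VF(3) by simp
    then have "?J \<bullet> p \<le> ?J \<bullet> x" using convex_hull_inner_ge p(2) by blast
    moreover have "- (?J \<bullet> q) \<le> - ?J \<bullet> x" 
      using convex_hull_inner_ge[OF \<open>x \<in> convex hull _\<close>, of "- (?J \<bullet> q)" "- ?J"] q(2) by auto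
    ultimately have "0 \<le> c * (?J \<bullet> ?J)" "c * (?J \<bullet> ?J) \<le> real n * (?J \<bullet> ?J)"
      by (simp_all add: x' qn inner_add_right)
    then have "0 \<le> c" "c \<le> real n" using J0 by (simp_all add: zero_le_mult_iff)
    then show "x \<in> {p + t *\<^sub>R ?J | t. 0 \<le> t \<and> t \<le> real n}" using x' by blast
  next
    fix x assume "x \<in> {p + t *\<^sub>R ?J | t. 0 \<le> t \<and> t \<le> real n}"
    then obtain t where t: "x = p + t *\<^sub>R ?J" "0 \<le> t" "t \<le> real n" by blast
    have cF: "convex ?F" using comp conv face_face_of face_of_imp_convex by blast
    show "x \<in> ?F"
    proof (cases "n = 0")
      case True then show ?thesis using t pF by simp
    next
      case False
      have "(1 - t / n) *\<^sub>R p + (t / n) *\<^sub>R q \<in> ?F"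
        using t False by (intro convexD[OF cF pF qF]) auto
      moreover have "(1 - t / n) *\<^sub>R p + (t / n) *\<^sub>R q = x"
        using False by (simp add: t qn algebra_simps)
      ultimately show ?thesis by simp
    qed
  qed
  have pl: "p \<in> lattice_pts" using p V by auto
  have "?F \<inter> lattice_pts = (\<lambda>i. p + real i *\<^sub>R ?J) ` {..n}"
  proof (intro set_eqI iffI)
    fix x assume x: "x \<in> ?F \<inter> lattice_pts"
    then obtain t where t: "x = p + t *\<^sub>R ?J" "0 \<le> t" "t \<le> real n" using F by auto
    have "x - p \<in> lattice_pts" using x pl lattice_pts_diff by auto
    then obtain i :: int where "x - p = of_int i *\<^sub>R ?J"
      using lattice_orthogonal_multiple[OF u] t(1) by (metis add_diff_cancel_left' inner_quarter_turn(1) inner_scaleR_right mult_zero_right)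
    then have "t = of_int i" using t(1) J0 by auto
    then have "t = real (nat i)" "nat i \<le> n" using t by auto
    then show "x \<in> (\<lambda>i. p + real i *\<^sub>R ?J) ` {..n}" using t(1) by blast
  next
    fix x assume "x \<in> (\<lambda>i. p + real i *\<^sub>R ?J) ` {..n}"
    then show "x \<in> ?F \<inter> lattice_pts"
      using F pl primitive_lattice[OF u]
      by (auto intro!: lattice_pts_add lattice_pts_scale lattice_pts_quarter_turn)
  qed
  moreover have "inj_on (\<lambda>i. p + real i *\<^sub>R ?J) {..n}"
    using J0 by (auto simp: inj_on_def)
  ultimately have "card (?F \<inter> lattice_pts) = Suc n" by (simp add: card_image)
  then have "wid P u = n" by (simp add: wid_def edge_width_def)
  then show thesis using that[of p] p q qn F by auto
qed

text \<open>The functional \<open>z\<close> changes by exactly 1 from one lattice point of the face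
  to the next, so its range on the face has the length of the face.\<close>

lemma wid_eq_hgt:
  assumes V: "finite V" "V \<noteq> {}" "V \<subseteq> lattice_pts" and u: "primitive u"
    and z: "\<bar>z \<bullet> quarter_turn u\<bar> = 1"
  defines "P \<equiv> convex hull V"
  shows "real (wid P u) = hgt (face P u) z + hgt (face P u) (- z)"
proof -
  obtain p where p: "face P u = {p + t *\<^sub>R quarter_turn u | t. 0 \<le> t \<and> t \<le> real (wid P u)}"
    unfolding P_def by (rule face_ends[OF V u])
  let ?q = "p + real (wid P u) *\<^sub>R quarter_turn u"
  have in_F: "p \<in> face P u" "?q \<in> face P u"
    by (subst p, force)+
  consider "z \<bullet> quarter_turn u = 1" | "z \<bullet> quarter_turn u = - 1" using z by linarith
  then show ?thesis
  proof cases
    case 1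
    have "hgt (face P u) z = - (z \<bullet> p)"
      by (rule hgt_eqI[OF in_F(1)]) (auto simp: p inner_add_right 1)
    moreover have "hgt (face P u) (- z) = z \<bullet> ?q"
      by (rule hgt_eqI[OF in_F(2)]) (auto simp: p inner_add_right 1)
    ultimately show ?thesis by (simp add: inner_add_right 1)
  next
    case 2
    have "hgt (face P u) z = - (z \<bullet> ?q)"
      by (rule hgt_eqI[OF in_F(2)]) (auto simp: p inner_add_right 2)
    moreover have "hgt (face P u) (- z) = z \<bullet> p"
      by (rule hgt_eqI[OF in_F(1)]) (auto simp: p inner_add_right 2)
    ultimately show ?thesis by (simp add: inner_add_right 2)
  qed
qed

text \<open>This is how the support function alone determines the length of a face.\<close>

lemma hgt_eventually:
  assumes V: "finite V" "V \<noteq> {}"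
  defines "P \<equiv> convex hull V"
  shows "\<forall>\<^sub>F m in sequentially. hgt P (real m *\<^sub>R u + z) = real m * hgt P u + hgt (face P u) z"
proof -
  have comp: "compact P" using V by (simp add: P_def compact_convex_hull finite_imp_compact)
  have conv: "convex P" by (simp add: P_def)
  have ne: "P \<noteq> {}" using V by (simp add: P_def)
  have cF: "compact (face P u)" "face P u \<noteq> {}"
    using comp conv ne compact_face face_nonempty by auto
  obtain p where p: "p \<in> face P u" "z \<bullet> p = - hgt (face P u) z" using hgt_attained[OF cF] by metis
  have pu: "p \<in> P" "u \<bullet> p = - hgt P u" using p comp by (auto simp: face_eq)
  have "\<forall>\<^sub>F m in sequentially. \<forall>x\<in>V. 0 \<le> real m * (u \<bullet> x + hgt P u) + (z \<bullet> x + hgt (face P u) z)"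
  proof (rule eventually_ball_finite[OF V(1)], rule ballI)
    fix x assume x: "x \<in> V"
    then have xP: "x \<in> P" by (simp add: P_def hull_inc)
    show "\<forall>\<^sub>F m in sequentially. 0 \<le> real m * (u \<bullet> x + hgt P u) + (z \<bullet> x + hgt (face P u) z)"
    \<comment> \<open>On the face the bound holds for every \<open>m\<close>. Off it,
      \<open>u\<close> has a positive gap, and \<open>m\<close> times this gap eventually outweighs
      the bounded term.\<close>
    proof (cases "x \<in> face P u")
      case True
      then have "z \<bullet> x \<ge> - hgt (face P u) z" using hgt_le[OF cF(1)] by blast
      moreover have "u \<bullet> x = - hgt P u" using True comp by (auto simp: face_eq)
      ultimately show ?thesis by simp
    next
      case False
      then have "u \<bullet> x + hgt P u > 0" using xP hgt_le[OF comp xP, of u] comp by (auto simp: face_eq)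
      then have "filterlim (\<lambda>m. real m * (u \<bullet> x + hgt P u)) at_top sequentially"
        by (intro filterlim_at_top_mult_tendsto_pos[OF tendsto_const] filterlim_real_sequentially)
      then have "\<forall>\<^sub>F m in sequentially. - (z \<bullet> x + hgt (face P u) z) \<le> real m * (u \<bullet> x + hgt P u)"
        by (simp add: filterlim_at_top)
      then show ?thesis by (rule eventually_mono) simp
    qed
  qed
  then show ?thesis
  proof (rule eventually_mono)
    fix m assume m: "\<forall>x\<in>V. 0 \<le> real m * (u \<bullet> x + hgt P u) + (z \<bullet> x + hgt (face P u) z)"
    show "hgt P (real m *\<^sub>R u + z) = real m * hgt P u + hgt (face P u) z"
    proof (rule hgt_eqI[OF pu(1)])
      show "(real m *\<^sub>R u + z) \<bullet> p = - (real m * hgt P u + hgt (face P u) z)"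
        using pu(2) p(2) by (simp add: inner_add_left)
      fix y assume "y \<in> P"
      then show "- (real m * hgt P u + hgt (face P u) z) \<le> (real m *\<^sub>R u + z) \<bullet> y"
        unfolding P_def
        by (rule convex_hull_inner_ge) (use m in \<open>auto simp: inner_add_left algebra_simps P_def\<close>)
    qed
  qed
qed

section \<open>Support functions of Fano polygons\<close>

definition verts :: "plane set \<Rightarrow> plane set" where
  "verts P = {v. v extreme_point_of P}"

definition nhgt :: "plane set \<Rightarrow> plane \<Rightarrow> nat" where
  "nhgt P u = nat \<lfloor>hgt P u\<rfloor>"

lemma
  assumes "fano_polygon P"
  shows fano_compact: "compact P" and fano_convex: "convex P" and fano_nonempty: "P \<noteq> {}"
    and fano_polytope: "polytope P" and fano_hull: "P = convex hull (verts P)"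
    and fano_finite_verts: "finite (verts P)" and fano_verts_nonempty: "verts P \<noteq> {}"
    and fano_verts_primitive: "v \<in> verts P \<Longrightarrow> primitive v"
    and fano_verts_lattice: "verts P \<subseteq> lattice_pts"
    and fano_verts_subset: "verts P \<subseteq> P"
proof -
  have P: "polytope P" "0 \<in> interior P" "\<And>v. v extreme_point_of P \<Longrightarrow> primitive v"
    using assms by (auto simp: fano_polygon_def)
  show "polytope P" by fact
  show c: "compact P" "convex P" using P polytope_imp_compact polytope_imp_convex by auto
  show ne: "P \<noteq> {}" using P interior_subset by blast
  show h: "P = convex hull (verts P)"
    using Krein_Milman_Minkowski[OF c] by (simp add: verts_def)
  show "finite (verts P)"
    using P(1) unfolding verts_def
    by (metis extreme_point_of_convex_hull finite_subset mem_Collect_eq polytope_def subsetI)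
  show "verts P \<noteq> {}" using h ne by force
  show "v \<in> verts P \<Longrightarrow> primitive v" using P by (simp add: verts_def)
  show "verts P \<subseteq> lattice_pts" using P primitive_lattice by (auto simp: verts_def)
  show "verts P \<subseteq> P" by (auto simp: verts_def extreme_point_of_def)
qed

lemma fano_hgt_pos:
  assumes "fano_polygon P" "u \<noteq> 0"
  shows "hgt P u > 0"
proof -
  obtain e where e: "e > 0" "ball 0 e \<subseteq> P"
    using assms(1) by (auto simp: fano_polygon_def mem_interior)
  define x where "x = (- (e / 2) / norm u) *\<^sub>R u"
  have "norm x < e" using e(1) assms(2) by (simp add: x_def)
  then have "x \<in> P" using e(2) by auto
  then have "- hgt P u \<le> u \<bullet> x" using hgt_le fano_compact assms(1) by blast
  also have "u \<bullet> x = - (e / 2) * norm u"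
    using assms(2) by (simp add: x_def dot_square_norm power2_eq_square)
  also have "\<dots> < 0" using e(1) assms(2) by simp
  finally show ?thesis by simp
qed

text \<open>Positive heights force the origin inside. A set contained in a line has two opposite
  heights with sum 0; and if the interior is nonempty but misses the origin, a separating line gives
  a direction of nonpositive height.\<close>

lemma fano_polygonI:
  assumes V: "finite V" "V \<noteq> {}" "\<And>v. v \<in> V \<Longrightarrow> primitive v"
    and pos: "\<And>u. u \<noteq> 0 \<Longrightarrow> hgt (convex hull V) u > 0"
  shows "fano_polygon (convex hull V)"
  unfolding fano_polygon_def
proof (intro conjI allI impI)
  let ?P = "convex hull V"
  show "polytope ?P" using V(1) by (auto simp: polytope_def)
  show "primitive v" if "v extreme_point_of ?P" for v
    using that V(3) extreme_point_of_convex_hull by blast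
  have comp: "compact ?P" using V by (simp add: compact_convex_hull finite_imp_compact)
  have ne: "?P \<noteq> {}" using V by simp
  have int: "interior ?P \<noteq> {}"
  proof
    assume "interior ?P = {}"
    then obtain a b where ab: "a \<noteq> 0" "?P \<subseteq> {x. a \<bullet> x = b}"
      using empty_interior_subset_hyperplane convex_convex_hull by metis
    obtain x where x: "x \<in> V" using V by auto
    have "a \<bullet> y = b" if "y \<in> ?P" for y using ab that by blast
    then have "hgt ?P a = - b" "hgt ?P (- a) = b"
      using hull_inc[OF x, of convex] by (intro hgt_eqI[of x]; simp)+
    then show False using pos[of a] pos[of "- a"] ab by simp
  qed
  show "0 \<in> interior ?P"
  proof (rule ccontr)
    assume "0 \<notin> interior ?P"
    then obtain a where a: "a \<noteq> 0" "\<forall>x\<in>interior ?P. 0 \<le> a \<bullet> x"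
      using separating_hyperplane_set_0[of "interior ?P"] convex_interior convex_convex_hull by metis
    have "closure (interior ?P) \<subseteq> {x. 0 \<le> a \<bullet> x}"
      using a(2) by (intro closure_minimal closed_halfspace_ge) auto
    moreover have "closure (interior ?P) = ?P"
      using convex_closure_interior[OF convex_convex_hull int] comp
      by (metis closure_closed compact_imp_closed)
    ultimately have *: "?P \<subseteq> {x. 0 \<le> a \<bullet> x}" by simp
    obtain x where "x \<in> ?P" "a \<bullet> x = - hgt ?P a" using hgt_attained[OF comp ne] by metis
    then show False using * pos[OF a(1)] by force
  qed
qed

lemma hgt_Ints:
  assumes "fano_polygon P" "u \<in> lattice_pts"
  shows "hgt P u \<in> \<int>"
proof -
  obtain p where p: "p \<in> verts P" "p \<in> face P u"
    using hull_face_vertex[of "verts P" u] fano_finite_verts fano_verts_nonempty fano_hull assms(1)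
    by metis
  then have "u \<bullet> p = - hgt P u" using face_eq fano_compact[OF assms(1)] by auto
  moreover have "u \<bullet> p \<in> \<int>" using p fano_verts_lattice assms by (blast intro: lattice_pts_inner)
  ultimately show ?thesis by (metis Ints_minus minus_minus)
qed

lemma real_nhgt:
  assumes "fano_polygon P" "primitive u"
  shows "real (nhgt P u) = hgt P u"
proof -
  obtain k :: int where k: "hgt P u = of_int k"
    using hgt_Ints[OF assms(1)] assms(2) primitive_lattice by (metis Ints_cases)
  then have "k > 0" using fano_hgt_pos[OF assms(1), of u] primitive_nonzero[OF assms(2)] by simp
  then show ?thesis by (simp add: nhgt_def k)
qed

lemma nhgt_pos: "fano_polygon P \<Longrightarrow> primitive u \<Longrightarrow> nhgt P u > 0"
  using real_nhgt[of P u] fano_hgt_pos[of P u] primitive_nonzero[of u] by simp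

lemma fano_face_ends:
  assumes "fano_polygon P" "primitive u"
  obtains p where "p \<in> verts P" "p + real (wid P u) *\<^sub>R quarter_turn u \<in> verts P"
    "face P u = {p + t *\<^sub>R quarter_turn u | t. 0 \<le> t \<and> t \<le> real (wid P u)}"
    "u \<bullet> p = - hgt P u"
proof -
  note h = fano_hull[OF assms(1), symmetric]
  obtain p where p: "p \<in> verts P" "p + real (wid P u) *\<^sub>R quarter_turn u \<in> verts P"
    "face P u = {p + t *\<^sub>R quarter_turn u | t. 0 \<le> t \<and> t \<le> real (wid P u)}"
    by (rule face_ends[OF fano_finite_verts[OF assms(1)] fano_verts_nonempty[OF assms(1)]
      fano_verts_lattice[OF assms(1)] assms(2), unfolded h])
  have "p \<in> face P u" by (subst p(3), force)
  then have "u \<bullet> p = - hgt P u" using face_eq[OF fano_compact[OF assms(1)]] by auto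
  then show thesis using that p by blast
qed

section \<open>Edges of a Fano polygon indexed by their primitive inner normals\<close>

lemma normalsD: "u \<in> normals P \<Longrightarrow> primitive u" "u \<in> normals P \<Longrightarrow> wid P u > 0"
  by (simp_all add: normals_def)

lemma normalsI:
  assumes "fano_polygon P" "primitive u" "x \<in> face P u" "y \<in> face P u" "x \<noteq> y"
  shows "u \<in> normals P"
proof -
  obtain p where p: "face P u = {p + t *\<^sub>R quarter_turn u | t. 0 \<le> t \<and> t \<le> real (wid P u)}"
    by (rule fano_face_ends[OF assms(1,2)])
  have "wid P u \<noteq> 0"
  proof
    assume "wid P u = 0"
    then have "face P u = {p}" using p by auto
    then show False using assms by auto
  qed
  then show ?thesis using assms(2) by (simp add: normals_def)
qed

lemma face_scale:
  assumes "c > 0"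
  shows "face P (c *\<^sub>R u) = face P u"
  using assms by (auto simp: face_def)

text \<open>Two primitive normals of the same segment agree up to sign, and opposite signs would
  make the heights in opposite directions cancel although both are positive.\<close>

lemma face_normals_inj:
  assumes P: "fano_polygon P" and u: "u \<in> normals P" and u': "primitive u'"
    and eq: "face P u = face P u'"
  shows "u = u'"
proof -
  have pu: "primitive u" and w: "wid P u > 0" using u by (auto simp: normals_def)
  obtain p where p: "face P u = {p + t *\<^sub>R quarter_turn u | t. 0 \<le> t \<and> t \<le> real (wid P u)}"
    by (rule fano_face_ends[OF P pu])
  have "p \<in> face P u" "p + real (wid P u) *\<^sub>R quarter_turn u \<in> face P u" by (subst p, force)+
  then have "u \<bullet> p = - hgt P u" "u' \<bullet> p = - hgt P u'"
    "u' \<bullet> (p + real (wid P u) *\<^sub>R quarter_turn u) = - hgt P u'"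
    using eq face_eq[OF fano_compact[OF P]] by auto
  then have "u' \<bullet> quarter_turn u = 0" using w by (simp add: inner_add_right)
  then have "u' = u \<or> u' = - u" using primitive_parallel pu u' by blast
  moreover have False if "u' = - u"
  proof -
    have "hgt P (- u) = - hgt P u"
      using \<open>u' \<bullet> p = - hgt P u'\<close> \<open>u \<bullet> p = - hgt P u\<close> that by simp
    then show False
      using fano_hgt_pos[OF P, of u] fano_hgt_pos[OF P, of "- u"] primitive_nonzero[OF pu] by simp
  qed
  ultimately show ?thesis by auto
qed

lemma edge_of_iff:
  assumes P: "fano_polygon P"
  shows "E edge_of P \<longleftrightarrow> (\<exists>u\<in>normals P. E = face P u)"
proof
  assume "\<exists>u\<in>normals P. E = face P u"
  then obtain u where u: "u \<in> normals P" and E: "E = face P u" by blast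
  have pu: "primitive u" and w: "wid P u > 0" using u by (auto simp: normals_def)
  obtain p where p: "face P u = {p + t *\<^sub>R quarter_turn u | t. 0 \<le> t \<and> t \<le> real (wid P u)}"
    by (rule fano_face_ends[OF P pu])
  let ?J = "quarter_turn u" and ?k = "real (wid P u)"
  have "face P u = closed_segment p (p + ?k *\<^sub>R ?J)"
  proof (intro set_eqI iffI)
    fix x assume "x \<in> face P u"
    then obtain t where t: "x = p + t *\<^sub>R ?J" "0 \<le> t" "t \<le> ?k" using p by blast
    then show "x \<in> closed_segment p (p + ?k *\<^sub>R ?J)"
      using w by (auto simp: in_segment algebra_simps intro!: exI[of _ "t / ?k"])
  next
    fix x assume "x \<in> closed_segment p (p + ?k *\<^sub>R ?J)"
    then obtain s where s: "0 \<le> s" "s \<le> 1" "x = (1 - s) *\<^sub>R p + s *\<^sub>R (p + ?k *\<^sub>R ?J)"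
      by (auto simp: in_segment)
    have "x = p + (s * ?k) *\<^sub>R ?J" by (simp add: s algebra_simps)
    moreover have "0 \<le> s * ?k" "s * ?k \<le> ?k" using s w by (auto intro: mult_left_le_one_le)
    ultimately show "x \<in> face P u" using p by blast
  qed
  moreover have "?k *\<^sub>R ?J \<noteq> 0" using w pu primitive_nonzero[of ?J] by simp
  ultimately have "aff_dim (face P u) = 1" by (simp add: segment_convex_hull aff_dim_convex_hull)
  then show "E edge_of P"
    using E face_face_of[OF fano_compact[OF P] fano_convex[OF P]] by (simp add: edge_of_def)
next
  assume "E edge_of P"
  then have E: "E face_of P" "aff_dim E = 1" by (auto simp: edge_of_def)
  have "E exposed_face_of P"
    using E(1) fano_polytope[OF P] exposed_face_of_polyhedron polytope_imp_polyhedron by blast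
  then obtain a b where ab: "P \<subseteq> {x. a \<bullet> x \<le> b}" "E = P \<inter> {x. a \<bullet> x = b}"
    by (auto simp: exposed_face_of_def)
  have Ene: "E \<noteq> {}" using E(2) by auto
  have "aff_dim P = 2"
    using P aff_dim_nonempty_interior[of P] by (auto simp: fano_polygon_def)
  then have a0: "a \<noteq> 0" using E(2) ab Ene by auto
  have EF: "E = face P (- a)"
  proof -
    obtain e where "e \<in> E" using Ene by blast
    then show ?thesis using ab by (auto simp: face_def intro: antisym)
  qed
  have hull: "E = convex hull (verts P \<inter> E)"
    using face_convex_hull[OF fano_finite_verts[OF P], of "- a"] fano_hull[OF P] EF by simp
  \<comment> \<open>The exposing normal \<open>a\<close> is only real. Two lattice vertices on the
    edge make its direction rational, so that \<open>a\<close> can be rescaled to a primitive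
    vector.\<close>
  have "\<exists>p q. p \<in> verts P \<inter> E \<and> q \<in> verts P \<inter> E \<and> p \<noteq> q"
  proof (rule ccontr)
    assume "\<not> ?thesis"
    then have "verts P \<inter> E = {} \<or> (\<exists>p. verts P \<inter> E = {p})" by blast
    then have "E = {} \<or> (\<exists>p. E = {p})" using hull by (metis convex_hull_empty convex_hull_singleton)
    then show False using E(2) Ene by auto
  qed
  then obtain p q where pq: "p \<in> verts P" "q \<in> verts P" "p \<in> E" "q \<in> E" "p \<noteq> q" by blast
  have "q - p \<in> lattice_pts" "q - p \<noteq> 0"
    using pq(5) lattice_pts_diff[OF subsetD[OF fano_verts_lattice[OF P] pq(2)]
      subsetD[OF fano_verts_lattice[OF P] pq(1)]] by simp_all
  then obtain d and k :: nat where d: "primitive d" "k > 0" "q - p = real k *\<^sub>R d"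
    using primitive_direction by metis
  have "a \<bullet> (q - p) = 0" using pq ab by (simp add: inner_diff_right)
  then have "d \<bullet> a = 0" using d by (simp add: inner_commute)
  then obtain c where c: "a = c *\<^sub>R quarter_turn d"
    using orthogonal_multiple[of d a] primitive_nonzero[OF d(1)] by metis
  have "c \<noteq> 0" using a0 c by auto
  define u where "u = (if c > 0 then - quarter_turn d else quarter_turn d)"
  have "- a = \<bar>c\<bar> *\<^sub>R u" by (simp add: c u_def)
  then have "face P (- a) = face P u" using \<open>c \<noteq> 0\<close> by (simp add: face_scale)
  then have Eu: "E = face P u" using EF by simp
  moreover have "primitive u" using d(1) by (simp add: u_def)
  ultimately have "u \<in> normals P" using normalsI[OF P] pq by metis
  then show "\<exists>u\<in>normals P. E = face P u" using Eu by blast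
qed

lemma bij_betw_face_edges:
  assumes "fano_polygon P"
  shows "bij_betw (face P) (normals P) {E. E edge_of P}"
  unfolding bij_betw_def
  using edge_of_iff[OF assms] face_normals_inj[OF assms]
  by (auto simp: inj_on_def normals_def)

lemma finite_normals:
  assumes "fano_polygon P"
  shows "finite (normals P)"
proof -
  have "{E. E edge_of P} \<subseteq> {F. F face_of P}" by (auto simp: edge_of_def)
  then have "finite {E. E edge_of P}"
    using finite_polytope_faces[OF fano_polytope[OF assms]] finite_subset by blast
  then show ?thesis using bij_betw_face_edges[OF assms] bij_betw_finite by blast
qed

lemma inner_normal_iff: "inner_normal P E w \<longleftrightarrow> primitive w \<and> E = face P w"
  by (simp add: inner_normal_def face_def)

text \<open>The description in \<open>edge_height\<close> is definite because an edge has only one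
  primitive inner normal.\<close>

lemma edge_height_face:
  assumes P: "fano_polygon P" and u: "u \<in> normals P"
  shows "edge_height P (face P u) = nhgt P u"
  unfolding edge_height_def
proof (rule the_equality)
  have pu: "primitive u" using u normalsD by blast
  show "\<exists>w. inner_normal P (face P u) w \<and> (\<forall>v\<in>face P u. w \<bullet> v = - real (nhgt P u))"
    using pu by (intro exI[of _ u])
      (auto simp: inner_normal_iff real_nhgt[OF P] face_eq[OF fano_compact[OF P]])
  fix r assume "\<exists>w. inner_normal P (face P u) w \<and> (\<forall>v\<in>face P u. w \<bullet> v = - real r)"
  then obtain w where w: "primitive w" "face P u = face P w" "\<forall>v\<in>face P u. w \<bullet> v = - real r"
    by (auto simp: inner_normal_iff)
  have uw: "u = w" using face_normals_inj[OF P u w(1,2)] .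
  obtain x where "x \<in> face P u" using face_nonempty fano_compact[OF P] fano_nonempty[OF P] by blast
  then have "w \<bullet> x = - real r" "u \<bullet> x = - hgt P u"
    using w(3) face_eq[OF fano_compact[OF P]] by auto
  then have "real r = hgt P u" using uw by simp
  then show "r = nhgt P u" using real_nhgt[OF P pu] by simp
qed

lemma only_T_iff:
  assumes "fano_polygon P"
  shows "only_T_singularities P \<longleftrightarrow> (\<forall>u\<in>normals P. nhgt P u dvd wid P u)"
  using edge_of_iff[OF assms] edge_height_face[OF assms]
  by (auto simp: only_T_singularities_def wid_def)

text \<open>Both the Euler number and the boundary length of \<open>P\<close> are sums of this kind.\<close>

definition normal_sum :: "(nat \<Rightarrow> nat \<Rightarrow> nat) \<Rightarrow> plane set \<Rightarrow> nat" where
  "normal_sum f P = (\<Sum>u\<in>normals P. f (wid P u) (nhgt P u))"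

lemma smoothing_euler_number_eq:
  assumes "fano_polygon P"
  shows "smoothing_euler_number P = normal_sum (div) P"
proof -
  have "smoothing_euler_number P
      = (\<Sum>u\<in>normals P. edge_width (face P u) div edge_height P (face P u))"
    unfolding smoothing_euler_number_def
    by (rule sum.reindex_bij_betw[OF bij_betw_face_edges[OF assms], symmetric])
  then show ?thesis
    by (simp add: normal_sum_def wid_def[symmetric] edge_height_face[OF assms])
qed

section \<open>Unimodular maps\<close>

locale unimodular =
  fixes f :: "plane \<Rightarrow> plane"
  assumes lin: "linear f" and lattice: "f ` lattice_pts = lattice_pts"
begin

lemma surj_f: "surj f"
proof -
  have "x \<in> range f" for x
  proof -
    obtain a b where a: "f a = (1, 0)" and b: "f b = (0, 1)"
      using lattice lattice_pts_of_int[of 1 0] lattice_pts_of_int[of 0 1]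
      by (metis imageE of_int_0 of_int_1)
    have "f (fst x *\<^sub>R a + snd x *\<^sub>R b) = x"
      using lin by (simp add: linear_add linear_scale a b)
    then show ?thesis by (metis rangeI)
  qed
  then show ?thesis by auto
qed

lemma inj_f: "inj f"
  using lin surj_f linear_surjective_imp_injective by blast

lemma lattice_iff: "f x \<in> lattice_pts \<longleftrightarrow> x \<in> lattice_pts"
  using lattice inj_f by (metis image_iff inj_image_mem_iff)

text \<open>Normals belong to the dual lattice, so they move by the adjoint, from the image back to
  the original polygon.\<close>

lemma inner_adjoint: "adjoint f u \<bullet> x = u \<bullet> f x"
  using adjoint_works[OF lin] by (metis inner_commute)

lemma linear_adjoint: "linear (adjoint f)"
  using lin by (rule adjoint_linear)

lemma inj_adjoint: "inj (adjoint f)"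
proof -
  have "u = 0" if "adjoint f u = 0" for u
  proof -
    obtain x where "f x = u" using surj_f by (metis surjD)
    then have "u \<bullet> u = 0" using inner_adjoint[of u x] that by simp
    then show ?thesis by simp
  qed
  then show ?thesis using linear_adjoint by (simp add: linear_injective_0)
qed

lemma surj_adjoint: "surj (adjoint f)"
  using linear_adjoint inj_adjoint linear_injective_imp_surjective by blast

lemma lattice_integral:
  assumes "\<And>x. x \<in> lattice_pts \<Longrightarrow> u \<bullet> x \<in> \<int>"
  shows "u \<in> lattice_pts"
  using assms[of "(of_int 1, of_int 0)"] assms[of "(of_int 0, of_int 1)"]
  by (simp add: lattice_pts_iff inner_plane)

lemma adjoint_lattice_iff: "adjoint f u \<in> lattice_pts \<longleftrightarrow> u \<in> lattice_pts"
proof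
  assume "adjoint f u \<in> lattice_pts"
  then have "u \<bullet> f x \<in> \<int>" if "x \<in> lattice_pts" for x
    using lattice_pts_inner that inner_adjoint by metis
  then have "u \<bullet> y \<in> \<int>" if "y \<in> lattice_pts" for y
    using that lattice by (metis imageE)
  then show "u \<in> lattice_pts" by (rule lattice_integral)
next
  assume "u \<in> lattice_pts"
  then show "adjoint f u \<in> lattice_pts"
    by (intro lattice_integral) (simp add: inner_adjoint lattice_pts_inner lattice_iff)
qed

lemma primitive_adjoint_iff: "primitive (adjoint f u) \<longleftrightarrow> primitive u"
proof -
  have "(\<exists>x\<in>lattice_pts. u \<bullet> f x = 1) \<longleftrightarrow> (\<exists>y\<in>f ` lattice_pts. u \<bullet> y = 1)" by blast
  then show ?thesis unfolding primitive_iff adjoint_lattice_iff inner_adjoint lattice by simp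
qed

lemma primitive_f_iff: "primitive (f x) \<longleftrightarrow> primitive x"
proof -
  have "(\<exists>y\<in>lattice_pts. f x \<bullet> y = 1) \<longleftrightarrow> (\<exists>y\<in>lattice_pts. x \<bullet> y = 1)"
  proof
    assume "\<exists>y\<in>lattice_pts. f x \<bullet> y = 1"
    then obtain y where "y \<in> lattice_pts" "f x \<bullet> y = 1" by blast
    then have "adjoint f y \<in> lattice_pts" "x \<bullet> adjoint f y = 1"
      using adjoint_lattice_iff inner_adjoint by (auto simp: inner_commute)
    then show "\<exists>y\<in>lattice_pts. x \<bullet> y = 1" by blast
  next
    assume "\<exists>y\<in>lattice_pts. x \<bullet> y = 1"
    then obtain y where y: "y \<in> lattice_pts" "x \<bullet> y = 1" by blast
    obtain z where z: "y = adjoint f z" using surj_adjoint by (metis surjD)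
    then show "\<exists>y\<in>lattice_pts. f x \<bullet> y = 1"
      using y adjoint_lattice_iff inner_adjoint by (metis inner_commute)
  qed
  then show ?thesis by (simp add: primitive_iff lattice_iff)
qed

lemma hgt_image: "hgt (f ` P) u = hgt P (adjoint f u)"
  by (simp add: hgt_def image_image inner_adjoint)

lemma face_image: "face (f ` P) u = f ` face P (adjoint f u)"
  by (auto simp: face_def inner_adjoint)

lemma wid_image: "wid (f ` P) u = wid P (adjoint f u)"
proof -
  have "f ` S \<inter> lattice_pts = f ` (S \<inter> lattice_pts)" for S
    using lattice inj_f by (metis image_Int)
  then show ?thesis
    by (simp add: wid_def edge_width_def face_image card_image inj_on_subset[OF inj_f])
qed

lemma normals_image: "u \<in> normals (f ` P) \<longleftrightarrow> adjoint f u \<in> normals P"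
  by (simp add: normals_def wid_image primitive_adjoint_iff)

lemma bij_normals_image: "bij_betw (adjoint f) (normals (f ` P)) (normals P)"
  unfolding bij_betw_def
proof
  show "inj_on (adjoint f) (normals (f ` P))" using inj_adjoint inj_on_subset by blast
  show "adjoint f ` normals (f ` P) = normals P"
  proof (intro set_eqI iffI)
    fix u assume "u \<in> normals P"
    moreover obtain x where "u = adjoint f x" using surj_adjoint by (rule surjE)
    ultimately show "u \<in> adjoint f ` normals (f ` P)" using normals_image by blast
  qed (use normals_image in blast)
qed

lemma normal_sum_image: "normal_sum g (f ` P) = normal_sum g P"
  unfolding normal_sum_def
  by (subst sum.reindex_bij_betw[OF bij_normals_image, symmetric])
     (simp add: wid_image nhgt_def hgt_image)

lemma fano_image:
  assumes "fano_polygon P"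
  shows "fano_polygon (f ` P)"
proof -
  have eq: "f ` P = convex hull (f ` verts P)"
    using fano_hull[OF assms] convex_hull_linear_image[OF lin] by metis
  have "fano_polygon (convex hull (f ` verts P))"
  proof (rule fano_polygonI)
    show "finite (f ` verts P)" "f ` verts P \<noteq> {}"
      using fano_finite_verts fano_verts_nonempty assms by auto
    show "primitive v" if "v \<in> f ` verts P" for v
      using that fano_verts_primitive[OF assms] primitive_f_iff by auto
    show "0 < hgt (convex hull f ` verts P) u" if "u \<noteq> 0" for u
    proof -
      have "adjoint f u \<noteq> 0"
        using that inj_adjoint linear_adjoint by (metis injD linear_0)
      then show ?thesis using fano_hgt_pos[OF assms] by (simp add: eq[symmetric] hgt_image)
    qed
  qed
  then show ?thesis using eq by simp
qed

lemma only_T_image: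
  assumes "fano_polygon P" "only_T_singularities P"
  shows "only_T_singularities (f ` P)"
  using assms fano_image
  by (auto simp: only_T_iff normals_image wid_image nhgt_def hgt_image)

end

lemma gl2_equivalent_iff: "gl2_equivalent P Q \<longleftrightarrow> (\<exists>f. unimodular f \<and> Q = f ` P)"
  by (auto simp: gl2_equivalent_def unimodular_def)

lemma unimodular_matrix:
  fixes a b c d :: int
  assumes "\<bar>a * d - b * c\<bar> = 1"
  shows "unimodular (\<lambda>x. (of_int a * fst x + of_int b * snd x, of_int c * fst x + of_int d * snd x))"
    (is "unimodular ?f")
proof (rule unimodular.intro)
  show "linear ?f" by (rule linearI) (simp_all add: algebra_simps)
  show "?f ` lattice_pts = lattice_pts"
  proof (intro set_eqI iffI)
    fix x assume "x \<in> ?f ` lattice_pts"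
    then show "x \<in> lattice_pts" by (auto simp: lattice_pts_iff)
  next
    fix x :: plane assume "x \<in> lattice_pts"
    then obtain m n :: int where x: "x = (of_int m, of_int n)" by (rule lattice_ptsE)
    \<comment> \<open>The determinant is its own inverse, so the inverse matrix is \<open>e\<close>
      times the adjugate; this gives the preimage below.\<close>
    define e where "e = a * d - b * c"
    have "e = 1 \<or> e = - 1" using assms by (auto simp: e_def)
    then have e: "e * e = 1" by auto
    have "a * (e * (d * m - b * n)) + b * (e * (a * n - c * m)) = e * e * m"
      "c * (e * (d * m - b * n)) + d * (e * (a * n - c * m)) = e * e * n"
      by (simp_all add: e_def algebra_simps)
    then have "x = ?f (of_int (e * (d * m - b * n)), of_int (e * (a * n - c * m)))"
      by (simp only: x e fst_conv snd_conv of_int_mult[symmetric] of_int_add[symmetric] mult_1)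
    then show "x \<in> ?f ` lattice_pts" by (rule rev_image_eqI[OF lattice_pts_of_int])
  qed
qed

section \<open>Mutation acts on support functions by a piecewise linear map\<close>

text \<open>The identity on the half-plane \<open>u \<bullet> v \<ge> 0\<close> and, when
  \<open>w \<bullet> v = 0\<close>, a shear along \<open>w\<close> on the other one. The two parts
  agree on the fold \<open>u \<bullet> v = 0\<close>, the line spanned by \<open>w\<close>.\<close>

definition bend :: "plane \<Rightarrow> plane \<Rightarrow> plane \<Rightarrow> plane" where
  "bend w v u = u - min 0 (u \<bullet> v) *\<^sub>R w"

text \<open>For \<open>w \<bullet> v = 0\<close> and among nonempty compact convex sets, this
  relation determines \<open>Q\<close>, so the choice of the pieces \<open>G\<close>
  disappears.\<close>

definition same_hgt :: "plane \<Rightarrow> plane \<Rightarrow> plane set \<Rightarrow> plane set \<Rightarrow> bool" where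
  "same_hgt w v P Q \<longleftrightarrow> (\<forall>u. hgt Q (bend w v u) = hgt P u)"

lemma bend_bend: "w \<bullet> v = 0 \<Longrightarrow> bend (- w) v (bend w v u) = u"
  by (simp add: bend_def inner_diff_left)

lemma bend_inner: "w \<bullet> v = 0 \<Longrightarrow> bend w v u \<bullet> v = u \<bullet> v"
  by (simp add: bend_def inner_diff_left)

lemma bend_nonneg: "u \<bullet> v \<ge> 0 \<Longrightarrow> bend w v u = u"
  by (simp add: bend_def)

lemma bend_neg: "u \<bullet> v \<le> 0 \<Longrightarrow> bend w v u = u - (u \<bullet> v) *\<^sub>R w"
  by (simp add: bend_def)

text \<open>All positive multiples of \<open>v\<close> define the same half-plane, on which the
  shears add up. Hence a chain of mutations in one direction is described by a single factor
  \<open>real j *\<^sub>R v\<close>.\<close>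

lemma bend_scale:
  assumes "c \<ge> 0" "w \<bullet> v = 0"
  shows "bend w v (bend w (c *\<^sub>R v) u) = bend w ((c + 1) *\<^sub>R v) u"
proof (cases "u \<bullet> v \<ge> 0")
  case True then show ?thesis using assms by (simp add: bend_nonneg)
next
  case False
  then have neg: "c * (u \<bullet> v) \<le> 0" "(c + 1) * (u \<bullet> v) \<le> 0"
    using assms by (auto intro: mult_nonneg_nonpos)
  have e: "bend w (c *\<^sub>R v) u = u - (c * (u \<bullet> v)) *\<^sub>R w"
    "bend w ((c + 1) *\<^sub>R v) u = u - ((c + 1) * (u \<bullet> v)) *\<^sub>R w"
    using neg bend_neg[of u "c *\<^sub>R v" w] bend_neg[of u "(c + 1) *\<^sub>R v" w] by simp_all
  show ?thesis
    unfolding e using False assms(2) by (simp add: bend_neg inner_diff_left algebra_simps)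
qed

text \<open>If \<open>x\<close> witnesses primitivity of \<open>u\<close>, its shear along
  \<open>v\<close> in the dual plane witnesses it after bending.\<close>

lemma primitive_bend:
  assumes "primitive w" "primitive v" "w \<bullet> v = 0" "primitive u"
  shows "primitive (bend w v u)"
proof (cases "u \<bullet> v \<ge> 0")
  case True then show ?thesis using assms by (simp add: bend_nonneg)
next
  case False
  obtain x where x: "x \<in> lattice_pts" "u \<bullet> x = 1" using assms by (auto simp: primitive_iff)
  have L: "u \<in> lattice_pts" "v \<in> lattice_pts" "w \<in> lattice_pts"
    using assms primitive_lattice by auto
  have "bend w v u \<bullet> (x + (w \<bullet> x) *\<^sub>R v) = 1"
    using False x assms(3) by (simp add: bend_def inner_add_right inner_diff_left)
  moreover have "bend w v u \<in> lattice_pts" "x + (w \<bullet> x) *\<^sub>R v \<in> lattice_pts"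
    using False L x
    by (auto simp: bend_def intro!: lattice_pts_diff lattice_pts_add lattice_pts_scale lattice_pts_inner)
  ultimately show ?thesis unfolding primitive_iff by blast
qed

lemma slice_subset:
  assumes "convex P"
  shows "slice w P h \<subseteq> P \<inter> {x. w \<bullet> x = of_int h}"
  unfolding slice_def
  by (rule hull_minimal) (use assms in \<open>auto intro: convex_Int convex_hyperplane\<close>)

lemma same_hgtI:
  assumes ge: "\<And>u y. y \<in> S \<Longrightarrow> - hgt P u \<le> bend w v u \<bullet> y"
    and ex: "\<And>u. \<exists>y\<in>S. bend w v u \<bullet> y \<le> - hgt P u"
  shows "same_hgt w v P (convex hull S)"
  unfolding same_hgt_def
proof
  fix u
  obtain y where y: "y \<in> S" "bend w v u \<bullet> y \<le> - hgt P u" using ex by blast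
  show "hgt (convex hull S) (bend w v u) = hgt P u"
  proof (rule hgt_eqI[of y])
    show "y \<in> convex hull S" using y by (simp add: hull_inc)
    show "bend w v u \<bullet> y = - hgt P u" using ge[OF y(1), of u] y(2) by simp
    show "- hgt P u \<le> bend w v u \<bullet> x" if "x \<in> convex hull S" for x
      using that ge by (rule convex_hull_inner_ge)
  qed
qed

lemma segment_0: "convex hull {0, v :: plane} = {t *\<^sub>R v | t. 0 \<le> t \<and> t \<le> 1}"
  by (auto simp: segment_convex_hull[symmetric] in_segment)

definition mutation_gens :: "plane \<Rightarrow> plane set \<Rightarrow> plane set \<Rightarrow> (int \<Rightarrow> plane set) \<Rightarrow> plane set" where
  "mutation_gens w P F G = (\<Union>h \<in> neg_heights w P. G h) \<union>
      (\<Union>h \<in> nonneg_heights w P. slice w P h + (*\<^sub>R) (of_int h) ` F)"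

lemma mut_eq_gens: "mut w P F G = convex hull mutation_gens w P F G"
  by (simp add: mut_def mutation_gens_def)

lemma mutation_data_slice:
  assumes G: "mutation_data w P (convex hull {0, v}) G" and that: "h \<in> neg_heights w P" "g \<in> G h"
  shows "g \<in> slice w P h" and "g + of_int \<bar>h\<bar> *\<^sub>R v \<in> slice w P h"
proof -
  have sub: "G h + (*\<^sub>R) (of_int \<bar>h\<bar>) ` (convex hull {0, v}) \<subseteq> slice w P h"
    using G that(1) by (auto simp: mutation_data_def)
  have F: "0 \<in> (convex hull {0, v})" "v \<in> (convex hull {0, v})" by (auto intro: hull_inc)
  have "g + of_int \<bar>h\<bar> *\<^sub>R 0 \<in> G h + (*\<^sub>R) (of_int \<bar>h\<bar>) ` (convex hull {0, v})"
    using that(2) F(1) by (intro set_plus_intro imageI)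
  then show "g \<in> slice w P h" using sub by auto
  have "g + of_int \<bar>h\<bar> *\<^sub>R v \<in> G h + (*\<^sub>R) (of_int \<bar>h\<bar>) ` (convex hull {0, v})"
    using that(2) F(2) by (intro set_plus_intro imageI)
  then show "g + of_int \<bar>h\<bar> *\<^sub>R v \<in> slice w P h" using sub by auto
qed

text \<open>Below height 0 a generator \<open>g\<close> has both ends \<open>g\<close> and
  \<open>g + of_int \<bar>h\<bar> *\<^sub>R v\<close> of its fibre in \<open>P\<close>, and the bent
  functional at \<open>g\<close> is the old one at one of these ends. From height 0 on, the segment
  added to a point of \<open>P\<close> cannot lower the bent functional below its old value.\<close>

lemma mutation_gens_ge:
  assumes P: "fano_polygon P" and wv: "w \<bullet> v = 0"
    and G: "mutation_data w P (convex hull {0, v}) G"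
    and y: "y \<in> mutation_gens w P (convex hull {0, v}) G"
  shows "- hgt P u \<le> bend w v u \<bullet> y"
proof -
  let ?F = "convex hull {0, v}"
  note comp = fano_compact[OF P]
  have sl: "x \<in> P" "w \<bullet> x = of_int h" if "x \<in> slice w P h" for x h
    using slice_subset[OF fano_convex[OF P], of w h] that by auto
  note Gsl = mutation_data_slice[OF G]
  show ?thesis
    using y unfolding mutation_gens_def
  proof
    assume "y \<in> (\<Union>h \<in> neg_heights w P. G h)"
    then obtain h where h: "h \<in> neg_heights w P" "y \<in> G h" by auto
    have neg: "h < 0" using h by (simp add: neg_heights_def)
    have y: "y \<in> P" "w \<bullet> y = of_int h" and y': "y - of_int h *\<^sub>R v \<in> P"
      using sl Gsl[OF h] neg by auto
    have "bend w v u \<bullet> y = u \<bullet> y - min 0 (u \<bullet> v) * of_int h"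
      by (simp add: bend_def inner_diff_left y)
    moreover have "u \<bullet> y - u \<bullet> v * of_int h = u \<bullet> (y - of_int h *\<^sub>R v)"
      by (simp add: inner_diff_right)
    ultimately have "bend w v u \<bullet> y = u \<bullet> y \<or> bend w v u \<bullet> y = u \<bullet> (y - of_int h *\<^sub>R v)"
      by (auto simp: min_def)
    then show ?thesis using hgt_le[OF comp y(1), of u] hgt_le[OF comp y', of u] by auto
  next
    assume "y \<in> (\<Union>h \<in> nonneg_heights w P. slice w P h + (*\<^sub>R) (of_int h) ` ?F)"
    then obtain h p t where h: "h \<in> nonneg_heights w P" "p \<in> slice w P h"
      and t: "0 \<le> t" "t \<le> 1" and y: "y = p + of_int h *\<^sub>R t *\<^sub>R v"
      by (auto simp: segment_0 elim!: set_plus_elim)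
    have nn: "(of_int h :: real) \<ge> 0" using h by (simp add: nonneg_heights_def)
    have "bend w v u \<bullet> y = u \<bullet> p + of_int h * (t * (u \<bullet> v) - min 0 (u \<bullet> v))"
      using sl[OF h(2)] wv by (simp add: y bend_def inner_diff_left inner_add_right algebra_simps)
    moreover have "t * (u \<bullet> v) - min 0 (u \<bullet> v) \<ge> 0"
    proof (cases "u \<bullet> v \<ge> 0")
      case False
      then have "1 * (u \<bullet> v) \<le> t * (u \<bullet> v)" using t by (intro mult_right_mono_neg) auto
      then show ?thesis using False by simp
    qed (use t in simp)
    ultimately have "u \<bullet> p \<le> bend w v u \<bullet> y" using nn by simp
    then show ?thesis using hgt_le[OF comp sl(1)[OF h(2)], of u] by linarith
  qed
qed

text \<open>One inequality is \<open>mutation_gens_ge\<close>. For the other, the old minimum is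
  attained at a vertex. If it has negative height, the mutation data put it on the fibre of some
  \<open>g\<close>, where the bent functional is no larger; otherwise an end of the added segment
  will do.\<close>

lemma mutation_data_same_hgt:
  assumes P: "fano_polygon P" and w: "w \<in> lattice_pts" and wv: "w \<bullet> v = 0"
    and G: "mutation_data w P (convex hull {0, v}) G"
  shows "same_hgt w v P (mut w P (convex hull {0, v}) G)"
  unfolding mut_eq_gens
proof (rule same_hgtI)
  let ?F = "convex hull {0, v}"
  let ?S = "mutation_gens w P ?F G"
  show "- hgt P u \<le> bend w v u \<bullet> y" if "y \<in> ?S" for u y
    using mutation_gens_ge[OF P wv G that] .
  note comp = fano_compact[OF P]
  have sl: "x \<in> P" "w \<bullet> x = of_int h" if "x \<in> slice w P h" for x h
    using slice_subset[OF fano_convex[OF P], of w h] that by auto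
  note Gsl = mutation_data_slice[OF G]
  fix u
  show "\<exists>y\<in>?S. bend w v u \<bullet> y \<le> - hgt P u"
  proof -
    obtain p where p: "p \<in> verts P" "p \<in> face P u"
      using hull_face_vertex[OF fano_finite_verts[OF P] fano_verts_nonempty[OF P], of u]
      unfolding fano_hull[OF P, symmetric] by metis
    have pu: "u \<bullet> p = - hgt P u" and pP: "p \<in> P" using p face_eq[OF comp] by auto
    have pL: "p \<in> lattice_pts" using p(1) fano_verts_lattice[OF P] by auto
    obtain h where h: "w \<bullet> p = of_int h"
      using lattice_pts_inner[OF w pL] by (rule Ints_cases)
    show ?thesis
    proof (cases "h < 0")
      case True
      have "(INF x\<in>P. w \<bullet> x) = - hgt P w" by (simp add: hgt_def)
      then have hn: "h \<in> neg_heights w P"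
        using True hgt_le[OF comp pP, of w] h by (simp add: neg_heights_def)
      then have "{x. x extreme_point_of P \<and> w \<bullet> x = of_int h} \<subseteq> G h + (*\<^sub>R) (of_int \<bar>h\<bar>) ` ?F"
        using G by (simp add: mutation_data_def)
      then have "p \<in> G h + (*\<^sub>R) (of_int \<bar>h\<bar>) ` ?F" using p(1) h by (auto simp: verts_def)
      then obtain g t where g: "g \<in> G h" and t: "0 \<le> t" "t \<le> 1"
        and pg: "p = g + of_int \<bar>h\<bar> *\<^sub>R t *\<^sub>R v"
        by (auto simp: segment_0 elim!: set_plus_elim)
      have wg: "w \<bullet> g = of_int h" using sl(2)[OF Gsl(1)[OF hn g]] .
      have "min 0 (u \<bullet> v) \<le> t * (u \<bullet> v)"
      proof (cases "u \<bullet> v \<ge> 0")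
        case False
        then have "1 * (u \<bullet> v) \<le> t * (u \<bullet> v)" using t by (intro mult_right_mono_neg) auto
        then show ?thesis using False by simp
      qed (use t in simp)
      then have "of_int h * (t * (u \<bullet> v)) \<le> of_int h * min 0 (u \<bullet> v)"
        using True by (intro mult_left_mono_neg) auto
      moreover have "bend w v u \<bullet> g = u \<bullet> p + of_int h * (t * (u \<bullet> v)) - of_int h * min 0 (u \<bullet> v)"
        using True by (simp add: pg wg bend_def inner_diff_left inner_diff_right inner_add_right)
      ultimately have "bend w v u \<bullet> g \<le> - hgt P u" using pu by linarith
      then show ?thesis using g hn unfolding mutation_gens_def by blast
    next
      case False
      have "bdd_above ((\<lambda>x. w \<bullet> x) ` P)"
        by (intro bounded_imp_bdd_above compact_imp_bounded compact_continuous_image comp continuous_intros)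
      then have "w \<bullet> p \<le> (SUP x\<in>P. w \<bullet> x)" using pP by (intro cSUP_upper)
      then have hn: "h \<in> nonneg_heights w P" using False h by (simp add: nonneg_heights_def)
      have psl: "p \<in> slice w P h" using pP pL h unfolding slice_def by (intro hull_inc) auto
      \<comment> \<open>The end of the segment is chosen by the sign of \<open>u \<bullet> v\<close>
        so that its contribution cancels the shear.\<close>
      define t :: real where "t = (if u \<bullet> v < 0 then 1 else 0)"
      have "t *\<^sub>R v \<in> ?F" by (auto simp: t_def intro: hull_inc)
      then have "p + of_int h *\<^sub>R t *\<^sub>R v \<in> slice w P h + (*\<^sub>R) (of_int h) ` ?F"
        using psl by (intro set_plus_intro imageI)
      moreover have "bend w v u \<bullet> (p + of_int h *\<^sub>R t *\<^sub>R v) = u \<bullet> p"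
        by (simp add: bend_def inner_diff_left inner_add_right wv h t_def)
      ultimately show ?thesis using hn pu unfolding mutation_gens_def
        by (intro bexI[of _ "p + of_int h *\<^sub>R t *\<^sub>R v"]) auto
    qed
  qed
qed

lemma face_length:
  assumes P: "fano_polygon P" and w: "primitive w" and v: "primitive v" "w \<bullet> v = 0"
    and g: "g \<in> face P w" "g + c *\<^sub>R v \<in> face P w"
  shows "c \<le> real (wid P w)"
proof -
  let ?J = "quarter_turn w"
  obtain p where F: "face P w = {p + t *\<^sub>R ?J | t. 0 \<le> t \<and> t \<le> real (wid P w)}"
    by (rule fano_face_ends[OF P w])
  obtain s t where s: "g = p + s *\<^sub>R ?J" "0 \<le> s" "s \<le> real (wid P w)"
    and t: "g + c *\<^sub>R v = p + t *\<^sub>R ?J" "0 \<le> t" "t \<le> real (wid P w)"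
    using g unfolding F by blast
  have J0: "?J \<noteq> 0" using w by (simp add: primitive_nonzero)
  have cv: "c *\<^sub>R v = (t - s) *\<^sub>R ?J" using s(1) t(1) by (simp add: algebra_simps)
  consider "v = ?J" | "v = - ?J" using primitive_orthogonal[OF w v] by metis
  then have "c = t - s \<or> c = s - t"
  proof cases
    case 1
    then show ?thesis using cv J0 by simp
  next
    case 2
    then have "(c + (t - s)) *\<^sub>R ?J = 0" using cv by (simp add: algebra_simps)
    then show ?thesis using J0 by simp
  qed
  then show ?thesis using s t by linarith
qed

lemma is_mutation_same_hgt:
  assumes P: "fano_polygon P" and Q: "is_mutation P Q"
  obtains w v where "w \<in> normals P" "primitive v" "w \<bullet> v = 0" "nhgt P w \<le> wid P w"
    "same_hgt w v P Q"
proof -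
  obtain E w v G where E: "E edge_of P" "inner_normal P E w" and v: "primitive v" "w \<bullet> v = 0"
    and G: "mutation_data w P (convex hull {0, v}) G" and Q: "Q = mut w P (convex hull {0, v}) G"
    using Q unfolding is_mutation_def by blast
  have pw: "primitive w" and Ew: "E = face P w" using E(2) by (auto simp: inner_normal_iff)
  obtain u where u: "u \<in> normals P" "E = face P u" using E(1) edge_of_iff[OF P] by blast
  have "u = w" by (rule face_normals_inj[OF P u(1) pw]) (simp flip: u(2) Ew)
  then have wn: "w \<in> normals P" using u(1) by simp
  have w: "w \<in> lattice_pts" using pw primitive_lattice by blast
  have "same_hgt w v P Q" unfolding Q by (rule mutation_data_same_hgt[OF P w v(2) G])
  \<comment> \<open>The lowest level contains a vertex, so \<open>G\<close> is nonempty there, and a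
    fibre as long as the edge is high has to fit into the edge.\<close>
  moreover have "nhgt P w \<le> wid P w"
  proof -
    let ?r = "nhgt P w" and ?F = "convex hull {0, v}"
    define h where "h = - int ?r"
    have r: "real ?r = hgt P w" "?r > 0" using real_nhgt[OF P pw] nhgt_pos[OF P pw] by auto
    obtain p where p: "p \<in> verts P" "w \<bullet> p = - hgt P w" by (rule fano_face_ends[OF P pw])
    have hn: "h \<in> neg_heights w P" using r by (simp add: neg_heights_def h_def hgt_def)
    have "p \<in> {x. x extreme_point_of P \<and> w \<bullet> x = of_int h}"
      using p r by (simp add: verts_def h_def)
    then have pG: "p \<in> G h + (*\<^sub>R) (of_int \<bar>h\<bar>) ` ?F"
      and sub: "G h + (*\<^sub>R) (of_int \<bar>h\<bar>) ` ?F \<subseteq> slice w P h"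
      using G hn unfolding mutation_data_def by blast+
    obtain g where g: "g \<in> G h" using pG by (auto elim: set_plus_elim)
    have "g + of_int \<bar>h\<bar> *\<^sub>R x \<in> face P w" if "x \<in> ?F" for x
    proof -
      have "g + of_int \<bar>h\<bar> *\<^sub>R x \<in> slice w P h"
        using g that sub by (metis (no_types, lifting) imageI set_plus_intro subsetD)
      then have "g + of_int \<bar>h\<bar> *\<^sub>R x \<in> P \<inter> {x. w \<bullet> x = of_int h}"
        using slice_subset[OF fano_convex[OF P]] by blast
      then show ?thesis using r by (simp add: face_eq[OF fano_compact[OF P]] h_def)
    qed
    from this[of 0] this[of v] have "g \<in> face P w" "g + real ?r *\<^sub>R v \<in> face P w"
      by (auto simp: h_def hull_inc)
    then show ?thesis using face_length[OF P pw v, of g "real ?r"] by simp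
  qed
  ultimately show thesis using that wn v by blast
qed

section \<open>Mutation invariants\<close>

text \<open>Far out on a ray that leaves the fold, the summand \<open>z\<close> no longer decides
  the half-plane, so \<open>bend\<close> acts on the tail of the ray by a single linear map.\<close>

lemma bend_ray:
  assumes "u \<bullet> v \<noteq> 0"
  shows "\<forall>\<^sub>F m in sequentially. bend w v (real m *\<^sub>R u + z)
    = real m *\<^sub>R bend w v u + (z - (if u \<bullet> v < 0 then z \<bullet> v else 0) *\<^sub>R w)"
proof -
  have "\<forall>\<^sub>F m in sequentially. \<bar>z \<bullet> v\<bar> \<le> real m * \<bar>u \<bullet> v\<bar>"
  proof -
    have "filterlim (\<lambda>m. real m * \<bar>u \<bullet> v\<bar>) at_top sequentially"
      using assms by (intro filterlim_at_top_mult_tendsto_pos[OF tendsto_const] filterlim_real_sequentially) auto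
    then show ?thesis by (simp add: filterlim_at_top)
  qed
  then show ?thesis
  proof (rule eventually_mono)
    fix m assume m: "\<bar>z \<bullet> v\<bar> \<le> real m * \<bar>u \<bullet> v\<bar>"
    show "bend w v (real m *\<^sub>R u + z)
      = real m *\<^sub>R bend w v u + (z - (if u \<bullet> v < 0 then z \<bullet> v else 0) *\<^sub>R w)"
    proof (cases "u \<bullet> v < 0")
      case True
      then have "(real m *\<^sub>R u + z) \<bullet> v \<le> 0" using m by (simp add: inner_add_left)
      then show ?thesis using True by (simp add: bend_neg inner_add_left algebra_simps)
    next
      case False
      then have "(real m *\<^sub>R u + z) \<bullet> v \<ge> 0" using m by (simp add: inner_add_left)
      then show ?thesis using False by (simp add: bend_nonneg)
    qed
  qed
qed

lemma fano_hgt_eventually: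
  assumes "fano_polygon P"
  shows "\<forall>\<^sub>F m in sequentially. hgt P (real m *\<^sub>R u + z) = real m * hgt P u + hgt (face P u) z"
  using hgt_eventually[OF fano_finite_verts[OF assms] fano_verts_nonempty[OF assms]]
  unfolding fano_hull[OF assms, symmetric] .

lemma fano_wid_eq_hgt:
  assumes "fano_polygon P" "primitive u" "\<bar>z \<bullet> quarter_turn u\<bar> = 1"
  shows "real (wid P u) = hgt (face P u) z + hgt (face P u) (- z)"
  using wid_eq_hgt[OF fano_finite_verts[OF assms(1)] fano_verts_nonempty[OF assms(1)]
      fano_verts_lattice[OF assms(1)] assms(2,3)]
  unfolding fano_hull[OF assms(1), symmetric] .

locale mutation_pair =
  fixes P Q w v
  assumes P: "fano_polygon P" and Q: "fano_polygon Q" and w: "primitive w" and v: "primitive v"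
    and wv: "w \<bullet> v = 0" and hgt_bend: "same_hgt w v P Q"
begin

lemma hgt_Q: "hgt Q (bend w v u) = hgt P u"
  using hgt_bend unfolding same_hgt_def by blast

lemma hgt_Q_nonneg: "u \<bullet> v \<ge> 0 \<Longrightarrow> hgt Q u = hgt P u"
  using hgt_Q[of u] by (simp add: bend_nonneg)

lemma hgt_Q_w [simp]: "hgt Q w = hgt P w" "hgt Q (- w) = hgt P (- w)"
  using hgt_Q_nonneg[of w] hgt_Q_nonneg[of "- w"] wv by simp_all

lemma parallel_w: "primitive u \<Longrightarrow> u \<bullet> v = 0 \<Longrightarrow> u = w \<or> u = - w"
proof -
  assume u: "primitive u" "u \<bullet> v = 0"
  consider "v = quarter_turn w" | "v = - quarter_turn w" using primitive_orthogonal[OF w v wv] by metis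
  then have "u \<bullet> quarter_turn w = 0" using u(2) by cases auto
  then show ?thesis using primitive_parallel u(1) w by blast
qed

text \<open>The tails of corresponding rays have equal support values in \<open>P\<close> and
  \<open>Q\<close>, hence equal growth terms. The shear has determinant 1, so the bent
  \<open>z\<close> still changes by 1 in absolute value along the new edge direction.\<close>

lemma wid_Q_bend:
  assumes u: "primitive u" and uv: "u \<bullet> v \<noteq> 0"
  shows "wid Q (bend w v u) = wid P u"
proof -
  define c where "c z = (if u \<bullet> v < 0 then z \<bullet> v else 0)" for z
  have transfer: "hgt (face Q (bend w v u)) (z - c z *\<^sub>R w) = hgt (face P u) z" for z
  proof -
    have "\<forall>\<^sub>F m in sequentially. hgt (face Q (bend w v u)) (z - c z *\<^sub>R w) = hgt (face P u) z"
      using fano_hgt_eventually[OF P, of u z] bend_ray[OF uv, of w z]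
        fano_hgt_eventually[OF Q, of "bend w v u" "z - c z *\<^sub>R w"]
    proof eventually_elim
      case (elim m)
      then have "real m * hgt Q (bend w v u) + hgt (face Q (bend w v u)) (z - c z *\<^sub>R w)
        = real m * hgt P u + hgt (face P u) z"
        using hgt_Q[of "real m *\<^sub>R u + z"] by (simp add: c_def)
      then show ?case by (simp add: hgt_Q)
    qed
    then show ?thesis by (simp add: eventually_const)
  qed
  obtain z where z: "z \<in> lattice_pts" "z \<bullet> quarter_turn u = 1"
    using primitive_complement u by blast
  have "(z - c z *\<^sub>R w) \<bullet> quarter_turn (bend w v u) = z \<bullet> quarter_turn u"
  proof (cases "u \<bullet> v < 0")
    case True
    consider "v = quarter_turn w" | "v = - quarter_turn w" using primitive_orthogonal[OF w v wv] by metis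
    then show ?thesis
      by cases (use True in \<open>simp_all add: c_def bend_neg quarter_turn_def inner_plane algebra_simps\<close>)
  next
    case False
    then show ?thesis by (simp add: c_def bend_nonneg)
  qed
  then have "\<bar>(z - c z *\<^sub>R w) \<bullet> quarter_turn (bend w v u)\<bar> = 1" using z by simp
  then have "real (wid Q (bend w v u)) = hgt (face Q (bend w v u)) (z - c z *\<^sub>R w)
     + hgt (face Q (bend w v u)) (- (z - c z *\<^sub>R w))"
    using fano_wid_eq_hgt[OF Q primitive_bend[OF w v wv u]] by blast
  also have "- (z - c z *\<^sub>R w) = (- z) - c (- z) *\<^sub>R w" by (simp add: c_def)
  finally have "real (wid Q (bend w v u)) = hgt (face P u) z + hgt (face P u) (- z)"
    by (simp add: transfer)
  also have "\<dots> = real (wid P u)" using fano_wid_eq_hgt[OF P u, of z] z(2) by simp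
  finally show ?thesis by simp
qed

lemma complement_w:
  obtains z where "\<bar>z \<bullet> quarter_turn w\<bar> = 1" "z \<bullet> v = 1"
proof -
  obtain z where z: "z \<bullet> quarter_turn w = 1" using primitive_complement w by blast
  consider "v = quarter_turn w" | "v = - quarter_turn w" using primitive_orthogonal[OF w v wv] by metis
  then show thesis
  proof cases
    case 1 then show thesis using that[of z] z by simp
  next
    case 2 then show thesis using that[of "- z"] z by simp
  qed
qed

text \<open>Here the ray runs along the fold, with \<open>z\<close> and \<open>- z\<close> on
  different sides. On the side of \<open>z\<close> nothing changes; on the side of
  \<open>- z\<close> the ray is shifted by one step of \<open>w\<close>, so the comparison is
  between consecutive values of \<open>m\<close>. This costs one height at \<open>w\<close> and
  gains one at \<open>- w\<close>.\<close>

lemma wid_Q_w: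
  shows "wid Q w + nhgt P w = wid P w" and "wid Q (- w) = wid P (- w) + nhgt P (- w)"
proof -
  obtain z where z: "\<bar>z \<bullet> quarter_turn w\<bar> = 1" "z \<bullet> v = 1" by (rule complement_w)
  have eq1: "hgt (face Q u) z = hgt (face P u) z" if u: "u = w \<or> u = - w" for u
  proof -
    have "\<forall>\<^sub>F m in sequentially. hgt (face Q u) z = hgt (face P u) z"
      using fano_hgt_eventually[OF P, of u z] fano_hgt_eventually[OF Q, of u z]
    proof eventually_elim
      case (elim m)
      have "hgt Q (real m *\<^sub>R u + z) = hgt P (real m *\<^sub>R u + z)"
        using u wv z(2) by (intro hgt_Q_nonneg) (auto simp: inner_add_left)
      then show ?case using elim u by auto
    qed
    then show ?thesis by (simp add: eventually_const)
  qed
  have eq2: "hgt (face Q w) (- z) + hgt P w = hgt (face P w) (- z)"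
  proof -
    have "\<forall>\<^sub>F m in sequentially. hgt (face Q w) (- z) + hgt P w = hgt (face P w) (- z)"
      using fano_hgt_eventually[OF P, of w "- z"]
        eventually_sequentially_Suc[THEN iffD2, OF fano_hgt_eventually[OF Q, of w "- z"]]
    proof eventually_elim
      case (elim m)
      have "bend w v (real m *\<^sub>R w - z) = real (Suc m) *\<^sub>R w - z"
        using wv z(2) by (simp add: bend_neg inner_diff_left algebra_simps)
      then have "hgt Q (real (Suc m) *\<^sub>R w - z) = hgt P (real m *\<^sub>R w - z)" by (metis hgt_Q)
      then show ?case using elim by (simp add: algebra_simps)
    qed
    then show ?thesis by (simp add: eventually_const)
  qed
  have eq3: "hgt (face Q (- w)) (- z) = hgt (face P (- w)) (- z) + hgt P (- w)"
  proof -
    have "\<forall>\<^sub>F m in sequentially. hgt (face Q (- w)) (- z) = hgt (face P (- w)) (- z) + hgt P (- w)"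
      using fano_hgt_eventually[OF Q, of "- w" "- z"]
        eventually_sequentially_Suc[THEN iffD2, OF fano_hgt_eventually[OF P, of "- w" "- z"]]
    proof eventually_elim
      case (elim m)
      have "bend w v (real (Suc m) *\<^sub>R (- w) + - z) = real m *\<^sub>R (- w) + - z"
        using wv z(2) by (simp add: bend_neg inner_diff_left algebra_simps)
      then have "hgt Q (real m *\<^sub>R (- w) + - z) = hgt P (real (Suc m) *\<^sub>R (- w) + - z)"
        by (metis hgt_Q)
      then have "real m * hgt Q (- w) + hgt (face Q (- w)) (- z)
        = real (Suc m) * hgt P (- w) + hgt (face P (- w)) (- z)"
        using elim by metis
      then show ?case by (simp add: algebra_simps)
    qed
    then show ?thesis by (simp add: eventually_const)
  qed
  have z': "\<bar>z \<bullet> quarter_turn (- w)\<bar> = 1" using z(1) by (simp add: quarter_turn_linear)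
  have "real (wid Q w) + real (nhgt P w) = real (wid P w)"
    using fano_wid_eq_hgt[OF P w z(1)] fano_wid_eq_hgt[OF Q w z(1)] eq1[of w] eq2 real_nhgt[OF P w]
    by simp
  then show "wid Q w + nhgt P w = wid P w" by linarith
  have "real (wid Q (- w)) = real (wid P (- w)) + real (nhgt P (- w))"
    using fano_wid_eq_hgt[OF P _ z'] fano_wid_eq_hgt[OF Q _ z'] eq1[of "- w"] eq3
      real_nhgt[OF P, of "- w"] w
    by simp
  then show "wid Q (- w) = wid P (- w) + nhgt P (- w)" by linarith
qed

lemma nhgt_Q_bend: "nhgt Q (bend w v u) = nhgt P u"
  by (simp add: nhgt_def hgt_Q)

lemma bend_unbend: "bend w v (bend (- w) v u) = u"
  using bend_bend[of "- w" v u] wv by simp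

lemma bij_normals: "bij_betw (bend w v) (normals P - {w, - w}) (normals Q - {w, - w})"
proof (rule bij_betw_byWitness[where f' = "bend (- w) v"])
  show "\<forall>u\<in>normals P - {w, - w}. bend (- w) v (bend w v u) = u"
    using wv by (simp add: bend_bend)
  show "\<forall>u\<in>normals Q - {w, - w}. bend w v (bend (- w) v u) = u"
    by (simp add: bend_unbend)
  have pm: "bend w v u \<noteq> w" "bend w v u \<noteq> - w" if "u \<bullet> v \<noteq> 0" for u
    using that bend_inner[OF wv, of u] wv by auto
  show "bend w v ` (normals P - {w, - w}) \<subseteq> normals Q - {w, - w}"
  proof
    fix y assume "y \<in> bend w v ` (normals P - {w, - w})"
    then obtain u where u: "u \<in> normals P" "u \<noteq> w" "u \<noteq> - w" "y = bend w v u" by auto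
    have "u \<bullet> v \<noteq> 0" using parallel_w u normalsD by blast
    then show "y \<in> normals Q - {w, - w}"
      using u pm[of u] wid_Q_bend[of u] primitive_bend[OF w v wv] by (simp add: normals_def)
  qed
  show "bend (- w) v ` (normals Q - {w, - w}) \<subseteq> normals P - {w, - w}"
  proof
    fix y assume "y \<in> bend (- w) v ` (normals Q - {w, - w})"
    then obtain u where u: "u \<in> normals Q" "u \<noteq> w" "u \<noteq> - w" "y = bend (- w) v u" by auto
    have uv: "u \<bullet> v \<noteq> 0" using parallel_w u normalsD by blast
    have yv: "y \<bullet> v = u \<bullet> v" using bend_inner[of "- w" v u] wv u by simp
    have "primitive y" using primitive_bend[of "- w" v u] w v wv u normalsD(1) by simp
    moreover have "bend w v y = u" by (simp add: u bend_unbend)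
    ultimately have "y \<in> normals P" using wid_Q_bend[of y] u yv uv by (simp add: normals_def)
    moreover have "y \<noteq> w" "y \<noteq> - w" using yv uv wv by auto
    ultimately show "y \<in> normals P - {w, - w}" by simp
  qed
qed

end

text \<open>\<open>w\<close> or \<open>- w\<close> may fail to be the normal of an edge; its length
  is then 0, and \<open>f 0 h = 0\<close> lets it be counted all the same.\<close>

lemma normal_sum_split:
  assumes "fano_polygon P" "primitive w" "\<And>h. f 0 h = 0"
  shows "normal_sum f P = (\<Sum>u\<in>normals P - {w, - w}. f (wid P u) (nhgt P u))
    + f (wid P w) (nhgt P w) + f (wid P (- w)) (nhgt P (- w))"
proof -
  have "w \<noteq> - w" using primitive_nonzero[OF assms(2)] by (simp add: eq_neg_iff_add_eq_0 flip: scaleR_2)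
  have fin: "finite (normals P)" using assms(1) by (rule finite_normals)
  have "normal_sum f P = (\<Sum>u\<in>normals P \<union> {w, - w}. f (wid P u) (nhgt P u))"
    unfolding normal_sum_def
  proof (rule sum.mono_neutral_left)
    show "\<forall>u\<in>normals P \<union> {w, - w} - normals P. f (wid P u) (nhgt P u) = 0"
    proof
      fix u assume "u \<in> normals P \<union> {w, - w} - normals P"
      then have "wid P u = 0" using assms(2) by (auto simp: normals_def)
      then show "f (wid P u) (nhgt P u) = 0" using assms(3) by simp
    qed
  qed (use fin in auto)
  also have "\<dots> = (\<Sum>u\<in>(normals P - {w, - w}) \<union> {w, - w}. f (wid P u) (nhgt P u))"
    by (rule sum.cong) auto
  also have "\<dots> = (\<Sum>u\<in>normals P - {w, - w}. f (wid P u) (nhgt P u))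
    + (\<Sum>u\<in>{w, - w}. f (wid P u) (nhgt P u))"
    using fin by (intro sum.union_disjoint) auto
  finally show ?thesis using \<open>w \<noteq> - w\<close> by simp
qed

context mutation_pair
begin

lemma normal_sum_mutation:
  assumes "\<And>h. f 0 h = 0"
  shows "normal_sum f Q + f (wid P w) (nhgt P w) + f (wid P (- w)) (nhgt P (- w))
    = normal_sum f P + f (wid Q w) (nhgt P w) + f (wid Q (- w)) (nhgt P (- w))"
proof -
  have "(\<Sum>u\<in>normals Q - {w, - w}. f (wid Q u) (nhgt Q u))
      = (\<Sum>u\<in>normals P - {w, - w}. f (wid P u) (nhgt P u))"
  proof (subst sum.reindex_bij_betw[OF bij_normals, symmetric], rule sum.cong[OF refl])
    fix u assume u: "u \<in> normals P - {w, - w}"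
    then have "u \<bullet> v \<noteq> 0" "primitive u" using parallel_w normalsD by blast+
    then show "f (wid Q (bend w v u)) (nhgt Q (bend w v u)) = f (wid P u) (nhgt P u)"
      by (simp add: wid_Q_bend nhgt_Q_bend)
  qed
  then show ?thesis
    using normal_sum_split[OF P w, of f] normal_sum_split[OF Q w, of f] assms
    by (simp add: nhgt_def)
qed

text \<open>The length at \<open>w\<close> drops and the length at \<open>- w\<close> grows by
  exactly one height, so the quotients change by 1 in opposite directions whatever the remainders
  are.\<close>

lemma smoothing_euler_number_mutation:
  "smoothing_euler_number Q = smoothing_euler_number P"
proof -
  have h: "nhgt P w > 0" "nhgt P (- w) > 0" using nhgt_pos[OF P] w by auto
  have "wid P w div nhgt P w = wid Q w div nhgt P w + 1"
    using h by (simp flip: wid_Q_w(1))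
  moreover have "wid Q (- w) div nhgt P (- w) = wid P (- w) div nhgt P (- w) + 1"
    using h by (simp add: wid_Q_w(2))
  ultimately show ?thesis
    using normal_sum_mutation[of "(div)"] by (simp add: smoothing_euler_number_eq P Q)
qed

lemma boundary_length_mutation:
  "normal_sum (\<lambda>k h. k) Q + nhgt P w = normal_sum (\<lambda>k h. k) P + nhgt P (- w)"
  using normal_sum_mutation[of "\<lambda>k h. k"] wid_Q_w by simp

lemma only_T_mutation:
  assumes "only_T_singularities P"
  shows "only_T_singularities Q"
  unfolding only_T_iff[OF Q]
proof
  \<comment> \<open>\<open>w\<close> or \<open>- w\<close> can be the normal of an edge of only one
    of the two polygons, so divisibility is extended to faces of length 0.\<close>
  have T: "nhgt P u dvd wid P u" if "primitive u" for u
  proof (cases "wid P u = 0")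
    case False
    then have "u \<in> normals P" using that by (simp add: normals_def)
    then show ?thesis using assms only_T_iff[OF P] by blast
  qed simp
  fix u assume u: "u \<in> normals Q"
  show "nhgt Q u dvd wid Q u"
  proof (cases "u \<in> {w, - w}")
    case True
    have "nhgt P w dvd wid Q w"
      using T[OF w] by (simp flip: wid_Q_w(1))
    moreover have "nhgt P (- w) dvd wid Q (- w)"
      using T[of "- w"] w by (simp add: wid_Q_w(2))
    ultimately show ?thesis using True by (auto simp: nhgt_def)
  next
    case False
    then have "u \<in> bend w v ` (normals P - {w, - w})"
      using u bij_betw_imp_surj_on[OF bij_normals] by simp
    then obtain y where y: "y \<in> normals P - {w, - w}" "u = bend w v y" by blast
    then have "y \<bullet> v \<noteq> 0" "primitive y" using parallel_w normalsD by blast+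
    then show ?thesis using y T by (simp add: wid_Q_bend nhgt_Q_bend)
  qed
qed

end

text \<open>Separates the two families of Euler number 4: all normals of the polygon of
  \<open>P\<^sup>1 \<times> P\<^sup>1\<close> agree modulo 2.\<close>

definition mod2_constant :: "plane set \<Rightarrow> bool" where
  "mod2_constant P \<longleftrightarrow> (\<forall>u\<in>normals P. \<forall>u'\<in>normals P. nhgt P u \<le> wid P u \<longrightarrow> nhgt P u' \<le> wid P u' \<longrightarrow>
     (\<exists>t\<in>lattice_pts. u - u' = 2 *\<^sub>R t))"

lemma mod2_trans:
  assumes "\<exists>t\<in>lattice_pts. x - z = 2 *\<^sub>R t" "\<exists>t\<in>lattice_pts. y - z = 2 *\<^sub>R t"
  shows "\<exists>t\<in>lattice_pts. x - y = 2 *\<^sub>R t"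
proof -
  obtain s t where st: "s \<in> lattice_pts" "t \<in> lattice_pts" "x - z = 2 *\<^sub>R s" "y - z = 2 *\<^sub>R t"
    using assms by blast
  have "x - y = (x - z) - (y - z)" by simp
  also have "\<dots> = 2 *\<^sub>R (s - t)" unfolding st by (simp add: algebra_simps)
  finally show ?thesis using st lattice_pts_diff by blast
qed

text \<open>A vector congruent to \<open>w\<close> modulo 2 has an even product with
  \<open>v\<close>, because \<open>w \<bullet> v = 0\<close>. The multiple of \<open>w\<close> added
  by bending is then even.\<close>

lemma mod2_bend:
  assumes "w \<in> lattice_pts" "v \<in> lattice_pts" "w \<bullet> v = 0" "\<exists>t\<in>lattice_pts. u - w = 2 *\<^sub>R t"
  shows "\<exists>t\<in>lattice_pts. bend w v u - w = 2 *\<^sub>R t" "\<exists>t\<in>lattice_pts. bend (- w) v u - w = 2 *\<^sub>R t"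
proof -
  obtain t where t: "t \<in> lattice_pts" "u - w = 2 *\<^sub>R t" using assms by blast
  then have u: "u = w + 2 *\<^sub>R t" by (simp add: algebra_simps)
  have min: "min 0 (u \<bullet> v) = 2 * min 0 (t \<bullet> v)" using assms(3) by (auto simp: u inner_add_left min_def)
  have i: "min 0 (t \<bullet> v) \<in> \<int>" using lattice_pts_inner[OF t(1) assms(2)] by (simp add: min_def)
  have "bend w v u - w = 2 *\<^sub>R (t - min 0 (t \<bullet> v) *\<^sub>R w)"
    "bend (- w) v u - w = 2 *\<^sub>R (t + min 0 (t \<bullet> v) *\<^sub>R w)"
    unfolding bend_def min by (simp_all add: u algebra_simps)
  then show "\<exists>t\<in>lattice_pts. bend w v u - w = 2 *\<^sub>R t" "\<exists>t\<in>lattice_pts. bend (- w) v u - w = 2 *\<^sub>R t"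
    using t(1) assms(1) i by (metis lattice_pts_diff lattice_pts_scale, metis lattice_pts_add lattice_pts_scale)
qed

context mutation_pair
begin

text \<open>\<open>w\<close> is a long edge of \<open>P\<close> and \<open>- w\<close> is one of
  \<open>Q\<close>. As they agree modulo 2, both statements say that the normals in question are
  congruent to \<open>w\<close>, and \<open>bend\<close> respects this class.\<close>

lemma mod2_constant_mutation:
  assumes wn: "w \<in> normals P" "nhgt P w \<le> wid P w"
  shows "mod2_constant Q \<longleftrightarrow> mod2_constant P"
proof -
  let ?c = "\<lambda>x. \<exists>t\<in>lattice_pts. x - w = 2 *\<^sub>R t"
  have L: "w \<in> lattice_pts" "v \<in> lattice_pts" using w v primitive_lattice by auto
  have cw: "?c w" "?c (- w)"
  proof -
    show "?c w" by (intro bexI[of _ 0]) simp_all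
    show "?c (- w)" using lattice_pts_minus[OF L(1)] by (intro bexI[of _ "- w"]) (simp_all add: scaleR_2)
  qed
  have mQ: "- w \<in> normals Q" "nhgt Q (- w) \<le> wid Q (- w)"
  proof -
    have "nhgt P (- w) > 0" using nhgt_pos[OF P] w by simp
    then show "- w \<in> normals Q" using w by (simp add: normals_def wid_Q_w(2))
    show "nhgt Q (- w) \<le> wid Q (- w)" by (simp add: wid_Q_w(2) nhgt_def)
  qed
  have iP: "mod2_constant P \<longleftrightarrow> (\<forall>u\<in>normals P. nhgt P u \<le> wid P u \<longrightarrow> ?c u)"
    unfolding mod2_constant_def using wn mod2_trans by blast
  have iQ: "mod2_constant Q \<longleftrightarrow> (\<forall>u\<in>normals Q. nhgt Q u \<le> wid Q u \<longrightarrow> ?c u)"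
  proof
    assume "mod2_constant Q"
    then have *: "\<exists>t\<in>lattice_pts. u - (- w) = 2 *\<^sub>R t" if "u \<in> normals Q" "nhgt Q u \<le> wid Q u" for u
      using mQ that unfolding mod2_constant_def by blast
    have "\<exists>t\<in>lattice_pts. w - (- w) = 2 *\<^sub>R t" using L by (auto simp: scaleR_2)
    then show "\<forall>u\<in>normals Q. nhgt Q u \<le> wid Q u \<longrightarrow> ?c u" using * mod2_trans by blast
  next
    assume "\<forall>u\<in>normals Q. nhgt Q u \<le> wid Q u \<longrightarrow> ?c u"
    then show "mod2_constant Q" unfolding mod2_constant_def using mod2_trans by blast
  qed
  have off: "(u \<in> normals P \<and> nhgt P u \<le> wid P u) \<longleftrightarrow>
      (bend w v u \<in> normals Q \<and> nhgt Q (bend w v u) \<le> wid Q (bend w v u))"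
    if "u \<bullet> v \<noteq> 0" "primitive u" for u
    using that primitive_bend[OF w v wv] by (simp add: normals_def wid_Q_bend nhgt_Q_bend)
  show ?thesis
  proof
    assume "mod2_constant Q"
    then have Qc: "\<And>u. u \<in> normals Q \<Longrightarrow> nhgt Q u \<le> wid Q u \<Longrightarrow> ?c u" using iQ by blast
    show "mod2_constant P"
      unfolding iP
    proof (intro ballI impI)
      fix u assume u: "u \<in> normals P" "nhgt P u \<le> wid P u"
      then have pu: "primitive u" using normalsD by blast
      show "?c u"
      proof (cases "u \<bullet> v = 0")
        case True then show ?thesis using parallel_w[OF pu] cw by blast
      next
        case False
        then have "?c (bend w v u)" using Qc off u pu by blast
        then have "?c (bend (- w) v (bend w v u))" using mod2_bend(2)[OF L wv] by blast
        then show ?thesis using wv by (simp add: bend_bend)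
      qed
    qed
  next
    assume "mod2_constant P"
    then have Pc: "\<And>u. u \<in> normals P \<Longrightarrow> nhgt P u \<le> wid P u \<Longrightarrow> ?c u" using iP by blast
    show "mod2_constant Q"
      unfolding iQ
    proof (intro ballI impI)
      fix u assume u: "u \<in> normals Q" "nhgt Q u \<le> wid Q u"
      then have pu: "primitive u" using normalsD by blast
      define y where "y = bend (- w) v u"
      have uy: "u = bend w v y" by (simp add: y_def bend_unbend)
      have py: "primitive y" using primitive_bend[of "- w" v u] w v wv pu by (simp add: y_def)
      have yv: "y \<bullet> v = u \<bullet> v" using bend_inner[of "- w" v u] wv by (simp add: y_def)
      show "?c u"
      proof (cases "u \<bullet> v = 0")
        case True then show ?thesis using parallel_w[OF pu] cw by blast
      next
        case False
        then have "?c y" using Pc off[of y] u py yv uy by metis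
        then show ?thesis using mod2_bend(1)[OF L wv] uy by blast
      qed
    qed
  qed
qed

end

lemma (in unimodular) mod2_constant_image:
  "mod2_constant (f ` P) \<longleftrightarrow> mod2_constant P"
proof -
  have iff: "(\<exists>t\<in>lattice_pts. u - u' = 2 *\<^sub>R t) \<longleftrightarrow>
    (\<exists>t\<in>lattice_pts. adjoint f u - adjoint f u' = 2 *\<^sub>R t)" for u u'
  proof -
    have "(\<exists>t\<in>lattice_pts. x = 2 *\<^sub>R t) \<longleftrightarrow> (1 / 2) *\<^sub>R x \<in> lattice_pts" for x
    proof
      assume "(1 / 2) *\<^sub>R x \<in> lattice_pts"
      then show "\<exists>t\<in>lattice_pts. x = 2 *\<^sub>R t" by (intro bexI[of _ "(1 / 2) *\<^sub>R x"]) auto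
    qed auto
    moreover have "adjoint f ((1 / 2) *\<^sub>R (u - u')) = (1 / 2) *\<^sub>R (adjoint f u - adjoint f u')"
      by (simp add: linear_scale[OF linear_adjoint] linear_diff[OF linear_adjoint])
    ultimately show ?thesis using adjoint_lattice_iff by metis
  qed
  show ?thesis
  proof
    assume L: "mod2_constant (f ` P)"
    show "mod2_constant P"
      unfolding mod2_constant_def
    proof (intro ballI impI)
      fix x x' assume x: "x \<in> normals P" "x' \<in> normals P" "nhgt P x \<le> wid P x" "nhgt P x' \<le> wid P x'"
      obtain u u' where u: "x = adjoint f u" "x' = adjoint f u'" using surj_adjoint by (metis surjD)
      then have "\<exists>t\<in>lattice_pts. u - u' = 2 *\<^sub>R t"
        using L x by (simp add: mod2_constant_def normals_image wid_image nhgt_def hgt_image)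
      then show "\<exists>t\<in>lattice_pts. x - x' = 2 *\<^sub>R t" using iff u by simp
    qed
  next
    assume R: "mod2_constant P"
    show "mod2_constant (f ` P)"
      unfolding mod2_constant_def normals_image wid_image nhgt_def hgt_image
    proof (intro ballI impI)
      fix u u' assume "u \<in> normals (f ` P)" "u' \<in> normals (f ` P)"
        "nat \<lfloor>hgt P (adjoint f u)\<rfloor> \<le> wid P (adjoint f u)"
        "nat \<lfloor>hgt P (adjoint f u')\<rfloor> \<le> wid P (adjoint f u')"
      then have "\<exists>t\<in>lattice_pts. adjoint f u - adjoint f u' = 2 *\<^sub>R t"
        using R unfolding mod2_constant_def normals_image nhgt_def by blast
      then show "\<exists>t\<in>lattice_pts. u - u' = 2 *\<^sub>R t" using iff by simp
    qed
  qed
qed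

section \<open>Mutation equivalence\<close>

abbreviation mut_equiv :: "plane set \<Rightarrow> plane set \<Rightarrow> bool" (infix "\<sim>\<^sub>m" 50) where
  "P \<sim>\<^sub>m Q \<equiv> (P, Q) \<in> mutation_equivalence"

lemma mut_equivD: "P \<sim>\<^sub>m Q \<Longrightarrow> fano_polygon P" "P \<sim>\<^sub>m Q \<Longrightarrow> fano_polygon Q"
  by (auto simp: mutation_equivalence_def)

lemma mut_equiv_refl: "fano_polygon P \<Longrightarrow> P \<sim>\<^sub>m P"
  by (simp add: mutation_equivalence_def)

lemma mut_equiv_sym: "P \<sim>\<^sub>m Q \<Longrightarrow> Q \<sim>\<^sub>m P"
  by (auto simp: mutation_equivalence_def intro: equivclp_sym)

lemma mut_equiv_trans [trans]: "P \<sim>\<^sub>m Q \<Longrightarrow> Q \<sim>\<^sub>m R \<Longrightarrow> P \<sim>\<^sub>m R"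
  by (auto simp: mutation_equivalence_def intro: equivclp_trans)

lemma mut_equiv_step: "mutation_step P Q \<Longrightarrow> P \<sim>\<^sub>m Q"
  by (auto simp: mutation_equivalence_def mutation_step_def)

lemma mut_equiv_unimodular:
  assumes "unimodular f" "fano_polygon P"
  shows "P \<sim>\<^sub>m f ` P"
  using assms unimodular.fano_image
  by (intro mut_equiv_step) (auto simp: mutation_step_def gl2_equivalent_iff)

lemma mut_equiv_mutation: "fano_polygon P \<Longrightarrow> fano_polygon Q \<Longrightarrow> is_mutation P Q \<Longrightarrow> P \<sim>\<^sub>m Q"
  by (intro mut_equiv_step) (auto simp: mutation_step_def)

lemma mut_equiv_invariant:
  assumes "P \<sim>\<^sub>m Q" and "\<And>P Q. mutation_step P Q \<Longrightarrow> I P = I Q"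
  shows "I P = I Q"
proof -
  have "equivclp mutation_step P Q" using assms(1) by (simp add: mutation_equivalence_def)
  then show ?thesis by (induction rule: equivclp_induct) (use assms(2) in auto)
qed

lemma mutation_step_cases:
  assumes "mutation_step P Q"
  obtains (unimodular) f where "unimodular f" "Q = f ` P"
  | (mutation) w v where "mutation_pair P Q w v" "w \<in> normals P" "nhgt P w \<le> wid P w"
proof -
  have F: "fano_polygon P" "fano_polygon Q" "gl2_equivalent P Q \<or> is_mutation P Q"
    using assms by (auto simp: mutation_step_def)
  show thesis
    using F(3)
  proof
    assume "gl2_equivalent P Q"
    then show thesis using unimodular by (auto simp: gl2_equivalent_iff)
  next
    assume "is_mutation P Q"
    then obtain w v where "w \<in> normals P" "primitive v" "w \<bullet> v = 0" "nhgt P w \<le> wid P w"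
      "same_hgt w v P Q"
      by (rule is_mutation_same_hgt[OF F(1)])
    then show thesis using mutation F normalsD by (auto simp: mutation_pair_def)
  qed
qed

lemma mut_equiv_smoothing_euler_number:
  assumes "P \<sim>\<^sub>m Q"
  shows "smoothing_euler_number P = smoothing_euler_number Q"
  using assms
proof (rule mut_equiv_invariant)
  fix P Q assume st: "mutation_step P Q"
  then have F: "fano_polygon P" "fano_polygon Q" by (auto simp: mutation_step_def)
  from st show "smoothing_euler_number P = smoothing_euler_number Q"
  proof (cases rule: mutation_step_cases)
    case (unimodular f)
    then show ?thesis
      using F by (simp add: smoothing_euler_number_eq unimodular.normal_sum_image)
  next
    case mutation
    then show ?thesis by (simp add: mutation_pair.smoothing_euler_number_mutation)
  qed
qed

lemma mut_equiv_mod2_constant: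
  assumes "P \<sim>\<^sub>m Q"
  shows "mod2_constant P = mod2_constant Q"
  using assms
proof (rule mut_equiv_invariant)
  fix P Q assume "mutation_step P Q"
  then show "mod2_constant P = mod2_constant Q"
    by (cases rule: mutation_step_cases)
      (simp_all add: unimodular.mod2_constant_image mutation_pair.mod2_constant_mutation)
qed

section \<open>Existence of mutations\<close>

text \<open>The vertices of a mutated polygon are found among the old vertices and their shears;
  this keeps the latter primitive.\<close>

lemma primitive_shear:
  assumes "primitive p" "w \<in> lattice_pts" "v \<in> lattice_pts" "w \<bullet> v = 0"
  shows "primitive (p + (w \<bullet> p) *\<^sub>R v)"
proof -
  obtain x where x: "p \<in> lattice_pts" "x \<in> lattice_pts" "p \<bullet> x = 1"
    using assms(1) by (auto simp: primitive_iff)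
  have "(p + (w \<bullet> p) *\<^sub>R v) \<bullet> (x - (v \<bullet> x) *\<^sub>R w) = 1"
    using x(3) assms(4)
    by (simp add: inner_add_left inner_diff_right inner_commute[of p w] inner_commute[of v w] algebra_simps)
  moreover have "x - (v \<bullet> x) *\<^sub>R w \<in> lattice_pts" "p + (w \<bullet> p) *\<^sub>R v \<in> lattice_pts"
    using x assms by (auto intro!: lattice_pts_diff lattice_pts_add lattice_pts_scale lattice_pts_inner)
  ultimately show ?thesis unfolding primitive_iff by blast
qed

text \<open>Shrinking a piece of the edge towards the origin puts a segment of length
  \<open>- (w \<bullet> p)\<close> into the level of \<open>p\<close>. The vertex \<open>p\<close>
  cannot lie strictly inside that segment, so by convexity a segment of this length fits on one side
  of \<open>p\<close>.\<close>

lemma long_edge_slices: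
  assumes P: "fano_polygon P" and w: "primitive w" and v: "primitive v" "w \<bullet> v = 0"
    and long: "nhgt P w \<le> wid P w" and p: "p \<in> verts P" "w \<bullet> p < 0"
  shows "p - (w \<bullet> p) *\<^sub>R v \<in> P \<or> p + (w \<bullet> p) *\<^sub>R v \<in> P"
proof -
  let ?J = "quarter_turn w"
  define r where "r = hgt P w"
  have r: "r > 0" "real (nhgt P w) = r"
    using fano_hgt_pos[OF P primitive_nonzero[OF w]] real_nhgt[OF P w] by (auto simp: r_def)
  have pP: "p \<in> P" using p(1) fano_verts_subset[OF P] by auto
  have pw: "- r \<le> w \<bullet> p" using hgt_le[OF fano_compact[OF P] pP] by (simp add: r_def)
  obtain e where e: "e \<in> verts P" "face P w = {e + t *\<^sub>R ?J | t. 0 \<le> t \<and> t \<le> real (wid P w)}"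
    by (rule fano_face_ends[OF P w])
  have in_F: "e + t *\<^sub>R ?J \<in> face P w" if "0 \<le> t" "t \<le> real (wid P w)" for t
    using e(2) that by blast
  have rw: "r \<le> real (wid P w)" using long r(2) by linarith
  obtain b where b: "b \<in> face P w" "b + r *\<^sub>R v \<in> face P w"
  proof -
    consider "v = ?J" | "v = - ?J" using primitive_orthogonal[OF w v] by metis
    then show thesis
    proof cases
      case 1
      then show thesis using that[of e] in_F[of 0] in_F[of r] r rw by simp
    next
      case 2
      then show thesis using that[of "e + r *\<^sub>R ?J"] in_F[of 0] in_F[of r] r rw by simp
    qed
  qed
  have bP: "b \<in> P" "b + r *\<^sub>R v \<in> P" "w \<bullet> b = - r"
    using b face_eq[OF fano_compact[OF P]] by (auto simp: r_def)
  \<comment> \<open>The ratio of the depth of \<open>p\<close> to the height of the edge; scaling by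
    it sends the edge to the level of \<open>p\<close> and a segment of length \<open>r\<close> to
    one of the required length.\<close>
  define l where "l = - (w \<bullet> p) / r"
  have l: "0 < l" "l \<le> 1" "l * r = - (w \<bullet> p)" using r pw p(2) by (auto simp: l_def field_simps)
  have 0: "0 \<in> P" using P interior_subset by (auto simp: fano_polygon_def)
  have cone: "l *\<^sub>R x \<in> P" if "x \<in> P" for x
    using convexD[OF fano_convex[OF P] that 0, of l "1 - l"] l by simp
  define x where "x = l *\<^sub>R b"
  have x: "x \<in> P" "x - (w \<bullet> p) *\<^sub>R v \<in> P" "w \<bullet> x = w \<bullet> p"
    using cone[OF bP(1)] cone[OF bP(2)] l(3) bP(3) by (simp_all add: x_def scaleR_add_right)
  have "w \<bullet> (p - x) = 0" using x(3) by (simp add: inner_diff_right)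
  then obtain c where "p - x = c *\<^sub>R ?J"
    using orthogonal_multiple primitive_nonzero[OF w] by metis
  moreover have "v = ?J \<or> v = - ?J" using primitive_orthogonal[OF w v] by metis
  ultimately have "p - x = c *\<^sub>R v \<or> p - x = (- c) *\<^sub>R v" by auto
  then obtain s where s: "p = x + s *\<^sub>R v" by (metis diff_eq_eq add.commute)
  let ?h = "- (w \<bullet> p)"
  have seg: "x + t *\<^sub>R v \<in> P" if "min 0 s \<le> t" "t \<le> max ?h s" for t
  proof -
    have conv: "y \<in> P" if "a \<in> P" "b \<in> P" "y \<in> closed_segment a b" for a b y
      using that fano_convex[OF P] by (meson closed_segment_subset subsetD)
    have mem: "x + t *\<^sub>R v \<in> closed_segment (x + a *\<^sub>R v) (x + b *\<^sub>R v)" if "a \<le> t" "t \<le> b" for a b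
    proof (cases "a = b")
      case True then show ?thesis using that by simp
    next
      case False
      then have "a < b" using that by simp
      then have "x + t *\<^sub>R v = (1 - (t - a) / (b - a)) *\<^sub>R (x + a *\<^sub>R v) + ((t - a) / (b - a)) *\<^sub>R (x + b *\<^sub>R v)"
        by (simp add: algebra_simps flip: scaleR_add_left) (simp add: field_simps flip: scaleR_add_left)
      then show ?thesis using that \<open>a < b\<close> by (auto simp: in_segment intro!: exI[of _ "(t - a) / (b - a)"])
    qed
    have pts: "x + 0 *\<^sub>R v \<in> P" "x + ?h *\<^sub>R v \<in> P" "x + s *\<^sub>R v \<in> P" using x s pP by simp_all
    have "\<exists>a b. x + a *\<^sub>R v \<in> P \<and> x + b *\<^sub>R v \<in> P \<and> a \<le> t \<and> t \<le> b"
      using that pts by (metis max_def min_def)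
    then show ?thesis using mem conv by blast
  qed
  consider "s \<le> 0" | "?h \<le> s" | "0 < s" "s < ?h" by linarith
  then show ?thesis
  proof cases
    case 1
    have "x + (s + ?h) *\<^sub>R v \<in> P" using 1 p(2) by (intro seg) auto
    then show ?thesis by (simp add: s algebra_simps)
  next
    case 2
    have "x + (s - ?h) *\<^sub>R v \<in> P" using 2 p(2) by (intro seg) auto
    then show ?thesis by (simp add: s algebra_simps)
  next
    case 3
    have v0: "v \<noteq> 0" using v primitive_nonzero by blast
    have "x + s *\<^sub>R v \<in> open_segment x (x + H *\<^sub>R v)" if "0 < s" "s < H" for H
      unfolding in_segment using that v0
      by (auto intro!: exI[of _ "s / H"] simp: algebra_simps)
    then have "p \<in> open_segment x (x + ?h *\<^sub>R v)" using 3 s by metis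
    moreover have "x + ?h *\<^sub>R v \<in> P" using x(2) by simp
    ultimately show ?thesis using p(1) x(1) by (auto simp: verts_def extreme_point_of_def)
  qed
qed

text \<open>The two inequalities used for mutation data need only fibre ends of points of
  \<open>V\<close> in \<open>P\<close>, and of vertices of \<open>P\<close> in the hull of
  \<open>V\<close>. A relation quantified over all directions is thus reduced to finitely many
  memberships.\<close>

lemma same_hgt_points:
  assumes P: "fano_polygon P" and wv: "w \<bullet> v = 0" and V: "finite V" "V \<noteq> {}" 
    and a_neg: "\<And>q. q \<in> V \<Longrightarrow> w \<bullet> q < 0 \<Longrightarrow> q \<in> P \<and> q - (w \<bullet> q) *\<^sub>R v \<in> P"
    and a_pos: "\<And>q. q \<in> V \<Longrightarrow> w \<bullet> q \<ge> 0 \<Longrightarrow> q \<in> P \<or> q - (w \<bullet> q) *\<^sub>R v \<in> P"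
    and b_pos: "\<And>p. p \<in> verts P \<Longrightarrow> w \<bullet> p \<ge> 0 \<Longrightarrow> p \<in> convex hull V \<and> p + (w \<bullet> p) *\<^sub>R v \<in> convex hull V"
    and b_neg: "\<And>p. p \<in> verts P \<Longrightarrow> w \<bullet> p < 0 \<Longrightarrow> p \<in> convex hull V \<or> p + (w \<bullet> p) *\<^sub>R v \<in> convex hull V"
  shows "same_hgt w v P (convex hull V)"
proof (rule same_hgtI)
  note comp = fano_compact[OF P]
  have bnd: "bend w v u \<bullet> x = u \<bullet> x - min 0 (u \<bullet> v) * (w \<bullet> x)" for u x
    by (simp add: bend_def inner_diff_left)
  fix u
  show "- hgt P u \<le> bend w v u \<bullet> y" if y: "y \<in> V" for y
  proof (cases "w \<bullet> y < 0")
    case True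
    then have "- hgt P u \<le> u \<bullet> y" "- hgt P u \<le> u \<bullet> (y - (w \<bullet> y) *\<^sub>R v)"
      using a_neg[OF y] hgt_le[OF comp] by blast+
    then show ?thesis by (auto simp: bnd min_def inner_diff_right mult.commute)
  next
    case False
    have "(u \<bullet> v) * (w \<bullet> y) \<ge> min 0 (u \<bullet> v) * (w \<bullet> y)" "0 \<ge> min 0 (u \<bullet> v) * (w \<bullet> y)"
      using False by (auto intro: mult_right_mono mult_nonpos_nonneg)
    moreover have "- hgt P u \<le> u \<bullet> y \<or> - hgt P u \<le> u \<bullet> (y - (w \<bullet> y) *\<^sub>R v)"
      using a_pos[OF y] False hgt_le[OF comp] by (meson not_less)
    ultimately show ?thesis by (auto simp: bnd inner_diff_right mult.commute)
  qed
  obtain p where p: "p \<in> verts P" "p \<in> face P u"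
    using hull_face_vertex[OF fano_finite_verts[OF P] fano_verts_nonempty[OF P], of u]
    unfolding fano_hull[OF P, symmetric] by metis
  have pu: "u \<bullet> p = - hgt P u" using p face_eq[OF comp] by auto
  have "\<exists>x\<in>convex hull V. bend w v u \<bullet> x \<le> u \<bullet> p"
  proof (cases "w \<bullet> p < 0")
    case True
    have "(u \<bullet> v) * (w \<bullet> p) \<le> min 0 (u \<bullet> v) * (w \<bullet> p)" "0 \<le> min 0 (u \<bullet> v) * (w \<bullet> p)"
      using True by (auto intro: mult_right_mono_neg mult_nonpos_nonpos)
    then have "bend w v u \<bullet> p \<le> u \<bullet> p" "bend w v u \<bullet> (p + (w \<bullet> p) *\<^sub>R v) \<le> u \<bullet> p"
      by (simp_all add: bnd inner_add_right wv mult.commute)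
    then show ?thesis using b_neg[OF p(1) True] by blast
  next
    case False
    have "bend w v u \<bullet> p \<le> u \<bullet> p \<or> bend w v u \<bullet> (p + (w \<bullet> p) *\<^sub>R v) \<le> u \<bullet> p"
      by (cases "u \<bullet> v \<ge> 0") (simp_all add: bnd inner_add_right wv)
    then show ?thesis using b_pos[OF p(1)] False by (metis not_less)
  qed
  then obtain x where x: "x \<in> convex hull V" "bend w v u \<bullet> x \<le> - hgt P u" using pu by auto
  show "\<exists>y\<in>V. bend w v u \<bullet> y \<le> - hgt P u"
  proof (rule ccontr)
    assume "\<not> ?thesis"
    then have gt: "\<And>y. y \<in> V \<Longrightarrow> - hgt P u < bend w v u \<bullet> y" by auto
    obtain y where y: "y \<in> V" "\<And>z. z \<in> V \<Longrightarrow> bend w v u \<bullet> y \<le> bend w v u \<bullet> z"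
      using finite_argmin[OF V, of "\<lambda>x. bend w v u \<bullet> x"] by blast
    have "bend w v u \<bullet> y \<le> bend w v u \<bullet> x" using x(1) y(2) by (rule convex_hull_inner_ge)
    then show False using gt[OF y(1)] x(2) by simp
  qed
qed

text \<open>\<open>bend w v\<close> has the inverse \<open>bend (- w) v\<close> and is therefore
  onto, so the relation prescribes the support function of the result everywhere.\<close>

lemma same_hgt_unique:
  assumes "same_hgt w v P Q" "same_hgt w v P Q'" "w \<bullet> v = 0"
    and "compact Q" "convex Q" "Q \<noteq> {}" "compact Q'" "convex Q'" "Q' \<noteq> {}"
  shows "Q = Q'"
proof (rule convex_compact_eqI)
  fix u
  have "u = bend w v (bend (- w) v u)" using assms(3) bend_bend[of "- w" v u] by simp
  then show "hgt Q u = hgt Q' u" using assms(1,2) unfolding same_hgt_def by metis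
qed (use assms in auto)

lemma mutation_exists:
  assumes P: "fano_polygon P" and w: "w \<in> normals P" and long: "nhgt P w \<le> wid P w"
    and v: "primitive v" "w \<bullet> v = 0"
  shows "\<exists>Q. fano_polygon Q \<and> is_mutation P Q \<and> same_hgt w v P Q"
proof -
  have pw: "primitive w" using w normalsD by blast
  have L: "w \<in> lattice_pts" "v \<in> lattice_pts" using pw v primitive_lattice by auto
  let ?F = "convex hull {0, v}"
  let ?s = "\<lambda>p. p + (w \<bullet> p) *\<^sub>R v"
  \<comment> \<open>From height 0 on both ends of the fibre over a vertex are needed. Below, a
    vertex is kept if the segment starting at it in direction \<open>v\<close> lies in
    \<open>P\<close>, and is replaced by its shear if the segment ending at it does.\<close>
  define V where "V = {p \<in> verts P. w \<bullet> p \<ge> 0 \<or> p - (w \<bullet> p) *\<^sub>R v \<in> P} \<union>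
    ?s ` {p \<in> verts P. w \<bullet> p \<ge> 0 \<or> ?s p \<in> P}"
  \<comment> \<open>A level without points of \<open>V\<close> receives the empty piece.\<close>
  define G where "G h = convex hull {q \<in> V. w \<bullet> q = of_int h}" for h :: int
  have ws: "w \<bullet> ?s p = w \<bullet> p" for p using v(2) by (simp add: inner_add_right)
  have finV: "finite V" unfolding V_def using fano_finite_verts[OF P] by auto
  have primV: "primitive q" if qV: "q \<in> V" for q
  proof -
    consider "q \<in> verts P" | p where "p \<in> verts P" "q = ?s p" using qV unfolding V_def by blast
    then show ?thesis
      using fano_verts_primitive[OF P] primitive_shear[OF _ L v(2)] by cases auto
  qed
  have latV: "V \<subseteq> lattice_pts" using primV primitive_lattice by auto
  have a_neg: "q \<in> P \<and> q - (w \<bullet> q) *\<^sub>R v \<in> P" if "q \<in> V" "w \<bullet> q < 0" for q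
    using that fano_verts_subset[OF P] by (auto simp: V_def ws)
  have a_pos: "q \<in> P \<or> q - (w \<bullet> q) *\<^sub>R v \<in> P" if "q \<in> V" for q
    using that fano_verts_subset[OF P] by (auto simp: V_def ws)
  have b_pos: "p \<in> V \<and> ?s p \<in> V" if "p \<in> verts P" "w \<bullet> p \<ge> 0" for p
    using that by (auto simp: V_def)
  have b_neg: "p \<in> V \<or> ?s p \<in> V" if "p \<in> verts P" "w \<bullet> p < 0" for p
    using long_edge_slices[OF P pw v long that] that by (auto simp: V_def)
  have neV: "V \<noteq> {}" using fano_verts_nonempty[OF P] b_pos b_neg by (metis ex_in_conv not_less)
  have data: "mutation_data w P ?F G"
    unfolding mutation_data_def
  proof (intro ballI conjI)
    fix h assume h: "h \<in> neg_heights w P"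
    then have h0: "h < 0" by (simp add: neg_heights_def)
    have "finite {q \<in> V. w \<bullet> q = of_int h}" "{q \<in> V. w \<bullet> q = of_int h} \<subseteq> lattice_pts"
      using finV latV by auto
    then show "lattice_polytope (G h)" unfolding lattice_polytope_def G_def by blast
    show "{p. p extreme_point_of P \<and> w \<bullet> p = of_int h} \<subseteq> G h + (*\<^sub>R) (of_int \<bar>h\<bar>) ` ?F"
    proof
      fix p assume "p \<in> {p. p extreme_point_of P \<and> w \<bullet> p = of_int h}"
      then have p: "p \<in> verts P" "w \<bullet> p = of_int h" by (auto simp: verts_def)
      have F: "0 \<in> ?F" "v \<in> ?F" by (auto intro: hull_inc)
      have "p \<in> V \<or> ?s p \<in> V" using b_neg[of p] p h0 by simp
      then show "p \<in> G h + (*\<^sub>R) (of_int \<bar>h\<bar>) ` ?F"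
      proof
        assume "p \<in> V"
        then have "p \<in> G h" using p(2) by (simp add: G_def hull_inc)
        then have "p + of_int \<bar>h\<bar> *\<^sub>R 0 \<in> G h + (*\<^sub>R) (of_int \<bar>h\<bar>) ` ?F"
          using F(1) by (intro set_plus_intro imageI)
        then show ?thesis by simp
      next
        assume "?s p \<in> V"
        then have "?s p \<in> G h" using p(2) ws[of p] by (simp add: G_def hull_inc)
        then have "?s p + of_int \<bar>h\<bar> *\<^sub>R v \<in> G h + (*\<^sub>R) (of_int \<bar>h\<bar>) ` ?F"
          using F(2) by (intro set_plus_intro imageI)
        moreover have "?s p + of_int \<bar>h\<bar> *\<^sub>R v = p" using h0 p(2) by simp
        ultimately show ?thesis by argo
      qed
    qed
    show "G h + (*\<^sub>R) (of_int \<bar>h\<bar>) ` ?F \<subseteq> slice w P h"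
    proof -
      let ?S = "slice w P h"
      have cS: "convex ?S" by (simp add: slice_def)
      \<comment> \<open>The condition that both ends of a fibre lie in the slice is convex in the
        base point, so it suffices to check it on generators.\<close>
      let ?T = "{g. g \<in> ?S \<and> g + of_int \<bar>h\<bar> *\<^sub>R v \<in> ?S}"
      have "?T = ?S \<inter> (\<lambda>x. (- (of_int \<bar>h\<bar> *\<^sub>R v)) + x) ` ?S"
        by (force simp: image_iff algebra_simps)
      then have cT: "convex ?T" using cS by (metis convex_Int convex_translation)
      have "{q \<in> V. w \<bullet> q = of_int h} \<subseteq> ?T"
      proof
        fix q assume "q \<in> {q \<in> V. w \<bullet> q = of_int h}"
        then have q: "q \<in> V" "w \<bullet> q = of_int h" by auto
        then have qP: "q \<in> P" "q + of_int \<bar>h\<bar> *\<^sub>R v \<in> P" using a_neg[OF q(1)] h0 by auto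
        have "q \<in> lattice_pts" "q + of_int \<bar>h\<bar> *\<^sub>R v \<in> lattice_pts"
          using q(1) latV L(2) by (auto intro!: lattice_pts_add lattice_pts_scale)
        then show "q \<in> ?T" using qP q(2) v(2) by (auto simp: slice_def inner_add_right intro!: hull_inc)
      qed
      then have GT: "G h \<subseteq> ?T" unfolding G_def using cT by (intro hull_minimal)
      show ?thesis
      proof
        fix x assume "x \<in> G h + (*\<^sub>R) (of_int \<bar>h\<bar>) ` ?F"
        then obtain g t where g: "g \<in> G h" and t: "0 \<le> t" "t \<le> 1"
          and x: "x = g + of_int \<bar>h\<bar> *\<^sub>R t *\<^sub>R v"
          by (auto simp: segment_0 elim!: set_plus_elim)
        have "(1 - t) *\<^sub>R g + t *\<^sub>R (g + of_int \<bar>h\<bar> *\<^sub>R v) \<in> ?S"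
          using GT g t by (intro convexD[OF cS]) auto
        moreover have "(1 - t) *\<^sub>R g + t *\<^sub>R (g + of_int \<bar>h\<bar> *\<^sub>R v) = x"
          by (simp add: x algebra_simps)
        ultimately show "x \<in> ?S" by simp
      qed
    qed
  qed
  let ?Q = "convex hull V"
  have same: "same_hgt w v P ?Q"
    by (rule same_hgt_points[OF P v(2) finV neV])
      (use a_neg a_pos b_pos b_neg hull_subset[of V convex] in blast)+
  have Q: "fano_polygon ?Q"
  proof (rule fano_polygonI[OF finV neV primV])
    fix u :: plane assume u: "u \<noteq> 0"
    have eq: "u = bend w v (bend (- w) v u)" using v(2) bend_bend[of "- w" v u] by simp
    then have "bend (- w) v u \<noteq> 0" using u by (auto simp: bend_def)
    then show "0 < hgt ?Q u" using fano_hgt_pos[OF P] same eq unfolding same_hgt_def by metis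
  qed
  have "mut w P ?F G = ?Q"
  proof (rule antisym)
    \<comment> \<open>The generators of the mutation obey all supporting inequalities of
      \<open>?Q\<close>; a generator outside would be separated from it.\<close>
    have "y \<in> ?Q" if y: "y \<in> mutation_gens w P ?F G" for y
    proof (rule ccontr)
      assume "y \<notin> ?Q"
      then obtain a b where ab: "a \<bullet> y < b" "\<forall>x\<in>?Q. a \<bullet> x > b"
        using separating_hyperplane_closed_point[of ?Q y] fano_convex[OF Q] fano_compact[OF Q]
          compact_imp_closed by blast
      obtain x where x: "x \<in> ?Q" "a \<bullet> x = - hgt ?Q a"
        using hgt_attained[OF fano_compact[OF Q] fano_nonempty[OF Q]] by metis
      have a: "a = bend w v (bend (- w) v a)" using v(2) bend_bend[of "- w" v a] by simp
      have "hgt ?Q a = hgt P (bend (- w) v a)" using same a unfolding same_hgt_def by metis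
      moreover have "- hgt P (bend (- w) v a) \<le> a \<bullet> y"
        using mutation_gens_ge[OF P v(2) data y, of "bend (- w) v a"] a by simp
      ultimately show False using ab x by fastforce
    qed
    then show "mut w P ?F G \<subseteq> ?Q" unfolding mut_eq_gens by (intro hull_minimal) auto
    have "V \<subseteq> mutation_gens w P ?F G"
    proof
      fix q assume q: "q \<in> V"
      obtain h where h: "w \<bullet> q = of_int h"
        using lattice_pts_inner[OF L(1) subsetD[OF latV q]] by (rule Ints_cases)
      show "q \<in> mutation_gens w P ?F G"
      proof (cases "h < 0")
        case True
        have "q \<in> P" using a_neg[OF q] True h by simp
        then have "(INF x\<in>P. w \<bullet> x) \<le> of_int h"
          using hgt_le[OF fano_compact[OF P], of q w] h by (simp add: hgt_def)
        then have "h \<in> neg_heights w P" using True by (simp add: neg_heights_def)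
        moreover have "q \<in> G h" using q h by (simp add: G_def hull_inc)
        ultimately show ?thesis by (auto simp: mutation_gens_def)
      next
        case False
        then obtain p t where p: "p \<in> P" "p \<in> lattice_pts" "w \<bullet> p = of_int h"
          and t: "t = 0 \<or> t = 1" "q = p + of_int h *\<^sub>R t *\<^sub>R v"
        proof -
          consider "q \<in> verts P" | p where "p \<in> verts P" "q = ?s p" using q unfolding V_def by blast
          then show thesis
          proof cases
            case 1
            then show thesis using that[of q 0] fano_verts_subset[OF P] h fano_verts_lattice[OF P] by auto
          next
            case 2
            then show thesis using that[of p 1] fano_verts_subset[OF P] h fano_verts_lattice[OF P] ws[of p] by auto
          qed
        qed
        have "bdd_above ((\<lambda>x. w \<bullet> x) ` P)"
          by (intro bounded_imp_bdd_above compact_imp_bounded compact_continuous_image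
              fano_compact[OF P] continuous_intros)
        then have "w \<bullet> p \<le> (SUP x\<in>P. w \<bullet> x)" using p(1) by (intro cSUP_upper)
        then have hn: "h \<in> nonneg_heights w P" using False p(3) by (simp add: nonneg_heights_def)
        have "p \<in> slice w P h" using p unfolding slice_def by (intro hull_inc) auto
        moreover have "t *\<^sub>R v \<in> ?F" using t(1) by (auto intro: hull_inc)
        ultimately have "q \<in> slice w P h + (*\<^sub>R) (of_int h) ` ?F"
          unfolding t(2) by (intro set_plus_intro imageI)
        then show ?thesis using hn by (auto simp: mutation_gens_def)
      qed
    qed
    then show "?Q \<subseteq> mut w P ?F G" unfolding mut_eq_gens by (rule hull_mono)
  qed
  moreover have "is_mutation P (mut w P ?F G)"
  proof -
    have "face P w edge_of P" "inner_normal P (face P w) w"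
      using edge_of_iff[OF P] w pw by (auto simp: inner_normal_iff)
    then show ?thesis unfolding is_mutation_def using v data by blast
  qed
  ultimately show ?thesis using Q same by auto
qed

lemma multi_mutation:
  assumes P: "fano_polygon P" and w: "w \<in> normals P" and v: "primitive v" "w \<bullet> v = 0"
  shows "j * nhgt P w \<le> wid P w \<Longrightarrow> \<exists>Q. P \<sim>\<^sub>m Q \<and> same_hgt w (real j *\<^sub>R v) P Q \<and>
    wid Q w + j * nhgt P w = wid P w \<and> nhgt Q w = nhgt P w \<and>
    (only_T_singularities P \<longrightarrow> only_T_singularities Q)"
proof (induction j)
  case 0
  show ?case using mut_equiv_refl[OF P] by (auto simp: same_hgt_def bend_def)
next
  case (Suc j)
  have pw: "primitive w" using w normalsD by blast
  obtain Q where Q: "P \<sim>\<^sub>m Q" "same_hgt w (real j *\<^sub>R v) P Q" "wid Q w + j * nhgt P w = wid P w"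
    "nhgt Q w = nhgt P w" "only_T_singularities P \<longrightarrow> only_T_singularities Q"
    using Suc by auto
  have FQ: "fano_polygon Q" using Q(1) mut_equivD by blast
  have long: "nhgt Q w \<le> wid Q w" using Suc.prems Q(3,4) by simp
  then have "w \<in> normals Q" using nhgt_pos[OF P pw] Q(4) pw by (simp add: normals_def)
  then obtain R where R: "fano_polygon R" "is_mutation Q R" "same_hgt w v Q R"
    using mutation_exists[OF FQ _ long v] by blast
  interpret mp: mutation_pair Q R w v using FQ R v pw by (simp add: mutation_pair_def)
  have "P \<sim>\<^sub>m R" using Q(1) mut_equiv_mutation[OF FQ R(1,2)] by (rule mut_equiv_trans)
  moreover have "same_hgt w (real (Suc j) *\<^sub>R v) P R"
  proof -
    have "hgt R (bend w (real (Suc j) *\<^sub>R v) u) = hgt P u" for u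
    proof -
      have "bend w (real (Suc j) *\<^sub>R v) u = bend w v (bend w (real j *\<^sub>R v) u)"
        using bend_scale[of "real j" w v u] v(2) by (simp add: add.commute)
      then show ?thesis using R(3) Q(2) unfolding same_hgt_def by metis
    qed
    then show ?thesis unfolding same_hgt_def by blast
  qed
  moreover have "wid R w + Suc j * nhgt P w = wid P w" using mp.wid_Q_w(1) Q(3,4) by simp
  moreover have "nhgt R w = nhgt P w" using Q(4) by (simp add: nhgt_def)
  moreover have "only_T_singularities P \<longrightarrow> only_T_singularities R" using Q(5) mp.only_T_mutation by blast
  ultimately show ?case by blast
qed

text \<open>The point named in \<open>bottom\<close> certifies that \<open>j\<close> mutations are
  possible: it has lowest level, and its fibre of length \<open>j\<close> times the height lies in
  the edge. Uniqueness then identifies the outcome with the given hull.\<close>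

lemma mut_equiv_points:
  assumes P: "fano_polygon P" and w: "primitive w" and v: "primitive v" "w \<bullet> v = 0" and j: "j > 0"
    and V: "finite V" "V \<noteq> {}"
    and a_neg: "\<And>q. q \<in> V \<Longrightarrow> w \<bullet> q < 0 \<Longrightarrow> q \<in> P \<and> q - (w \<bullet> q) *\<^sub>R real j *\<^sub>R v \<in> P"
    and a_pos: "\<And>q. q \<in> V \<Longrightarrow> w \<bullet> q \<ge> 0 \<Longrightarrow> q \<in> P \<or> q - (w \<bullet> q) *\<^sub>R real j *\<^sub>R v \<in> P"
    and b_pos: "\<And>p. p \<in> verts P \<Longrightarrow> w \<bullet> p \<ge> 0 \<Longrightarrow>
      p \<in> convex hull V \<and> p + (w \<bullet> p) *\<^sub>R real j *\<^sub>R v \<in> convex hull V"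
    and b_neg: "\<And>p. p \<in> verts P \<Longrightarrow> w \<bullet> p < 0 \<Longrightarrow>
      p \<in> convex hull V \<or> p + (w \<bullet> p) *\<^sub>R real j *\<^sub>R v \<in> convex hull V"
    and bottom: "q \<in> V" "w \<bullet> q < 0" "\<And>p. p \<in> verts P \<Longrightarrow> w \<bullet> q \<le> w \<bullet> p"
  shows "P \<sim>\<^sub>m convex hull V"
proof -
  have qP: "q \<in> P" "q - (w \<bullet> q) *\<^sub>R real j *\<^sub>R v \<in> P" using a_neg bottom by auto
  have "w \<bullet> q \<le> w \<bullet> x" if "x \<in> P" for x
    using that bottom(3) fano_hull[OF P] convex_hull_inner_ge by metis
  then have h: "hgt P w = - (w \<bullet> q)" using qP(1) by (intro hgt_eqI) auto
  have "q \<in> face P w" "q + (hgt P w * real j) *\<^sub>R v \<in> face P w"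
    using qP v(2) by (auto simp: face_eq[OF fano_compact[OF P]] h inner_diff_right)
  then have le: "hgt P w * real j \<le> real (wid P w)" by (rule face_length[OF P w v])
  then have "real (j * nhgt P w) \<le> real (wid P w)" by (simp add: real_nhgt[OF P w] mult.commute)
  then have le': "j * nhgt P w \<le> wid P w" by (simp only: of_nat_le_iff)
  then have wn: "w \<in> normals P"
    using j nhgt_pos[OF P w] w by (auto simp: normals_def intro!: gr0I)
  obtain Q where Q: "P \<sim>\<^sub>m Q" "same_hgt w (real j *\<^sub>R v) P Q"
    using multi_mutation[OF P wn v le'] by blast
  have same: "same_hgt w (real j *\<^sub>R v) P (convex hull V)"
    using v(2) by (intro same_hgt_points[OF P _ V a_neg a_pos b_pos b_neg]) simp_all
  have FQ: "fano_polygon Q" using Q(1) mut_equivD by blast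
  have "Q = convex hull V"
    by (rule same_hgt_unique[OF Q(2) same])
      (use v(2) V fano_compact[OF FQ] fano_convex[OF FQ] fano_nonempty[OF FQ] in
        \<open>auto simp: compact_convex_hull finite_imp_compact\<close>)
  then show ?thesis using Q(1) by simp
qed

section \<open>Polygons that no mutation shortens\<close>

definition minimal :: "plane set \<Rightarrow> bool" where
  "minimal P \<longleftrightarrow> (\<forall>u\<in>normals P. nhgt P u \<le> nhgt P (- u))"

text \<open>By divisibility every edge is at least as long as high. An edge higher than the opposite
  side can therefore be mutated, and the boundary length drops by the difference of the two
  heights.\<close>

lemma mut_equiv_minimal:
  assumes "fano_polygon P" "only_T_singularities P"
  shows "\<exists>Q. P \<sim>\<^sub>m Q \<and> only_T_singularities Q \<and> minimal Q"
  using assms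
proof (induction "normal_sum (\<lambda>k h. k) P" arbitrary: P rule: less_induct)
  case less
  show ?case
  proof (cases "minimal P")
    case True then show ?thesis using less.prems mut_equiv_refl by blast
  next
    case False
    then obtain w where w: "w \<in> normals P" "nhgt P (- w) < nhgt P w"
      by (auto simp: minimal_def not_le simp del: split_paired_All)
    have pw: "primitive w" "wid P w > 0" using w normalsD by auto
    then have long: "nhgt P w \<le> wid P w"
      using less.prems w only_T_iff dvd_imp_le by blast
    let ?v = "quarter_turn w"
    have v: "primitive ?v" "w \<bullet> ?v = 0" using pw by auto
    obtain Q where Q: "fano_polygon Q" "is_mutation P Q" "same_hgt w ?v P Q"
      using mutation_exists[OF less.prems(1) w(1) long v] by blast
    interpret mp: mutation_pair P Q w ?v
      using less.prems Q pw v by (simp add: mutation_pair_def)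
    have "normal_sum (\<lambda>k h. k) Q < normal_sum (\<lambda>k h. k) P"
      using mp.boundary_length_mutation w(2) by linarith
    then obtain R where "Q \<sim>\<^sub>m R" "only_T_singularities R" "minimal R"
      using less.hyps Q(1) mp.only_T_mutation less.prems by blast
    then show ?thesis
      using mut_equiv_trans mut_equiv_mutation[OF less.prems(1) Q(1,2)] by blast
  qed
qed

lemma (in unimodular) minimal_image: "minimal (f ` P) \<longleftrightarrow> minimal P"
proof -
  have neg: "adjoint f (- u) = - adjoint f u" for u using linear_adjoint by (rule linear_neg)
  show ?thesis
  proof
    assume *: "minimal (f ` P)"
    show "minimal P"
      unfolding minimal_def
    proof
      fix x assume x: "x \<in> normals P"
      obtain u where u: "x = adjoint f u" using surj_adjoint by (rule surjE)
      then have "nhgt (f ` P) u \<le> nhgt (f ` P) (- u)"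
        using * x normals_image unfolding minimal_def by blast
      then show "nhgt P x \<le> nhgt P (- x)" by (simp add: nhgt_def hgt_image u neg)
    qed
  next
    assume "minimal P"
    then show "minimal (f ` P)"
      unfolding minimal_def nhgt_def hgt_image neg normals_image[abs_def]
      using normals_image by blast
  qed
qed

section \<open>Consecutive edges\<close>

text \<open>Gift wrapping around the end \<open>q\<close> of a face, which may be a single vertex:
  among the vertices strictly above the face, the one whose direction from \<open>q\<close> leans
  outwards most spans the next edge. The sign \<open>e\<close> selects the end and hence the sense
  of rotation.\<close>

lemma adjacent_edge:
  assumes P: "fano_polygon P" and u: "primitive u" and e: "e = 1 \<or> e = (-1 :: real)"
    and q: "q \<in> face P u" "\<And>x. x \<in> face P u \<Longrightarrow> e * (quarter_turn u \<bullet> x) \<le> e * (quarter_turn u \<bullet> q)"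
  obtains u' where "u' \<in> normals P" "e * (u \<bullet> quarter_turn u') > 0" "q \<in> face P u'"
    "q + (e * real (wid P u')) *\<^sub>R quarter_turn u' \<in> verts P" "q \<in> verts P"
proof -
  let ?J = "quarter_turn u"
  note comp = fano_compact[OF P]
  have u0: "u \<noteq> 0" using u primitive_nonzero by blast
  have JJ: "?J \<bullet> ?J > 0" using u primitive_nonzero[of ?J] by simp
  have qP: "q \<in> P" "u \<bullet> q = - hgt P u" using q(1) face_eq[OF comp] by auto
  have qV: "q \<in> verts P"
  proof -
    obtain p where p: "p \<in> verts P" "p + real (wid P u) *\<^sub>R ?J \<in> verts P"
      "face P u = {p + t *\<^sub>R ?J | t. 0 \<le> t \<and> t \<le> real (wid P u)}"
      by (rule fano_face_ends[OF P u])
    obtain t where t: "q = p + t *\<^sub>R ?J" "0 \<le> t" "t \<le> real (wid P u)" using q(1) p(3) by blast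
    have mem: "p + t *\<^sub>R ?J \<in> face P u" if "0 \<le> t" "t \<le> real (wid P u)" for t
      using p(3) that by blast
    from e show ?thesis
    proof
      assume "e = 1"
      then have "?J \<bullet> (p + real (wid P u) *\<^sub>R ?J) \<le> ?J \<bullet> q"
        using q(2)[OF mem[of "real (wid P u)"]] by simp
      then have "real (wid P u) \<le> t" using JJ by (simp add: t inner_add_right)
      then show ?thesis using t p by simp
    next
      assume "e = - 1"
      then have "?J \<bullet> q \<le> ?J \<bullet> (p + 0 *\<^sub>R ?J)" using q(2)[OF mem[of 0]] by simp
      then have "t * (?J \<bullet> ?J) \<le> 0" by (simp add: t inner_add_right)
      then have "t = 0" using JJ t(2) by (simp add: mult_le_0_iff)
      then show ?thesis using t p by simp
    qed
  qed
  define V where "V = {x \<in> verts P. u \<bullet> x > u \<bullet> q}"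
  \<comment> \<open>If no vertex lay above the face, the heights of \<open>P\<close> at
    \<open>u\<close> and \<open>- u\<close> would cancel.\<close>
  have "V \<noteq> {}"
  proof
    assume "V = {}"
    then have "u \<bullet> x \<le> u \<bullet> q" if "x \<in> verts P" for x
      using that unfolding V_def by (metis (mono_tags, lifting) empty_iff mem_Collect_eq not_less)
    then have "- (u \<bullet> q) \<le> (- u) \<bullet> x" if "x \<in> P" for x
      using that convex_hull_inner_ge[of x "verts P" "- (u \<bullet> q)" "- u"] fano_hull[OF P] by auto
    then have "hgt P (- u) = u \<bullet> q" using qP(1) by (intro hgt_eqI) auto
    then show False
      using fano_hgt_pos[OF P, of u] fano_hgt_pos[OF P, of "- u"] u0 qP(2) by simp
  qed
  moreover have "finite V" using fano_finite_verts[OF P] by (simp add: V_def)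
  ultimately obtain x where x: "x \<in> V" and
    max: "\<And>y. y \<in> V \<Longrightarrow> e * (?J \<bullet> (y - q)) / (u \<bullet> (y - q)) \<le> e * (?J \<bullet> (x - q)) / (u \<bullet> (x - q))"
    using finite_argmin[of V "\<lambda>y. - (e * (?J \<bullet> (y - q)) / (u \<bullet> (y - q)))"] by auto
  have xV: "x \<in> verts P" "u \<bullet> (x - q) > 0" using x by (auto simp: V_def inner_diff_right)
  have "x - q \<in> lattice_pts" "x - q \<noteq> 0"
    using lattice_pts_diff[OF subsetD[OF fano_verts_lattice[OF P] xV(1)]
        subsetD[OF fano_verts_lattice[OF P] qV]] xV(2) by auto
  then obtain d and k :: nat where d: "primitive d" "k > 0" "x - q = real k *\<^sub>R d"
    using primitive_direction by metis
  have ud: "u \<bullet> d > 0" using xV(2) d by (simp add: zero_less_mult_iff)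
  \<comment> \<open>The sign is chosen so that \<open>quarter_turn u'\<close> is \<open>d\<close>
    for \<open>e = 1\<close> and \<open>- d\<close> for \<open>e = - 1\<close>, which makes
    \<open>u'\<close> an inner normal.\<close>
  define u' where "u' = (- e) *\<^sub>R quarter_turn d"
  have e2: "e * e = 1" using e by auto
  have Ju': "quarter_turn u' = e *\<^sub>R d" by (simp add: u'_def quarter_turn_linear)
  have pu': "primitive u'" using e d(1) by (auto simp: u'_def)
  have pos: "e * (u \<bullet> quarter_turn u') > 0" using ud e2 by (simp add: Ju' flip: mult.assoc)
  \<comment> \<open>Expansion of \<open>u'\<close> in the orthogonal basis \<open>u\<close>,
    \<open>?J\<close>; its sign on \<open>y - q\<close> is decided by the comparison of
    slopes.\<close>
  have u'y: "(u \<bullet> u) * (u' \<bullet> y) = e * (?J \<bullet> d) * (u \<bullet> y) - (u \<bullet> d) * (e * (?J \<bullet> y))" for y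
    by (simp add: u'_def quarter_turn_def inner_plane algebra_simps)
  have ge: "u' \<bullet> (y - q) \<ge> 0" if y: "y \<in> verts P" for y
  proof -
    have yP: "y \<in> P" using y fano_verts_subset[OF P] by auto
    have "(u \<bullet> d) * (e * (?J \<bullet> (y - q))) \<le> e * (?J \<bullet> d) * (u \<bullet> (y - q))"
    proof (cases "y \<in> V")
      case True
      then have yq: "u \<bullet> (y - q) > 0" by (simp add: V_def inner_diff_right)
      have "e * (?J \<bullet> (x - q)) / (u \<bullet> (x - q)) = e * (?J \<bullet> d) / (u \<bullet> d)"
        using d(2) by (simp add: d(3))
      then have "e * (?J \<bullet> (y - q)) / (u \<bullet> (y - q)) \<le> e * (?J \<bullet> d) / (u \<bullet> d)"
        using max[OF True] by simp
      then show ?thesis using ud yq by (simp add: divide_simps mult.commute)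
    next
      case False
      then have "u \<bullet> y = u \<bullet> q" using y hgt_le[OF comp yP, of u] qP(2) by (simp add: V_def)
      then have "y \<in> face P u" using yP qP(2) by (simp add: face_eq[OF comp])
      then have "e * (?J \<bullet> (y - q)) \<le> 0" using q(2)[of y] by (simp add: inner_diff_right algebra_simps)
      then show ?thesis using \<open>u \<bullet> y = u \<bullet> q\<close> ud by (simp add: inner_diff_right mult_nonneg_nonpos)
    qed
    then have "(u \<bullet> u) * (u' \<bullet> (y - q)) \<ge> 0" unfolding u'y by simp
    moreover have "u \<bullet> u > 0" using u0 by simp
    ultimately show ?thesis by (simp add: zero_le_mult_iff)
  qed
  have geP: "u' \<bullet> q \<le> u' \<bullet> y" if "y \<in> P" for y
    using that convex_hull_inner_ge[of y "verts P" "u' \<bullet> q" u'] fano_hull[OF P] ge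
    by (auto simp: inner_diff_right)
  then have qF: "q \<in> face P u'" using qP(1) by (simp add: face_def)
  have "u' \<bullet> (x - q) = 0" by (simp add: d(3) u'_def)
  then have "u' \<bullet> x = u' \<bullet> q" by (simp add: inner_diff_right)
  then have xF: "x \<in> face P u'"
    using geP xV(1) fano_verts_subset[OF P] by (auto simp: face_def)
  have "x \<noteq> q" using xV(2) by auto
  then have un: "u' \<in> normals P" using normalsI[OF P pu' xF qF] by blast
  obtain p where p: "p \<in> verts P" "p + real (wid P u') *\<^sub>R quarter_turn u' \<in> verts P"
    "face P u' = {p + t *\<^sub>R quarter_turn u' | t. 0 \<le> t \<and> t \<le> real (wid P u')}"
    by (rule fano_face_ends[OF P pu'])
  obtain t where t: "q = p + t *\<^sub>R quarter_turn u'" "0 \<le> t" "t \<le> real (wid P u')"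
    using qF p(3) by blast
  have minq: "u \<bullet> q \<le> u \<bullet> y" if "y \<in> verts P" for y
    using that hgt_le[OF comp, of y u] qP(2) fano_verts_subset[OF P] by auto
  have "q + (e * real (wid P u')) *\<^sub>R quarter_turn u' \<in> verts P"
    using e
  proof
    assume e1: "e = 1"
    have "t * (u \<bullet> quarter_turn u') \<le> 0" using minq[OF p(1)] by (simp add: t(1) inner_add_right)
    then have "t = 0" using t(2) pos e1 by (simp add: mult_le_0_iff)
    then show ?thesis using t p e1 by simp
  next
    assume e1: "e = - 1"
    have "t * (u \<bullet> quarter_turn u') \<le> real (wid P u') * (u \<bullet> quarter_turn u')"
      using minq[OF p(2)] by (simp add: t(1) inner_add_right)
    then have "real (wid P u') \<le> t" using pos e1 by simp
    then have "t = real (wid P u')" using t(3) by simp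
    then show ?thesis using t p e1 by simp
  qed
  then show thesis using that un pos qF qV by blast
qed

section \<open>Edges in integer coordinates\<close>

definition ipt :: "plane set \<Rightarrow> int \<Rightarrow> int \<Rightarrow> bool" where
  "ipt P x y \<longleftrightarrow> (of_int x, of_int y) \<in> P"

abbreviation ivec :: "int \<Rightarrow> int \<Rightarrow> plane" where
  "ivec a b \<equiv> (of_int a, of_int b)"

lemma primitive_ivec [simp]: "primitive (ivec a b) \<longleftrightarrow> coprime a b"
  by (auto simp: primitive_def)

lemma ivec_inner: "ivec a b \<bullet> ivec x y = of_int (a * x + b * y)"
  by (simp add: inner_plane)

lemma fano_iptE:
  assumes "fano_polygon P" "v \<in> verts P"
  obtains x y where "v = ivec x y" "ipt P x y" "coprime x y"
  using assms fano_verts_primitive[OF assms] fano_verts_subset[OF assms(1)]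
  by (auto simp: primitive_def ipt_def)

text \<open>The vertices are lattice points, so an inequality at the integer points of
  \<open>P\<close> spreads to all of it. The classification can therefore be carried out in integer
  arithmetic.\<close>

lemma fano_ge_ipt:
  assumes P: "fano_polygon P" and ge: "\<And>x y. ipt P x y \<Longrightarrow> c \<le> a * x + b * y" and z: "z \<in> P"
  shows "of_int c \<le> ivec a b \<bullet> z"
proof -
  have "of_int c \<le> ivec a b \<bullet> v" if v: "v \<in> verts P" for v
  proof -
    obtain x y where "v = ivec x y" "ipt P x y" using fano_iptE[OF P v] by metis
    then have "real_of_int c \<le> of_int (a * x + b * y)" using ge[of x y] by (simp only: of_int_le_iff)
    then show ?thesis by (simp only: \<open>v = ivec x y\<close> ivec_inner)
  qed
  moreover have "z \<in> convex hull verts P" using z fano_hull[OF P] by simp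
  ultimately show ?thesis by (meson convex_hull_inner_ge)
qed

lemma hgt_ipt:
  assumes P: "fano_polygon P" and "ipt P x0 y0" "\<And>x y. ipt P x y \<Longrightarrow> a * x0 + b * y0 \<le> a * x + b * y"
  shows "hgt P (ivec a b) = - of_int (a * x0 + b * y0)"
proof (rule hgt_eqI[of "ivec x0 y0"])
  show "ivec x0 y0 \<in> P" using assms by (simp add: ipt_def)
  show "ivec a b \<bullet> ivec x0 y0 = - (- of_int (a * x0 + b * y0))" by (simp add: ivec_inner)
  show "- (- of_int (a * x0 + b * y0)) \<le> ivec a b \<bullet> z" if "z \<in> P" for z
    using fano_ge_ipt[OF P assms(3) that] by simp
qed

lemma nhgt_ipt:
  assumes "fano_polygon P" "ipt P x0 y0" "\<And>x y. ipt P x y \<Longrightarrow> a * x0 + b * y0 \<le> a * x + b * y"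
  shows "int (nhgt P (ivec a b)) = max 0 (- (a * x0 + b * y0))"
proof -
  define k where "k = a * x0 + b * y0"
  have "hgt P (ivec a b) = of_int (- k)" using hgt_ipt[OF assms] by (simp only: k_def of_int_minus)
  then show ?thesis by (simp add: nhgt_def flip: k_def)
qed

text \<open>The edge that follows (\<open>e = 1\<close>) or precedes (\<open>e = -1\<close>), in anticlockwise order, the face
  with inner normal \<open>(c, d)\<close>.\<close>

lemma adjacent_edge_ipt:
  assumes P: "fano_polygon P" and T: "only_T_singularities P" and cd: "coprime c d"
    and e: "e = 1 \<or> e = (- 1 :: int)" and q: "ipt P qx qy"
    and min: "\<And>x y. ipt P x y \<Longrightarrow> c * qx + d * qy \<le> c * x + d * y"
    and ext: "\<And>x y. ipt P x y \<Longrightarrow> c * x + d * y = c * qx + d * qy \<Longrightarrow> e * (d * x - c * y) \<le> e * (d * qx - c * qy)"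
  obtains a b m h where "coprime a b" "h \<ge> 1" "m \<ge> 1" "e * (c * b - d * a) > 0"
    "a * qx + b * qy = - h" "\<And>x y. ipt P x y \<Longrightarrow> - h \<le> a * x + b * y"
    "ipt P (qx + e * (m * h * b)) (qy - e * (m * h * a))"
    "\<And>x y. ipt P x y \<Longrightarrow> a * x + b * y = - h \<Longrightarrow> e * (b * x - a * y) \<le> e * (b * qx - a * qy) + m * h * (a * a + b * b)"
    "ivec a b \<in> normals P" "int (nhgt P (ivec a b)) = h" "int (wid P (ivec a b)) = m * h"
proof -
  let ?u = "ivec c d" and ?q = "ivec qx qy"
  note comp = fano_compact[OF P]
  have u: "primitive ?u" using cd by simp
  have q_in: "?q \<in> P" using q by (simp add: ipt_def)
  have hu: "hgt P ?u = - of_int (c * qx + d * qy)" by (rule hgt_ipt[OF P q min])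
  have qF: "?q \<in> face P ?u" using q_in hu by (simp add: face_eq[OF comp] ivec_inner)
  have qext: "of_int e * (quarter_turn ?u \<bullet> x) \<le> of_int e * (quarter_turn ?u \<bullet> ?q)" if x: "x \<in> face P ?u" for x
  proof -
    have "x \<in> convex hull (verts P \<inter> face P ?u)"
      using x face_convex_hull[OF fano_finite_verts[OF P], of ?u] fano_hull[OF P] by simp
    then have "- (of_int e * (quarter_turn ?u \<bullet> ?q)) \<le> (- of_int e *\<^sub>R quarter_turn ?u) \<bullet> x"
    proof (rule convex_hull_inner_ge)
      fix y assume y: "y \<in> verts P \<inter> face P ?u"
      then obtain i j where ij: "y = ivec i j" "ipt P i j" using fano_iptE[OF P] by (metis IntD1)
      have "ivec c d \<bullet> y = - hgt P ?u" using y face_eq[OF comp] by auto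
      then have "of_int (c * i + d * j) = (of_int (c * qx + d * qy) :: real)"
        using hu by (simp only: ij ivec_inner)
      then have "c * i + d * j = c * qx + d * qy" by (simp only: of_int_eq_iff)
      then have "e * (d * i - c * j) \<le> e * (d * qx - c * qy)" using ext ij(2) by blast
      then have "real_of_int (e * (d * i - c * j)) \<le> of_int (e * (d * qx - c * qy))"
        by (simp only: of_int_le_iff)
      then show "- (of_int e * (quarter_turn ?u \<bullet> ?q)) \<le> (- of_int e *\<^sub>R quarter_turn ?u) \<bullet> y"
        by (simp add: ij quarter_turn_def inner_plane algebra_simps)
    qed
    then show ?thesis by simp
  qed
  have e': "real_of_int e = 1 \<or> real_of_int e = - 1" using e by auto
  obtain u' where u': "u' \<in> normals P" "of_int e * (?u \<bullet> quarter_turn u') > 0" "?q \<in> face P u'"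
    "?q + (of_int e * real (wid P u')) *\<^sub>R quarter_turn u' \<in> verts P"
    by (rule adjacent_edge[OF P u e' qF qext])
  obtain a b where ab: "u' = ivec a b" "coprime a b"
    using u'(1) by (auto simp: normals_def primitive_def)
  define h where "h = int (nhgt P u')"
  have pu: "primitive u'" using u'(1) normalsD by blast
  have h1: "h \<ge> 1" using nhgt_pos[OF P pu] by (simp add: h_def)
  have hr: "hgt P u' = of_int h" using real_nhgt[OF P pu] by (simp add: h_def)
  \<comment> \<open>The T-condition enters here: the length of the edge is \<open>m\<close> times
    its height.\<close>
  have "nhgt P u' dvd wid P u'" using T u'(1) only_T_iff[OF P] by blast
  then obtain m' where m': "wid P u' = nhgt P u' * m'" by (elim dvdE)
  define m where "m = int m'"
  have mh: "int (wid P u') = m * h" by (simp add: m' m_def h_def)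
  have "wid P u' > 0" using u'(1) normalsD by blast
  then have m1: "m \<ge> 1" using mh h1 by (simp add: m_def m')
  have qh: "a * qx + b * qy = - h"
  proof -
    have "u' \<bullet> ?q = - hgt P u'" using u'(3) face_eq[OF comp] by auto
    then have "real_of_int (a * qx + b * qy) = of_int (- h)" by (simp only: ab ivec_inner hr[unfolded ab] of_int_minus)
    then show ?thesis by (simp only: of_int_eq_iff)
  qed
  have geh: "- h \<le> a * x + b * y" if "ipt P x y" for x y
  proof -
    have "- hgt P u' \<le> u' \<bullet> ivec x y" using hgt_le[OF comp] that by (simp add: ipt_def)
    then have "real_of_int (- h) \<le> of_int (a * x + b * y)" by (simp only: ab ivec_inner hr[unfolded ab] of_int_minus)
    then show ?thesis by (simp only: of_int_le_iff)
  qed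
  have wr: "real (wid P u') = of_int (m * h)" using mh by (metis of_int_of_nat_eq)
  let ?E = "ivec (qx + e * (m * h * b)) (qy - e * (m * h * a))"
  have Eeq: "?q + (of_int e * real (wid P u')) *\<^sub>R quarter_turn u' = ?E"
    unfolding wr by (simp add: ab quarter_turn_def)
  then have Ev: "?E \<in> verts P" using u'(4) by simp
  have line: "e * (b * x - a * y) \<le> e * (b * qx - a * qy) + m * h * (a * a + b * b)"
    if xy: "ipt P x y" "a * x + b * y = - h" for x y
  proof -
    have xF: "ivec x y \<in> face P u'"
    proof -
      have "u' \<bullet> ivec x y = - hgt P u'" using xy(2) hr by (simp only: ab ivec_inner of_int_minus)
      then show ?thesis using xy(1) by (simp add: face_eq[OF comp] ipt_def)
    qed
    have "ivec x y - ?q \<in> lattice_pts" by (intro lattice_pts_diff) simp_all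
    moreover have "u' \<bullet> (ivec x y - ?q) = 0"
      unfolding inner_diff_right by (simp only: ab ivec_inner xy(2) qh diff_self)
    ultimately obtain k :: int where k: "ivec x y - ?q = of_int k *\<^sub>R quarter_turn u'"
      using lattice_orthogonal_multiple[OF pu] by metis
    have "ivec x y = ?q + (of_int e * of_int (e * k)) *\<^sub>R quarter_turn u'"
    proof -
      have "e * (e * k) = k" using e by auto
      then have "real_of_int e * of_int (e * k) = of_int k" by (metis of_int_mult)
      then show ?thesis using k by (metis add.commute diff_eq_eq)
    qed
    then have mem: "?q + of_int (e * k) *\<^sub>R (of_int e *\<^sub>R quarter_turn u') \<in> face P u'"
      using xF by (simp add: mult.commute)
    have v': "primitive (of_int e *\<^sub>R quarter_turn u')" "u' \<bullet> (of_int e *\<^sub>R quarter_turn u') = 0"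
      using e pu by auto
    have "real_of_int (e * k) \<le> real (wid P u')" by (rule face_length[OF P pu v' u'(3) mem])
    then have ek: "e * k \<le> m * h" unfolding wr by (simp only: of_int_le_iff)
    have "x - qx = k * b" "y - qy = - (k * a)"
    proof -
      have "real_of_int (x - qx) = of_int (k * b)" "real_of_int (y - qy) = of_int (- (k * a))"
        using k by (auto simp: ab quarter_turn_def)
      then show "x - qx = k * b" "y - qy = - (k * a)" by (simp_all only: of_int_eq_iff)
    qed
    then have xk: "x = qx + k * b" "y = qy - k * a" by auto
    have "e * (b * x - a * y) = e * (b * qx - a * qy) + (e * k) * (a * a + b * b)"
      unfolding xk by (simp add: algebra_simps)
    also have "\<dots> \<le> e * (b * qx - a * qy) + m * h * (a * a + b * b)"
      using ek by (intro add_left_mono mult_right_mono) auto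
    finally show ?thesis .
  qed
  have det: "e * (c * b - d * a) > 0"
  proof -
    have "0 < real_of_int (e * (c * b - d * a))"
      using u'(2) by (simp add: ab quarter_turn_def inner_plane algebra_simps)
    then show ?thesis by (simp only: of_int_0_less_iff)
  qed
  have ptE: "ipt P (qx + e * (m * h * b)) (qy - e * (m * h * a))"
    using Ev fano_verts_subset[OF P] by (auto simp: ipt_def)
  show thesis
    by (rule that[OF ab(2) h1 m1 det qh geh ptE line])
      (use u'(1) mh h_def ab(1) in simp_all)
qed

section \<open>Classification of the polygons that no mutation shortens\<close>

definition in_strip :: "plane set \<Rightarrow> bool" where
  "in_strip P \<longleftrightarrow> (\<forall>x y. ipt P x y \<longrightarrow> \<bar>y\<bar> \<le> 1)"

text \<open>What the case analysis leaves over: the first triangle comes from an edge of height 1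
  and length 3, the fourth and fifth from an edge twice as long as high, the others from an edge as
  long as high.\<close>

definition triangles :: "plane set set" where
  "triangles = {
     convex hull {ivec (-1) (-1), ivec 2 (-1), ivec (-1) 2},
     convex hull {ivec (-1) (-3), ivec 2 (-3), ivec (-1) 3},
     convex hull {ivec (-1) (-3), ivec 2 (-3), ivec (-1) 6},
     convex hull {ivec (-1) (-2), ivec 3 (-2), ivec (-1) 2},
     convex hull {ivec (-1) (-3), ivec 5 (-3), ivec (-1) 3},
     convex hull {ivec (-1) (-4), ivec 3 (-4), ivec (-1) 4},
     convex hull {ivec (-2) (-5), ivec 3 (-5), ivec (-2) 5}}"

definition reducible :: "plane set \<Rightarrow> bool" where
  "reducible P \<longleftrightarrow> (\<exists>f. unimodular f \<and> (in_strip (f ` P) \<or> f ` P \<in> triangles))"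

lemma unimodular_comp: "unimodular f \<Longrightarrow> unimodular g \<Longrightarrow> unimodular (f \<circ> g)"
  unfolding unimodular_def by (metis image_comp linear_compose)

lemma reducible_image: "unimodular g \<Longrightarrow> reducible (g ` P) \<Longrightarrow> reducible P"
  unfolding reducible_def using unimodular_comp by (metis image_comp)

definition imat :: "int \<Rightarrow> int \<Rightarrow> int \<Rightarrow> int \<Rightarrow> plane \<Rightarrow> plane" where
  "imat a b c d x = (of_int a * fst x + of_int b * snd x, of_int c * fst x + of_int d * snd x)"

lemma unimodular_imat: "\<bar>a * d - b * c\<bar> = 1 \<Longrightarrow> unimodular (imat a b c d)"
  using unimodular_matrix[of a d b c] by (simp add: imat_def[abs_def])

lemma imat_ivec: "imat a b c d (ivec x y) = ivec (a * x + b * y) (c * x + d * y)"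
  by (simp add: imat_def)

lemma ipt_image:
  assumes "\<bar>a * d - b * c\<bar> = 1"
  shows "ipt (imat a b c d ` P) x y \<longleftrightarrow> (\<exists>i j. ipt P i j \<and> x = a * i + b * j \<and> y = c * i + d * j)"
proof
  interpret unimodular "imat a b c d" using assms by (rule unimodular_imat)
  assume "ipt (imat a b c d ` P) x y"
  then obtain z where z: "z \<in> P" "ivec x y = imat a b c d z" by (auto simp: ipt_def)
  then have "z \<in> lattice_pts" using lattice_iff lattice_pts_of_int by metis
  then obtain i j where "z = ivec i j" by (rule lattice_ptsE)
  moreover from this z(2) have "x = a * i + b * j" "y = c * i + d * j"
    by (simp_all only: imat_ivec prod.inject of_int_eq_iff)
  ultimately show "\<exists>i j. ipt P i j \<and> x = a * i + b * j \<and> y = c * i + d * j"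
    using z(1) by (auto simp: ipt_def)
next
  assume "\<exists>i j. ipt P i j \<and> x = a * i + b * j \<and> y = c * i + d * j"
  then obtain i j where "ivec i j \<in> P" "ivec x y = imat a b c d (ivec i j)"
    by (auto simp: ipt_def imat_ivec)
  then show "ipt (imat a b c d ` P) x y" by (auto simp: ipt_def)
qed

lemma reducible_columns:
  assumes "\<And>x y. ipt P x y \<Longrightarrow> \<bar>x\<bar> \<le> 1"
  shows "reducible P"
proof -
  have "in_strip (imat 0 1 1 0 ` P)" using assms by (auto simp: in_strip_def ipt_image)
  then show ?thesis unfolding reducible_def using unimodular_imat[of 0 0 1 1] by auto
qed

lemma reducible_strip: "in_strip P \<Longrightarrow> reducible P"
  unfolding reducible_def
  using unimodular_imat[of 1 1 0 0] by (auto simp: imat_def[abs_def] intro!: exI[of _ "imat 1 0 0 1"])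

lemma reducible_triangle: "P \<in> triangles \<Longrightarrow> reducible P"
  unfolding reducible_def
  using unimodular_imat[of 1 1 0 0] by (auto simp: imat_def[abs_def] intro!: exI[of _ "imat 1 0 0 1"])

text \<open>Barycentric coordinates cleared of the common denominator \<open>n\<close>, so that all
  conditions become integer equations and inequalities.\<close>

lemma mem_triangle:
  fixes w1 w2 w3 :: int
  assumes "0 \<le> w1" "0 \<le> w2" "0 \<le> w3" "w1 + w2 + w3 = n" "n > 0"
    and "n * x = w1 * ax + w2 * bx + w3 * cx" "n * y = w1 * ay + w2 * by' + w3 * cy"
  shows "ivec x y \<in> convex hull {ivec ax ay, ivec bx by', ivec cx cy}"
proof -
  let ?n = "real_of_int n"
  have n: "?n > 0" using assms by simp
  have sum: "of_int w1 / ?n + of_int w2 / ?n + of_int w3 / ?n = 1"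
  proof -
    have "real_of_int (w1 + w2 + w3) = ?n" using assms by simp
    then show ?thesis using n by (simp add: add_divide_distrib[symmetric])
  qed
  have "real_of_int (n * x) = of_int (w1 * ax + w2 * bx + w3 * cx)"
    "real_of_int (n * y) = of_int (w1 * ay + w2 * by' + w3 * cy)"
    using assms by (simp_all only:)
  then have "ivec x y = (of_int w1 / ?n) *\<^sub>R ivec ax ay + (of_int w2 / ?n) *\<^sub>R ivec bx by'
      + (of_int w3 / ?n) *\<^sub>R ivec cx cy"
    using n by (simp add: field_simps)
  moreover have "0 \<le> of_int w1 / ?n" "0 \<le> of_int w2 / ?n" "0 \<le> of_int w3 / ?n"
    using assms n by simp_all
  ultimately show ?thesis using sum unfolding convex_hull_3 by blast
qed

lemma fano_eq_hull:
  assumes P: "fano_polygon P" and V: "\<And>v. v \<in> V \<Longrightarrow> v \<in> P"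
    and "\<And>x y. ipt P x y \<Longrightarrow> ivec x y \<in> convex hull V"
  shows "P = convex hull V"
proof (rule antisym)
  have "verts P \<subseteq> convex hull V"
  proof
    fix v assume "v \<in> verts P"
    then obtain x y where "v = ivec x y" "ipt P x y" using fano_iptE[OF P] by metis
    then show "v \<in> convex hull V" using assms(3) by simp
  qed
  then show "P \<subseteq> convex hull V" using fano_hull[OF P] by (metis convex_convex_hull hull_minimal)
  show "convex hull V \<subseteq> P" using V fano_convex[OF P] by (intro hull_minimal) auto
qed

lemma fano_eq_triangle:
  assumes P: "fano_polygon P"
    and corners: "ipt P p q" "ipt P p' q" "ipt P p q'" and lt: "p < p'" "q < q'"
    and ge: "\<And>x y. ipt P x y \<Longrightarrow> p \<le> x" "\<And>x y. ipt P x y \<Longrightarrow> q \<le> y"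
    and le: "\<And>x y. ipt P x y \<Longrightarrow> (q' - q) * (x - p) + (p' - p) * (y - q) \<le> (p' - p) * (q' - q)"
  shows "P = convex hull {ivec p q, ivec p' q, ivec p q'}"
proof (rule fano_eq_hull[OF P])
  show "v \<in> P" if "v \<in> {ivec p q, ivec p' q, ivec p q'}" for v
    using that corners by (auto simp: ipt_def)
  fix x y assume xy: "ipt P x y"
  have nn: "0 \<le> (q' - q) * (x - p)" "0 \<le> (p' - p) * (y - q)" "0 < (p' - p) * (q' - q)"
    using ge[OF xy] lt by simp_all
  show "ivec x y \<in> convex hull {ivec p q, ivec p' q, ivec p q'}"
    by (rule mem_triangle[of "(p' - p) * (q' - q) - (q' - q) * (x - p) - (p' - p) * (y - q)"
          "(q' - q) * (x - p)" "(p' - p) * (y - q)" "(p' - p) * (q' - q)"])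
      (use le[OF xy] nn in \<open>simp_all, simp_all add: algebra_simps\<close>)
qed

text \<open>An edge of maximal height \<open>r\<close> and length \<open>N * r\<close>, placed on
  the line \<open>y = - r\<close>. Its left end \<open>p\<close> can still be moved by shears within
  its class modulo \<open>r\<close>.\<close>

locale bottom_edge =
  fixes P :: "plane set" and r p N :: int
  assumes P: "fano_polygon P" and T: "only_T_singularities P" and minP: "minimal P"
    and r: "r \<ge> 1" and N: "N \<ge> 1"
    and corners: "ipt P p (- r)" "ipt P (p + N * r) (- r)"
    and bottom: "\<And>x y. ipt P x y \<Longrightarrow> - r \<le> y"
    and bottom_line: "\<And>x. ipt P x (- r) \<Longrightarrow> p \<le> x \<and> x \<le> p + N * r"
    and cop: "coprime p r"
    and max: "\<And>u. u \<in> normals P \<Longrightarrow> int (nhgt P u) \<le> r"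
begin

text \<open>Minimality at the bottom edge: the polygon reaches at least as far up as it reaches
  down.\<close>

lemma top:
  obtains t s where "ipt P t s" "r \<le> s" "\<forall>x y. ipt P x y \<longrightarrow> y \<le> s"
proof -
  have n01: "ivec 0 1 \<in> normals P"
  proof (rule normalsI[OF P])
    show "primitive (ivec 0 1)" by (rule primitive_ivec[THEN iffD2]) simp
    have "r \<noteq> 0" "N \<noteq> 0" using r N by auto
    then show "ivec p (- r) \<noteq> ivec (p + N * r) (- r)" by simp
    have "hgt P (ivec 0 1) = of_int r" using hgt_ipt[OF P corners(1), of 0 1] bottom by simp
    then show "ivec p (- r) \<in> face P (ivec 0 1)" "ivec (p + N * r) (- r) \<in> face P (ivec 0 1)"
      using corners by (simp_all add: face_eq[OF fano_compact[OF P]] ipt_def)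
  qed
  have nh: "int (nhgt P (ivec 0 1)) = r" using nhgt_ipt[OF P corners(1), of 0 1] bottom r by simp
  have "primitive (ivec 0 (-1))" by (rule primitive_ivec[THEN iffD2]) simp
  then obtain q where q: "q \<in> verts P" "ivec 0 (-1) \<bullet> q = - hgt P (ivec 0 (-1))"
    by (rule fano_face_ends[OF P])
  obtain t s where ts: "q = ivec t s" "ipt P t s" by (rule fano_iptE[OF P q(1)])
  have s: "hgt P (ivec 0 (-1)) = of_int s" using q(2) by (simp add: ts)
  have le: "y \<le> s" if "ipt P x y" for x y
  proof -
    have "- hgt P (ivec 0 (-1)) \<le> ivec 0 (-1) \<bullet> ivec x y"
      using that hgt_le[OF fano_compact[OF P]] unfolding ipt_def by blast
    then show ?thesis using s by simp
  qed
  have "nhgt P (ivec 0 1) \<le> nhgt P (- ivec 0 1)" using minP n01 unfolding minimal_def by blast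
  then have "r \<le> int (nhgt P (- ivec 0 1))" using nh by linarith
  also have "\<dots> = max 0 s" using s by (simp add: nhgt_def)
  finally have "r \<le> s" using r by simp
  then show thesis using that ts(2) le by blast
qed

text \<open>The normal is written \<open>(a, - b)\<close>, matching \<open>(- a, - b)\<close> on the
  right, so that on both sides \<open>b \<ge> 0\<close> means leaning inwards.\<close>

lemma left_edge:
  obtains a b h m where "coprime a b" "1 \<le> h" "h \<le> r" "1 \<le> m" "1 \<le> a" "h = - (a * p) - b * r"
    "\<forall>x y. ipt P x y \<longrightarrow> - h \<le> a * x - b * y"
    "ipt P (p + m * h * b) (m * h * a - r)"
    "\<forall>x y. ipt P x y \<longrightarrow> a * x - b * y = - h \<longrightarrow> b * x + a * y \<le> b * p - a * r + m * h * (a * a + b * b)"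
    "ivec a (- b) \<in> normals P" "int (nhgt P (ivec a (- b))) = h" "int (wid P (ivec a (- b))) = m * h"
proof -
  obtain a b m h where *: "coprime a b" "h \<ge> 1" "m \<ge> 1" "(-1) * (0 * b - 1 * a) > 0"
    "a * p + b * (- r) = - h" "\<And>x y. ipt P x y \<Longrightarrow> - h \<le> a * x + b * y"
    "ipt P (p + (-1) * (m * h * b)) (- r - (-1) * (m * h * a))"
    "\<And>x y. ipt P x y \<Longrightarrow> a * x + b * y = - h \<Longrightarrow> (-1) * (b * x - a * y) \<le> (-1) * (b * p - a * (- r)) + m * h * (a * a + b * b)"
    "ivec a b \<in> normals P" "int (nhgt P (ivec a b)) = h" "int (wid P (ivec a b)) = m * h"
    by (rule adjacent_edge_ipt[OF P T, of 0 1 "-1" p "- r"]) (use corners bottom bottom_line in auto)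
  show thesis
  proof (rule that[of a "- b" h m])
    show "h \<le> r" using max[OF *(9)] *(10) by simp
    show "\<forall>x y. ipt P x y \<longrightarrow> - h \<le> a * x - (- b) * y" using *(6) by simp
    show "\<forall>x y. ipt P x y \<longrightarrow> a * x - (- b) * y = - h \<longrightarrow>
        (- b) * x + a * y \<le> (- b) * p - a * r + m * h * (a * a + (- b) * (- b))"
      using *(8) by simp
    have "p + m * h * (- b) = p + (-1) * (m * h * b)" "m * h * a - r = - r - (-1) * (m * h * a)"
      by simp_all
    then show "ipt P (p + m * h * (- b)) (m * h * a - r)" using *(7) by (simp only:)
  qed (use * in simp_all)
qed

lemma right_edge:
  obtains a b h m where "coprime a b" "1 \<le> h" "h \<le> r" "1 \<le> m" "1 \<le> a" "h = a * (p + N * r) - b * r"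
    "\<forall>x y. ipt P x y \<longrightarrow> a * x + b * y \<le> h"
    "ipt P (p + N * r - m * h * b) (m * h * a - r)"
    "\<forall>x y. ipt P x y \<longrightarrow> a * x + b * y = h \<longrightarrow> a * y - b * x \<le> - (a * r) - b * (p + N * r) + m * h * (a * a + b * b)"
    "ivec (- a) (- b) \<in> normals P" "int (nhgt P (ivec (- a) (- b))) = h"
    "int (wid P (ivec (- a) (- b))) = m * h"
proof -
  obtain a b m h where *: "coprime a b" "h \<ge> 1" "m \<ge> 1" "1 * (0 * b - 1 * a) > 0"
    "a * (p + N * r) + b * (- r) = - h" "\<And>x y. ipt P x y \<Longrightarrow> - h \<le> a * x + b * y"
    "ipt P (p + N * r + 1 * (m * h * b)) (- r - 1 * (m * h * a))"
    "\<And>x y. ipt P x y \<Longrightarrow> a * x + b * y = - h \<Longrightarrow> 1 * (b * x - a * y) \<le> 1 * (b * (p + N * r) - a * (- r)) + m * h * (a * a + b * b)"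
    "ivec a b \<in> normals P" "int (nhgt P (ivec a b)) = h" "int (wid P (ivec a b)) = m * h"
    by (rule adjacent_edge_ipt[OF P T, of 0 1 1 "p + N * r" "- r"]) (use corners bottom bottom_line in auto)
  show thesis
  proof (rule that[of "- a" "- b" h m])
    show "h \<le> r" using max[OF *(9)] *(10) by simp
    show "\<forall>x y. ipt P x y \<longrightarrow> (- a) * x + (- b) * y \<le> h"
    proof (intro allI impI)
      fix x y assume "ipt P x y"
      then show "(- a) * x + (- b) * y \<le> h" using *(6)[of x y] by simp
    qed
    show "\<forall>x y. ipt P x y \<longrightarrow> (- a) * x + (- b) * y = h \<longrightarrow>
        (- a) * y - (- b) * x \<le> - ((- a) * r) - (- b) * (p + N * r) + m * h * ((- a) * (- a) + (- b) * (- b))"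
    proof (intro allI impI)
      fix x y assume xy: "ipt P x y" "(- a) * x + (- b) * y = h"
      then have "a * x + b * y = - h" by simp
      then show "(- a) * y - (- b) * x \<le> - ((- a) * r) - (- b) * (p + N * r) + m * h * ((- a) * (- a) + (- b) * (- b))"
        using *(8)[OF xy(1)] by (simp add: algebra_simps)
    qed
    have "p + N * r - m * h * (- b) = p + N * r + 1 * (m * h * b)"
      "m * h * (- a) - r = - r - 1 * (m * h * a)"
      by simp_all
    then show "ipt P (p + N * r - m * h * (- b)) (m * h * (- a) - r)" using *(7) by (simp only:)
  qed (use * in simp_all)
qed

end

lemma (in unimodular) bottom_edge_image:
  assumes "bottom_edge P r p N" 
    and "ipt (f ` P) p' (- r)" "ipt (f ` P) (p' + N * r) (- r)"
    "\<And>x y. ipt (f ` P) x y \<Longrightarrow> - r \<le> y"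
    "\<And>x. ipt (f ` P) x (- r) \<Longrightarrow> p' \<le> x \<and> x \<le> p' + N * r" "coprime p' r"
  shows "bottom_edge (f ` P) r p' N"
proof -
  interpret bottom_edge P r p N by fact
  show ?thesis
  proof
    show "fano_polygon (f ` P)" "only_T_singularities (f ` P)" "minimal (f ` P)"
      using fano_image only_T_image minimal_image P T minP by auto
    show "int (nhgt (f ` P) u) \<le> r" if "u \<in> normals (f ` P)" for u
    proof -
      have "adjoint f u \<in> normals P" using that normals_image by blast
      then show ?thesis using max by (simp add: nhgt_def hgt_image)
    qed
  qed (use assms r N in auto)
qed

text \<open>A horizontal shear preserves every horizontal line and translates the line
  \<open>y = - r\<close> by a multiple of \<open>r\<close>.\<close>

lemma bottom_edge_shear:
  assumes "bottom_edge P r p N"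
  shows "bottom_edge (imat 1 j 0 1 ` P) r (p - j * r) N"
proof -
  interpret bottom_edge P r p N by fact
  have u: "unimodular (imat 1 j 0 1)" by (rule unimodular_imat) simp
  show ?thesis
  proof (rule unimodular.bottom_edge_image[OF u assms])
    show "ipt (imat 1 j 0 1 ` P) (p - j * r) (- r)" "ipt (imat 1 j 0 1 ` P) (p - j * r + N * r) (- r)"
      using corners by (auto simp: ipt_image algebra_simps)
    show "- r \<le> y" if "ipt (imat 1 j 0 1 ` P) x y" for x y
      using that bottom by (auto simp: ipt_image)
    show "p - j * r \<le> x \<and> x \<le> p - j * r + N * r" if "ipt (imat 1 j 0 1 ` P) x (- r)" for x
      using that bottom_line by (auto simp: ipt_image algebra_simps)
    show "coprime (p - j * r) r" using cop by (simp add: coprime_iff_gcd_eq_1 gcd_diff1)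
        (metis add.commute diff_conv_add_uminus gcd_add_mult gcd.commute mult_minus_left)
  qed
qed

lemma bottom_edge_mirror:
  assumes "bottom_edge P r p N"
  shows "bottom_edge (imat (-1) 0 0 1 ` P) r (- p - N * r) N"
proof -
  interpret bottom_edge P r p N by fact
  have u: "unimodular (imat (-1) 0 0 1)" by (rule unimodular_imat) simp
  show ?thesis
  proof (rule unimodular.bottom_edge_image[OF u assms])
    show "ipt (imat (-1) 0 0 1 ` P) (- p - N * r) (- r)" "ipt (imat (-1) 0 0 1 ` P) (- p - N * r + N * r) (- r)"
      using corners by (auto simp: ipt_image intro: exI[of _ "p + N * r"])
    show "- r \<le> y" if "ipt (imat (-1) 0 0 1 ` P) x y" for x y
      using that bottom by (auto simp: ipt_image)
    show "- p - N * r \<le> x \<and> x \<le> - p - N * r + N * r" if "ipt (imat (-1) 0 0 1 ` P) x (- r)" for x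
      using that by (auto simp: ipt_image dest!: bottom_line)
    have "coprime (p + N * r) r" using cop
      by (metis coprime_iff_gcd_eq_1 gcd.commute gcd_add_mult add.commute)
    then show "coprime (- p - N * r) r"
      by (metis coprime_minus_left_iff minus_add_distrib uminus_add_conv_diff add.commute minus_diff_eq diff_minus_eq_add)
  qed
qed

lemma coprime_dvd_2:
  assumes "(c :: int) dvd 2 * r" "coprime c r" "c > 0"
  shows "c = 1 \<or> c = 2"
proof -
  have "c dvd 2" using assms coprime_dvd_mult_left_iff by blast
  then have "c \<le> 2" by (rule zdvd_imp_le) simp
  then show ?thesis using assms(3) by linarith
qed

context bottom_edge
begin

text \<open>Both neighbours of an edge of maximal height lean inwards, so the polygon is no wider than
  that edge.\<close>

lemma left_edge_inward:
  assumes p: "p < 0"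
  obtains a b h m where "coprime a b" "1 \<le> h" "h \<le> r" "1 \<le> m" "1 \<le> a" "0 \<le> b" "h = - (a * p) - b * r"
    "\<forall>x y. ipt P x y \<longrightarrow> - h \<le> a * x - b * y"
    "ipt P (p + m * h * b) (m * h * a - r)"
    "\<forall>x y. ipt P x y \<longrightarrow> a * x - b * y = - h \<longrightarrow> b * x + a * y \<le> b * p - a * r + m * h * (a * a + b * b)"
    "ivec a (- b) \<in> normals P" "int (nhgt P (ivec a (- b))) = h" "int (wid P (ivec a (- b))) = m * h"
    "\<forall>x y. ipt P x y \<longrightarrow> p \<le> x"
proof -
  obtain a b h m where F0: "coprime a b" "1 \<le> h" "h \<le> r" "1 \<le> m" "1 \<le> a" "h = - (a * p) - b * r"
    "\<forall>x y. ipt P x y \<longrightarrow> - h \<le> a * x - b * y"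
    "ipt P (p + m * h * b) (m * h * a - r)"
    "\<forall>x y. ipt P x y \<longrightarrow> a * x - b * y = - h \<longrightarrow> b * x + a * y \<le> b * p - a * r + m * h * (a * a + b * b)"
    "ivec a (- b) \<in> normals P" "int (nhgt P (ivec a (- b))) = h" "int (wid P (ivec a (- b))) = m * h"
    by (rule left_edge)
  note F = F0[rule_format]
  have "0 < a * (- p)" using p F(5) by (intro mult_pos_pos) auto
  \<comment> \<open>Maximality \<open>h \<le> r\<close> bounds the positive number
    \<open>a * (- p)\<close> by \<open>(b + 1) * r\<close>.\<close>
  then have "0 < (b + 1) * r" using F(3,6) by (simp add: algebra_simps)
  then have b0: "0 \<le> b" using r by (simp add: zero_less_mult_iff)
  have le: "p \<le> x" if "ipt P x y" for x y
  proof -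
    have "b * (- r) \<le> b * y" using bottom[OF that] b0 by (rule mult_left_mono)
    then have "a * p \<le> a * x" using F(6) F(7)[OF that] by simp
    then show ?thesis using F(5) by simp
  qed
  show thesis by (rule that[OF F0(1-5) b0 F0(6-12)]) (use le in blast)
qed

lemma right_edge_inward:
  assumes q: "0 < p + N * r"
  obtains a b h m where "coprime a b" "1 \<le> h" "h \<le> r" "1 \<le> m" "1 \<le> a" "0 \<le> b" "h = a * (p + N * r) - b * r"
    "\<forall>x y. ipt P x y \<longrightarrow> a * x + b * y \<le> h"
    "ipt P (p + N * r - m * h * b) (m * h * a - r)"
    "\<forall>x y. ipt P x y \<longrightarrow> a * x + b * y = h \<longrightarrow> a * y - b * x \<le> - (a * r) - b * (p + N * r) + m * h * (a * a + b * b)"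
    "ivec (- a) (- b) \<in> normals P" "int (nhgt P (ivec (- a) (- b))) = h"
    "int (wid P (ivec (- a) (- b))) = m * h"
    "\<forall>x y. ipt P x y \<longrightarrow> x \<le> p + N * r"
proof -
  obtain a b h m where F0: "coprime a b" "1 \<le> h" "h \<le> r" "1 \<le> m" "1 \<le> a" "h = a * (p + N * r) - b * r"
    "\<forall>x y. ipt P x y \<longrightarrow> a * x + b * y \<le> h"
    "ipt P (p + N * r - m * h * b) (m * h * a - r)"
    "\<forall>x y. ipt P x y \<longrightarrow> a * x + b * y = h \<longrightarrow> a * y - b * x \<le> - (a * r) - b * (p + N * r) + m * h * (a * a + b * b)"
    "ivec (- a) (- b) \<in> normals P" "int (nhgt P (ivec (- a) (- b))) = h"
    "int (wid P (ivec (- a) (- b))) = m * h"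
    by (rule right_edge)
  note F = F0[rule_format]
  have "0 < a * (p + N * r)" using q F(5) by (intro mult_pos_pos) auto
  then have "0 < (b + 1) * r" using F(3,6) by (simp add: algebra_simps)
  then have b0: "0 \<le> b" using r by (simp add: zero_less_mult_iff)
  have le: "x \<le> p + N * r" if "ipt P x y" for x y
  proof -
    have "b * (- r) \<le> b * y" using bottom[OF that] b0 by (rule mult_left_mono)
    then have "a * x \<le> a * (p + N * r)" using F(6) F(7)[OF that] by simp
    then show ?thesis using F(5) by simp
  qed
  show thesis by (rule that[OF F0(1-5) b0 F0(6-12)]) (use le in blast)
qed

text \<open>The slope of the right neighbour yields \<open>x + (N - 1) * y \<le> p + r\<close> on
  \<open>P\<close>. As \<open>P\<close> reaches up to \<open>r\<close> and stays right of
  \<open>p\<close>, this forces \<open>N = 2\<close> and a right triangle with legs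
  \<open>2 * r\<close>. Its other two edges have heights \<open>- p\<close> and
  \<open>p + r\<close>; these divide \<open>2 * r\<close> and are coprime to \<open>r\<close>, so
  they are 1 or 2.\<close>

lemma wide:
  assumes N2: "N \<ge> 2" and p: "- r < p" "p < 0"
  shows "reducible P"
proof -
  obtain a b h m where L0: "coprime a b" "1 \<le> h" "h \<le> r" "1 \<le> m" "1 \<le> a" "0 \<le> b" "h = - (a * p) - b * r"
    "\<forall>x y. ipt P x y \<longrightarrow> - h \<le> a * x - b * y"
    "ipt P (p + m * h * b) (m * h * a - r)"
    "\<forall>x y. ipt P x y \<longrightarrow> a * x - b * y = - h \<longrightarrow> b * x + a * y \<le> b * p - a * r + m * h * (a * a + b * b)"
    "ivec a (- b) \<in> normals P" "int (nhgt P (ivec a (- b))) = h" "int (wid P (ivec a (- b))) = m * h"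
    "\<forall>x y. ipt P x y \<longrightarrow> p \<le> x"
    by (rule left_edge_inward[OF p(2)])
  note L = L0[rule_format]
  have "2 * r \<le> N * r" using N2 r by (intro mult_right_mono) auto
  then have q0: "0 < p + N * r" using p(1) r by linarith
  obtain a' b' h' m' where R0: "coprime a' b'" "1 \<le> h'" "h' \<le> r" "1 \<le> m'" "1 \<le> a'" "0 \<le> b'" "h' = a' * (p + N * r) - b' * r"
    "\<forall>x y. ipt P x y \<longrightarrow> a' * x + b' * y \<le> h'"
    "ipt P (p + N * r - m' * h' * b') (m' * h' * a' - r)"
    "\<forall>x y. ipt P x y \<longrightarrow> a' * x + b' * y = h' \<longrightarrow> a' * y - b' * x \<le> - (a' * r) - b' * (p + N * r) + m' * h' * (a' * a' + b' * b')"
    by (rule right_edge_inward[OF q0])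
  note R = R0[rule_format]
  obtain t s where ts: "ipt P t s" "r \<le> s" "\<forall>x y. ipt P x y \<longrightarrow> y \<le> s" by (rule top)
  \<comment> \<open>The right end lies beyond \<open>(N - 1) * r\<close>, so an edge of height at
    most \<open>r\<close> starting there has to lean this much.\<close>
  have ab': "a' * (N - 1) \<le> b'"
  proof -
    have "a' * (p + r) > 0" using p R(5) by simp
    moreover have "a' * (p + N * r) \<le> (b' + 1) * r" using R(3,7) by (simp add: algebra_simps)
    ultimately have "(a' * (N - 1)) * r < (b' + 1) * r" by (simp add: algebra_simps)
    then show ?thesis using r by simp
  qed
  have diag: "x + (N - 1) * y \<le> p + r" if xy: "ipt P x y" for x y
  proof -
    have "(b' - a' * (N - 1)) * (- r) \<le> (b' - a' * (N - 1)) * y"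
      using bottom[OF xy] ab' by (intro mult_left_mono) auto
    then have "a' * (x + (N - 1) * y) \<le> a' * (p + r)"
      using R(7) R(8)[OF xy] by (simp add: algebra_simps)
    then show ?thesis using R(5) by simp
  qed
  have tN: "(N - 1) * s \<le> r" using diag[OF ts(1)] L(14)[OF ts(1)] by linarith
  have N_eq: "N = 2"
  proof (rule ccontr)
    assume "N \<noteq> 2"
    then have "2 * s \<le> (N - 1) * s" using N2 ts(2) r by (intro mult_right_mono) auto
    then show False using tN ts(2) r by linarith
  qed
  have s: "s = r" and t: "t = p"
    using tN ts(2) diag[OF ts(1)] L(14)[OF ts(1)] by (auto simp: N_eq)
  have top': "ipt P p r" using ts(1) s t by simp
  have b0: "b = 0"
  proof -
    have "2 * (b * r) \<le> 0" using L(7) L(8)[OF top'] by simp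
    then show ?thesis using L(6) r by (simp add: mult_le_0_iff)
  qed
  have a1: "a = 1" using L(1,5) b0 by simp
  have hp: "h = - p" using L(7) a1 b0 by simp
  have "m * h = 2 * r"
  proof (rule antisym)
    show "m * h \<le> 2 * r" using ts(3)[rule_format, OF L(9)] a1 s by simp
    show "2 * r \<le> m * h" using L(10)[OF top'] a1 b0 hp by simp
  qed
  then have "- p dvd 2 * r" using hp by (metis dvd_triv_right)
  then have p12: "- p = 1 \<or> - p = 2" using cop p(2) by (intro coprime_dvd_2[of "- p" r]) auto
  have ba: "b' = a'"
  proof -
    have "(2 * b') * r \<le> (2 * a') * r" using R(7) R(8)[OF top'] by (simp add: N_eq algebra_simps)
    then have "b' \<le> a'" using r by simp
    then show ?thesis using ab' by (simp add: N_eq)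
  qed
  then have a1': "a' = 1" "b' = 1" using R(1,5) by auto
  have h': "h' = p + r" using R(7) by (simp add: a1' N_eq)
  have "m' * h' = 2 * r"
  proof (rule antisym)
    show "m' * h' \<le> 2 * r" using ts(3)[rule_format, OF R(9)] a1' s by simp
    show "2 * r \<le> m' * h'" using R(10)[OF top'] a1' h' by (simp add: N_eq)
  qed
  then have d2: "p + r dvd 2 * r" using h' by (metis dvd_triv_right)
  have "coprime (p + r) r" using cop by (metis coprime_iff_gcd_eq_1 gcd_add1)
  then have pr12: "p + r = 1 \<or> p + r = 2" using d2 p(1) by (intro coprime_dvd_2[of "p + r" r]) auto
  have tri: "P = convex hull {ivec p (- r), ivec (p + 2 * r) (- r), ivec p r}"
  proof (rule fano_eq_triangle[OF P])
    fix x y assume xy: "ipt P x y"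
    have "(2 * r) * (x + y) \<le> (2 * r) * (p + r)"
      using diag[OF xy] r by (intro mult_left_mono) (auto simp: N_eq)
    then show "(r - - r) * (x - p) + (p + 2 * r - p) * (y - - r) \<le> (p + 2 * r - p) * (r - - r)"
      by (simp add: algebra_simps)
  qed (use corners top' L(14) bottom r in \<open>auto simp: N_eq\<close>)
  \<comment> \<open>Of the four pairs allowed by the two divisibilities, this one is not
    coprime.\<close>
  have "\<not> (p = - 2 \<and> r = 4)" using cop by auto
  then have "(p = -1 \<and> r = 2) \<or> (p = -1 \<and> r = 3) \<or> (p = -2 \<and> r = 3)"
    using p12 pr12 by presburger
  then show ?thesis
  proof (elim disjE conjE)
    assume "p = -1" "r = 2"
    then have "P \<in> triangles" using tri by (simp add: triangles_def)
    then show ?thesis by (rule reducible_triangle)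
  next
    assume "p = -1" "r = 3"
    then have "P \<in> triangles" using tri by (simp add: triangles_def)
    then show ?thesis by (rule reducible_triangle)
  next
    assume pr: "p = -2" "r = 3"
    \<comment> \<open>This map reverses the bottom edge and exchanges the other two edges, whose
      heights are 2 and 1.\<close>
    let ?f = "imat (-1) (-1) 0 1"
    have u: "unimodular ?f" by (rule unimodular_imat) simp
    have "?f ` P = convex hull (?f ` {ivec (-2) (-3), ivec 4 (-3), ivec (-2) 3})"
      using tri pr convex_hull_linear_image[OF unimodular.lin[OF u]] by simp
    also have "?f ` {ivec (-2) (-3), ivec 4 (-3), ivec (-2) 3} = {ivec (-1) (-3), ivec 5 (-3), ivec (-1) 3}"
      by (simp only: image_insert image_empty imat_ivec) auto
    finally have "?f ` P \<in> triangles" by (simp add: triangles_def)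
    then show ?thesis using reducible_image[OF u] reducible_triangle by blast
  qed
qed

text \<open>With \<open>c = - p\<close>, minimality of the vertical edge and coprimality give
  \<open>2 * c < r\<close>. The top point forces \<open>2 * b \<le> a\<close>, and
  \<open>h \<le> r\<close> forces \<open>a < 2 * (b + 1)\<close>. For \<open>a = 2 * b\<close> the
  polygon is a triangle with divisibility conditions on \<open>c\<close> and
  \<open>r - 2 * c\<close>. For \<open>a = 2 * b + 1\<close> one finds \<open>a = 3\<close>,
  \<open>b = 1\<close>, and either a triangle with \<open>r = 3\<close> or no room for the next
  edge.\<close>

lemma narrow_left_vertical:
  assumes N1: "N = 1" and p: "- r < p" "p < 0" and r3: "r \<ge> 3"
    and vertical: "ivec 1 0 \<in> normals P" "int (nhgt P (ivec 1 0)) = - p"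
      "int (wid P (ivec 1 0)) = m * (- p)" "ipt P p (m * (- p) - r)"
      "\<And>y. ipt P p y \<Longrightarrow> y \<le> m * (- p) - r" "m \<ge> 1"
    and R: "coprime a b" "1 \<le> h" "h \<le> r" "1 \<le> m'" "1 \<le> a" "1 \<le> b" "h = a * (p + r) - b * r"
    "\<And>x y. ipt P x y \<Longrightarrow> a * x + b * y \<le> h"
    "ipt P (p + r - m' * h * b) (m' * h * a - r)"
    "\<And>x y. ipt P x y \<Longrightarrow> a * x + b * y = h \<Longrightarrow> a * y - b * x \<le> - (a * r) - b * (p + r) + m' * h * (a * a + b * b)"
    "ivec (- a) (- b) \<in> normals P"
    and box: "\<And>x y. ipt P x y \<Longrightarrow> p \<le> x" "\<And>x y. ipt P x y \<Longrightarrow> x \<le> p + r"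
  shows "reducible P"
proof -
  obtain t s where ts: "ipt P t s" "r \<le> s" "\<forall>x y. ipt P x y \<longrightarrow> y \<le> s" by (rule top)
  define c where "c = - p"
  have c: "0 < c" "c < r" "p = - c" using p by (auto simp: c_def)
  have copc: "coprime c r" using cop by (simp add: c)
  have "c \<le> r - c"
  proof -
    have "int (nhgt P (ivec (- 1) 0)) = max 0 (- ((- 1) * (p + r) + 0 * (- r)))"
    proof (rule nhgt_ipt[OF P])
      show "ipt P (p + r) (- r)" using corners N1 by simp
      show "- 1 * (p + r) + 0 * - r \<le> - 1 * x + 0 * y" if "ipt P x y" for x y
        using box(2)[OF that] by simp
    qed
    moreover have "nhgt P (ivec 1 0) \<le> nhgt P (- ivec 1 0)"
      using minP vertical(1) unfolding minimal_def by blast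
    moreover have "- ivec 1 0 = ivec (- 1) 0" by simp
    ultimately show ?thesis using vertical(2) c by (simp add: max_def split: if_splits)
  qed
  moreover have "2 * c \<noteq> r"
  proof
    assume "2 * c = r"
    then have "c dvd r" by (metis dvd_triv_right)
    then have "c = 1" using copc c(1) by (metis coprime_absorb_left zdvd1_eq abs_of_pos)
    then show False using \<open>2 * c = r\<close> r3 by simp
  qed
  ultimately have cr: "2 * c < r" by linarith
  have topineq: "b * (s + r) \<le> a * (r - c - t)"
    using R(7) R(8)[OF ts(1)] by (simp add: c algebra_simps)
  have tc: "- c \<le> t" using box(1)[OF ts(1)] c by simp
  have "a * (r - c - t) \<le> a * r" using tc R(5) by (intro mult_left_mono) auto
  then have bsr: "b * (s + r) \<le> a * r" using topineq by linarith
  have "b * (2 * r) \<le> b * (s + r)" using ts(2) R(6) by (intro mult_left_mono) auto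
  then have "(2 * b) * r \<le> a * r" using bsr by (simp add: algebra_simps)
  then have a_ge: "2 * b \<le> a" using r by simp
  have hc: "h = a * (r - c) - b * r" using R(7) by (simp add: c)
  have "a * r < a * (2 * (r - c))" using cr R(5) by simp
  also have "\<dots> \<le> 2 * (b + 1) * r" using R(3) hc by (simp add: algebra_simps)
  finally have "a < 2 * (b + 1)" using r by simp
  then have "a = 2 * b \<or> a = 2 * b + 1" using a_ge by arith
  then consider "a = 2 * b" | "a = 2 * b + 1" by blast
  then show ?thesis
  proof cases
    case 1
    then have "b dvd a" by simp
    then have b1: "b = 1" using R(1,6) by (metis abs_of_nonneg coprime_absorb_right coprime_commute dvd_refl zdvd1_eq zle_iff_zadd order_trans zero_le_one)
    then have a2: "a = 2" using 1 by simp
    have t: "t = - c" and s: "s = r" using topineq tc ts(2) by (auto simp: b1 a2)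
    have top': "ipt P (- c) r" using ts(1) s t by simp
    \<comment> \<open>The left edge joins \<open>(p, - r)\<close> to \<open>(p, r)\<close>, so its
      length is \<open>2 * r\<close>, a multiple of its height \<open>c\<close>; below, the right
      edge similarly makes \<open>r\<close> a multiple of \<open>r - 2 * c\<close>.\<close>
    have "m * c = 2 * r"
    proof (rule antisym)
      show "m * c \<le> 2 * r" using ts(3)[rule_format, OF vertical(4)] s c by simp
      show "2 * r \<le> m * c" using vertical(5)[of r] top' c by simp
    qed
    then have "c dvd 2 * r" by (metis dvd_triv_right)
    then have c12: "c = 1 \<or> c = 2" using copc c(1) by (rule coprime_dvd_2)
    have h: "h = r - 2 * c" using hc by (simp add: a2 b1)
    have "m' * h = r"
    proof (rule antisym)
      show "m' * h \<le> r" using ts(3)[rule_format, OF R(9)] a2 s by simp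
      show "r \<le> m' * h" using R(10)[OF top'] h by (simp add: a2 b1 c)
    qed
    then have dv: "r - 2 * c dvd r" using h by (metis dvd_triv_right)
    then have "r - 2 * c dvd r - (r - 2 * c)" by (rule dvd_diff) simp
    then have dv2: "r - 2 * c dvd 2 * c" by simp
    have le: "r - 2 * c \<le> 2 * c" using dv2 c by (intro zdvd_imp_le) auto
    have tri: "P = convex hull {ivec p (- r), ivec (p + r) (- r), ivec p r}"
    proof (rule fano_eq_triangle[OF P])
      fix x y assume xy: "ipt P x y"
      have "r * (2 * x + y) \<le> r * (r - 2 * c)"
        using R(8)[OF xy] r by (intro mult_left_mono) (auto simp: a2 b1 h)
      then show "(r - - r) * (x - p) + (p + r - p) * (y - - r) \<le> (p + r - p) * (r - - r)"
        by (simp add: c algebra_simps)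
    qed (use corners N1 top' box bottom r c in auto)
    have "(c = 1 \<and> r = 3) \<or> (c = 1 \<and> r = 4) \<or> (c = 2 \<and> r = 5)"
      using c12
    proof
      assume "c = 1" then show ?thesis using le r3 by auto
    next
      assume c2: "c = 2"
      then have "r \<le> 8" "r > 4" using le cr by auto
      then have "r = 5 \<or> r = 6 \<or> r = 7 \<or> r = 8" by arith
      moreover have "odd r" using copc unfolding c2 coprime_left_2_iff_odd .
      moreover have "r \<noteq> 7"
      proof
        assume "r = 7"
        then have "(3 :: int) dvd 4" using dv2 c2 by simp
        then show False by simp
      qed
      ultimately have "r = 5" by auto
      then show ?thesis using c2 by simp
    qed
    then have "P \<in> triangles"
    proof (elim disjE conjE)
      assume "c = 1" "r = 3"
      then show ?thesis using tri by (simp add: triangles_def c)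
    next
      assume "c = 1" "r = 4"
      then show ?thesis using tri by (simp add: triangles_def c)
    next
      assume "c = 2" "r = 5"
      then show ?thesis using tri by (simp add: triangles_def c)
    qed
    then show ?thesis by (rule reducible_triangle)
  next
    case 2
    \<comment> \<open>This edge is higher than \<open>r / 2\<close>, while its end may not pass the
      top, which gives \<open>b * m' * h \<le> r\<close>. Together they leave only
      \<open>b = m' = 1\<close>.\<close>
    have h2: "r < 2 * h" 
    proof -
      have "(2 * b + 1) * r < (2 * b + 1) * (2 * (r - c))" using cr R(6) by simp
      then show ?thesis using hc 2 by (simp add: algebra_simps)
    qed
    have "m' * h * a \<le> s + r" using ts(3)[rule_format, OF R(9)] by simp
    then have "b * (m' * h * a) \<le> b * (s + r)" using R(6) by (intro mult_left_mono) auto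
    then have "a * (b * m' * h) \<le> a * r" using bsr by (simp add: algebra_simps)
    then have "b * m' * h \<le> r" using R(5) by simp
    then have "(b * m') * h < 2 * h" using h2 by linarith
    then have "b * m' < 2" using R(2) by simp
    moreover have "b \<le> b * m'" "m' \<le> b * m'" using R(4,6) by auto
    ultimately have b1: "b = 1" and m1: "m' = 1" using R(4,6) by linarith+
    have a3: "a = 3" using 2 b1 by simp
    have h: "h = 2 * r - 3 * c" using hc by (simp add: a3 b1)
    have r3c: "r \<le> 3 * c" using R(3) h by simp
    have Q: "ipt P (2 * c - r) (5 * r - 9 * c)"
    proof -
      have eqs: "p + r - m' * h * b = 2 * c - r" "m' * h * a - r = 5 * r - 9 * c"
        by (simp_all add: h a3 b1 m1 c)
      show ?thesis using R(9) unfolding eqs .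
    qed
    have ineq: "3 * x + y \<le> 2 * r - 3 * c" if "ipt P x y" for x y
      using R(8)[OF that] by (simp add: a3 b1 h)
    show ?thesis
    proof (cases "r = 3 * c")
      case True
      then have "c dvd r" by simp
      then have "c = 1" using copc c(1) by (metis coprime_absorb_left zdvd1_eq abs_of_pos)
      then have rc: "r = 3" "c = 1" "p = - 1" using True c by auto
      have "P = convex hull {ivec (-1) (-3), ivec 2 (-3), ivec (-1) 6}"
      proof (rule fano_eq_triangle[OF P])
        fix x y assume xy: "ipt P x y"
        show "(6 - - 3) * (x - - 1) + (2 - - 1) * (y - - 3) \<le> (2 - - 1) * (6 - - 3)"
          using ineq[OF xy] rc by simp
      qed (use corners N1 Q box bottom rc in auto)
      then have "P \<in> triangles" by (simp add: triangles_def)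
      then show ?thesis by (rule reducible_triangle)
    next
      case False
      then have r3c': "r < 3 * c" using r3c by simp
      \<comment> \<open>For \<open>r < 3 * c\<close> the right edge stops at
        \<open>(2 * c - r, 5 * r - 9 * c)\<close>, strictly right of the line
        \<open>x = - c\<close>, so a further edge has to be examined.\<close>
      obtain a2 b2 h2 m2 where E: "h2 \<ge> 1" "m2 \<ge> 1" "1 * ((- 3) * b2 - (- 1) * a2) > 0"
        "a2 * (2 * c - r) + b2 * (5 * r - 9 * c) = - h2" "\<And>x y. ipt P x y \<Longrightarrow> - h2 \<le> a2 * x + b2 * y"
        "ipt P (2 * c - r + 1 * (m2 * h2 * b2)) (5 * r - 9 * c - 1 * (m2 * h2 * a2))"
      proof (rule adjacent_edge_ipt[OF P T, of "- 3" "- 1" 1 "2 * c - r" "5 * r - 9 * c"])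
        show "coprime (- 3 :: int) (- 1)" by simp
        fix x y assume xy: "ipt P x y"
        show "(- 3) * (2 * c - r) + (- 1) * (5 * r - 9 * c) \<le> (- 3) * x + (- 1) * y"
          using ineq[OF xy] by simp
        assume "(- 3) * x + (- 1) * y = (- 3) * (2 * c - r) + (- 1) * (5 * r - 9 * c)"
        then have "a * x + b * y = h" by (simp add: a3 b1 h)
        then have "3 * y - x \<le> - (3 * r) - (r - c) + (2 * r - 3 * c) * 10"
          using R(10)[OF xy] by (simp add: a3 b1 m1 h c)
        then show "1 * ((- 1) * x - (- 3) * y) \<le> 1 * ((- 1) * (2 * c - r) - (- 3) * (5 * r - 9 * c))"
          by simp
      qed (use Q in auto)
      \<comment> \<open>Otherwise the line of the new edge would cut off the corner
        \<open>(- c, - r)\<close>.\<close>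
      have b2: "b2 \<le> - 1"
      proof (rule ccontr)
        assume "\<not> b2 \<le> - 1"
        then have nn: "0 \<le> b2" "0 < a2" using E(3) by auto
        have "- h2 \<le> a2 * (- c) + b2 * (- r)" using E(5)[OF corners(1)] c by simp
        then have "0 \<le> a2 * (r - 3 * c) + b2 * (9 * c - 6 * r)" using E(4) by (simp add: algebra_simps)
        moreover have "a2 * (r - 3 * c) < 0" using nn r3c' by (intro mult_pos_neg) auto
        moreover have "b2 * (9 * c - 6 * r) \<le> 0" using nn cr c by (intro mult_nonneg_nonpos) auto
        ultimately show False by simp
      qed
      define b' where "b' = - b2"
      have b': "b' \<ge> 1" "- a2 \<le> 3 * b' - 1" using b2 E(3) by (auto simp: b'_def)
      have "(3 * b' - 1) * (2 * c - r) \<le> (- a2) * (2 * c - r)"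
        using b'(2) cr by (intro mult_right_mono_neg) auto
      then have "b' * (2 * r - 3 * c) + (r - 2 * c) \<le> h2"
        using E(4) by (simp add: b'_def algebra_simps)
      moreover have "1 * (2 * r - 3 * c) \<le> b' * (2 * r - 3 * c)" using b' cr c(1) by (intro mult_right_mono) auto
      ultimately have low: "3 * r - 5 * c \<le> h2" by simp
      \<comment> \<open>The new edge must not pass the line \<open>x = - c\<close>. This bounds its
        height by \<open>3 * c - r\<close>, whereas its position demands at least
        \<open>3 * r - 5 * c\<close>; both together contradict \<open>2 * c < r\<close>.\<close>
      have "m2 * h2 * b' \<le> 3 * c - r" using box(1)[OF E(6)] by (simp add: b'_def c)
      moreover have "1 * h2 * 1 \<le> m2 * h2 * b'" using E(1,2) b'(1) by (intro mult_mono) auto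
      ultimately have "h2 \<le> 3 * c - r" by simp
      then show ?thesis using low cr by simp
    qed
  qed
qed

text \<open>A second point on the line \<open>x = p\<close> makes the left neighbour vertical. If
  the right one is vertical too, minimality at both makes their heights equal, so
  \<open>r = 2 * (- p)\<close>, which coprimality excludes for \<open>r \<ge> 3\<close>.\<close>

lemma narrow_vertical:
  assumes N1: "N = 1" and r3: "r \<ge> 3" and p: "- r < p" "p < 0" and y: "ipt P p y" "- r < y"
  shows "reducible P"
proof -
  have q0: "0 < p + N * r" using p N1 by simp
  obtain a b h m where L0: "coprime a b" "1 \<le> h" "h \<le> r" "1 \<le> m" "1 \<le> a" "0 \<le> b" "h = - (a * p) - b * r"
    "\<forall>x y. ipt P x y \<longrightarrow> - h \<le> a * x - b * y"
    "ipt P (p + m * h * b) (m * h * a - r)"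
    "\<forall>x y. ipt P x y \<longrightarrow> a * x - b * y = - h \<longrightarrow> b * x + a * y \<le> b * p - a * r + m * h * (a * a + b * b)"
    "ivec a (- b) \<in> normals P" "int (nhgt P (ivec a (- b))) = h" "int (wid P (ivec a (- b))) = m * h"
    "\<forall>x y. ipt P x y \<longrightarrow> p \<le> x"
    by (rule left_edge_inward[OF p(2)])
  note L = L0[rule_format]
  obtain a' b' h' m' where R0: "coprime a' b'" "1 \<le> h'" "h' \<le> r" "1 \<le> m'" "1 \<le> a'" "0 \<le> b'" "h' = a' * (p + N * r) - b' * r"
    "\<forall>x y. ipt P x y \<longrightarrow> a' * x + b' * y \<le> h'"
    "ipt P (p + N * r - m' * h' * b') (m' * h' * a' - r)"
    "\<forall>x y. ipt P x y \<longrightarrow> a' * x + b' * y = h' \<longrightarrow> a' * y - b' * x \<le> - (a' * r) - b' * (p + N * r) + m' * h' * (a' * a' + b' * b')"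
    "ivec (- a') (- b') \<in> normals P" "int (nhgt P (ivec (- a') (- b'))) = h'"
    "int (wid P (ivec (- a') (- b'))) = m' * h'"
    "\<forall>x y. ipt P x y \<longrightarrow> x \<le> p + N * r"
    by (rule right_edge_inward[OF q0])
  note R = R0[rule_format]
  have "b * (y + r) \<le> 0" using L(7) L(8)[OF y(1)] by (simp add: algebra_simps)
  then have b0: "b = 0" using L(6) y(2) by (simp add: mult_le_0_iff)
  then have a1: "a = 1" using L(1,5) by simp
  have h: "h = - p" using L(7) a1 b0 by simp
  have n1: "ivec 1 0 \<in> normals P" "int (nhgt P (ivec 1 0)) = - p" "int (wid P (ivec 1 0)) = m * (- p)"
    using L(11-13) by (simp_all add: a1 b0 h)
  show ?thesis
  proof (cases "b' = 0")
    case True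
    then have a1': "a' = 1" using R(1,5) by simp
    have h': "h' = p + r" using R(7) True a1' N1 by simp
    have n2: "- ivec 1 0 \<in> normals P" "int (nhgt P (- ivec 1 0)) = p + r"
      using R(11,12) by (simp_all add: a1' True h')
    have "nhgt P (ivec 1 0) \<le> nhgt P (- ivec 1 0)" "nhgt P (- ivec 1 0) \<le> nhgt P (- (- ivec 1 0))"
      using minP n1(1) n2(1) unfolding minimal_def by blast+
    then have "- p = p + r" using n1(2) n2(2) by simp
    then have r: "r = 2 * (- p)" by simp
    then have "- p dvd r" by (metis dvd_triv_right)
    moreover have "coprime (- p) r" using cop by simp
    ultimately have "- p = 1" using p(2) by (metis coprime_absorb_left zdvd1_eq abs_of_pos neg_0_less_iff_less)
    then show ?thesis using r r3 by simp
  next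
    case False
    show ?thesis
    proof (rule narrow_left_vertical[OF N1 p r3 n1])
      show "ipt P p (m * - p - r)" using L(9) by (simp add: a1 b0 h)
      show "y \<le> m * - p - r" if "ipt P p y" for y
        using L(10)[OF that] by (simp add: a1 b0 h)
      show "1 \<le> m" by fact
      show "coprime a' b'" "1 \<le> h'" "h' \<le> r" "1 \<le> m'" "1 \<le> a'" by fact+
      show "1 \<le> b'" using False R(6) by simp
    qed (use R L(14) N1 in auto)
  qed
qed

text \<open>The two edge inequalities at the top point, weighted by \<open>a'\<close> and
  \<open>a\<close>, give \<open>2 * ?B \<le> a * a'\<close>; the bounds on the heights give
  \<open>a * a' \<le> ?B + a + a'\<close>. As \<open>?B\<close> is at least \<open>a + a'\<close>,
  equality holds throughout: \<open>b = b' = 1\<close>, \<open>h = r\<close> and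
  \<open>a * a' = 2 * (a + a')\<close>. The left edge then fits below the top only if
  \<open>a \<le> 2\<close>, which the last equation forbids.\<close>

lemma not_both_inclined:
  assumes N1: "N = 1" and p: "- r < p" "p < 0"
    and L: "1 \<le> m" "1 \<le> a" "1 \<le> b" "h = - (a * p) - b * r" "h \<le> r"
      "\<And>x y. ipt P x y \<Longrightarrow> - h \<le> a * x - b * y" "ipt P (p + m * h * b) (m * h * a - r)"
    and R: "1 \<le> a'" "1 \<le> b'" "h' = a' * (p + r) - b' * r" "h' \<le> r"
      "\<And>x y. ipt P x y \<Longrightarrow> a' * x + b' * y \<le> h'"
  shows False
proof -
  obtain t s where ts: "ipt P t s" "r \<le> s" "\<forall>x y. ipt P x y \<longrightarrow> y \<le> s" by (rule top)
  let ?B = "a' * b + a * b'"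
  have "b * (s + r) \<le> a * (t - p)" using L(4) L(6)[OF ts(1)] by (simp add: algebra_simps)
  then have 1: "a' * (b * (s + r)) \<le> a' * (a * (t - p))" using R(1) by simp
  have "b' * (s + r) \<le> a' * (p + r - t)" using R(3) R(5)[OF ts(1)] by (simp add: algebra_simps)
  then have 2: "a * (b' * (s + r)) \<le> a * (a' * (p + r - t))" using L(2) by simp
  have 3: "?B * (s + r) \<le> (a * a') * r" using 1 2 by (simp add: algebra_simps)
  have B0: "0 < ?B" using L(2,3) R(1,2) by (simp add: add_pos_pos)
  have "?B * (2 * r) \<le> ?B * (s + r)" using ts(2) B0 by (intro mult_left_mono) auto
  then have "(2 * ?B) * r \<le> (a * a') * r" using 3 by (simp add: algebra_simps)
  then have low: "2 * ?B \<le> a * a'" using r by simp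
  have ac: "a * (- p) \<le> (b + 1) * r" using L(4,5) by (simp add: algebra_simps)
  have ac': "a' * (p + r) \<le> (b' + 1) * r" using R(3,4) by (simp add: algebra_simps)
  have m1: "a' * (a * (- p)) \<le> a' * ((b + 1) * r)" using ac R(1) by (intro mult_left_mono) auto
  have m2: "a * (a' * (p + r)) \<le> a * ((b' + 1) * r)" using ac' L(2) by (intro mult_left_mono) auto
  have "(a * a') * r \<le> (?B + a + a') * r" using m1 m2 by (simp add: algebra_simps)
  then have up: "a * a' \<le> ?B + a + a'" using r by simp
  have aa: "a \<le> a * b'" "a' \<le> a' * b" using L(2,3) R(1,2) by auto
  have "B \<le> x + y" if "2 * B \<le> z" "z \<le> B + x + y" for B x y z :: int
    using that by linarith
  then have "?B \<le> a + a'" using low up by this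
  then have eq12: "a * b' = a" "a' * b = a'" using aa by linarith+
  have "a * a' = 2 * (a + a')" using low up unfolding eq12 by simp
  note eq = eq12 this
  then have b1: "b = 1" "b' = 1" using L(2) R(1) by auto
  have "a' * (a * (- p)) + a * (a' * (p + r)) = (a * a') * r" by (simp add: algebra_simps)
  also have "\<dots> = a' * ((b + 1) * r) + a * ((b' + 1) * r)" by (simp add: eq(3) b1 algebra_simps)
  finally have "a' * (a * (- p)) = a' * ((b + 1) * r)" using m1 m2 by linarith
  then have "a * (- p) = (b + 1) * r" using R(1) by (simp only: mult_cancel_left) linarith
  then have "a * (- p) = 2 * r" using b1 by simp
  then have h: "h = r" using L(4) b1 by simp
  have "(a + a') * (s + r) \<le> (a + a') * (2 * r)" using 3 by (simp add: b1 eq(3) algebra_simps)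
  then have "s + r \<le> 2 * r" using L(2) R(1) by simp
  moreover have "m * h * a \<le> s + r" using ts(3)[rule_format, OF L(7)] by simp
  ultimately have "(m * a) * r \<le> 2 * r" using h by (simp add: algebra_simps)
  then have "m * a \<le> 2" using r by simp
  moreover have "a \<le> m * a" using L(1,2) by simp
  ultimately have "a = 1 \<or> a = 2" using L(2) by linarith
  then show False using eq(3) R(1) by auto
qed

end

lemma bottom_edge_narrow:
  assumes "bottom_edge P r p 1" and r3: "r \<ge> 3" and p: "- r < p" "p < 0"
  shows "reducible P"
proof -
  interpret bottom_edge P r p 1 by fact
  have q0: "0 < p + 1 * r" using p by simp
  obtain a b h m where L0: "coprime a b" "1 \<le> h" "h \<le> r" "1 \<le> m" "1 \<le> a" "0 \<le> b" "h = - (a * p) - b * r"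
    "\<forall>x y. ipt P x y \<longrightarrow> - h \<le> a * x - b * y"
    "ipt P (p + m * h * b) (m * h * a - r)"
    "\<forall>x y. ipt P x y \<longrightarrow> a * x - b * y = - h \<longrightarrow> b * x + a * y \<le> b * p - a * r + m * h * (a * a + b * b)"
    "ivec a (- b) \<in> normals P" "int (nhgt P (ivec a (- b))) = h" "int (wid P (ivec a (- b))) = m * h"
    "\<forall>x y. ipt P x y \<longrightarrow> p \<le> x"
    by (rule left_edge_inward[OF p(2)])
  note L = L0[rule_format]
  obtain a' b' h' m' where R0: "coprime a' b'" "1 \<le> h'" "h' \<le> r" "1 \<le> m'" "1 \<le> a'" "0 \<le> b'" "h' = a' * (p + 1 * r) - b' * r"
    "\<forall>x y. ipt P x y \<longrightarrow> a' * x + b' * y \<le> h'"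
    "ipt P (p + 1 * r - m' * h' * b') (m' * h' * a' - r)"
    "\<forall>x y. ipt P x y \<longrightarrow> a' * x + b' * y = h' \<longrightarrow> a' * y - b' * x \<le> - (a' * r) - b' * (p + 1 * r) + m' * h' * (a' * a' + b' * b')"
    "ivec (- a') (- b') \<in> normals P" "int (nhgt P (ivec (- a') (- b'))) = h'"
    "int (wid P (ivec (- a') (- b'))) = m' * h'"
    "\<forall>x y. ipt P x y \<longrightarrow> x \<le> p + 1 * r"
    by (rule right_edge_inward[OF q0])
  note R = R0[rule_format]
  have pos: "0 < m * h * a" "0 < m' * h' * a'"
    using L(2,4,5) R(2,4,5) by (simp_all add: mult_pos_pos)
  have "b = 0 \<or> b' = 0 \<or> 1 \<le> b \<and> 1 \<le> b'" using L(6) R(6) by linarith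
  then consider "b = 0" | "b' = 0" | "1 \<le> b" "1 \<le> b'" by blast
  then show ?thesis
  proof cases
    case 1
    then show ?thesis using narrow_vertical[OF refl r3 p, of "m * h * a - r"] L(9) pos(1) by simp
  next
    case 2
    \<comment> \<open>Reflection exchanges the neighbours and turns a vertical right one into a
      vertical left one.\<close>
    let ?f = "imat (-1) 0 0 1"
    have u: "unimodular ?f" by (rule unimodular_imat) simp
    have me: "bottom_edge (?f ` P) r (- p - 1 * r) 1" by (rule bottom_edge_mirror) fact
    have "ipt (?f ` P) (- p - 1 * r) (m' * h' * a' - r)"
      using R(9) 2 by (auto simp: ipt_image intro: exI[of _ "p + r"])
    then have "reducible (?f ` P)"
      using bottom_edge.narrow_vertical[OF me refl r3, of "m' * h' * a' - r"] p pos(2) by simp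
    then show ?thesis by (rule reducible_image[OF u])
  next
    case 3
    have False
      by (rule not_both_inclined[OF refl p L(4,5) 3(1) L(7,3,8,9) R(5) 3(2) _ R(3,8)])
        (use R(7) in simp_all)
    then show ?thesis ..
  qed
qed

context bottom_edge
begin

text \<open>On \<open>P\<close> one has \<open>x \<ge> - 1\<close> and
  \<open>x + (N - 2) * y \<le> 1\<close>, hence \<open>(N - 2) * y \<le> 2\<close>. This gives three
  columns for \<open>N = 2\<close>, a triangle or the strip for \<open>N = 3\<close>, and the strip
  for larger \<open>N\<close>.\<close>

lemma height_one_wide:
  assumes r1: "r = 1" and N2: "N \<ge> 2" and p: "p = - 1"
  shows "reducible P"
proof -
  have left: "- 1 \<le> x" if "ipt P x y" for x y
  proof -
    have "\<forall>x y. ipt P x y \<longrightarrow> p \<le> x" by (rule left_edge_inward) (use p in simp)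
    then show ?thesis using that p by blast
  qed
  have q0: "0 < p + N * r" using p N2 r1 by simp
  obtain a b h m where R0: "coprime a b" "1 \<le> h" "h \<le> r" "1 \<le> m" "1 \<le> a" "0 \<le> b" "h = a * (p + N * r) - b * r"
    "\<forall>x y. ipt P x y \<longrightarrow> a * x + b * y \<le> h"
    "ipt P (p + N * r - m * h * b) (m * h * a - r)"
    "\<forall>x y. ipt P x y \<longrightarrow> a * x + b * y = h \<longrightarrow> a * y - b * x \<le> - (a * r) - b * (p + N * r) + m * h * (a * a + b * b)"
    "ivec (- a) (- b) \<in> normals P" "int (nhgt P (ivec (- a) (- b))) = h"
    "int (wid P (ivec (- a) (- b))) = m * h"
    "\<forall>x y. ipt P x y \<longrightarrow> x \<le> p + N * r"
    by (rule right_edge_inward[OF q0])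
  note R = R0[rule_format]
  have h: "h = 1" and b: "b = a * (N - 1) - 1" using R(2,3,7) r1 p by (auto simp: algebra_simps)
  have diag: "x + (N - 2) * y \<le> 1" if xy: "ipt P x y" for x y
  proof -
    have "(a - 1) * (- 1) \<le> (a - 1) * y" using bottom[OF xy] R(5) r1 by (intro mult_left_mono) auto
    then have "a * (x + (N - 2) * y) \<le> a * 1" using R(8)[OF xy] by (simp add: h b algebra_simps)
    then show ?thesis using R(5) by simp
  qed
  have yN: "(N - 2) * y \<le> 2" if "ipt P x y" for x y using diag[OF that] left[OF that] by linarith
  have y_ge: "- 1 \<le> y" if "ipt P x y" for x y using bottom[OF that] r1 by simp
  consider "N = 2" | "N = 3" | "N \<ge> 4" using N2 by linarith
  then show ?thesis
  proof cases
    case 1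
    show ?thesis
    proof (rule reducible_columns)
      fix x y assume "ipt P x y"
      then show "\<bar>x\<bar> \<le> 1" using diag[of x y] left[of x y] 1 by simp
    qed
  next
    case 2
    show ?thesis
    proof (cases "\<exists>x. ipt P x 2")
      case True
      then obtain x where x: "ipt P x 2" by blast
      then have "x = - 1" using diag[OF x] left[OF x] 2 by simp
      then have top': "ipt P (- 1) 2" using x by simp
      have "P = convex hull {ivec (-1) (-1), ivec 2 (-1), ivec (-1) 2}"
      proof (rule fano_eq_triangle[OF P])
        fix x y assume xy: "ipt P x y"
        show "(2 - - 1) * (x - - 1) + (2 - - 1) * (y - - 1) \<le> (2 - - 1) * (2 - - (1 :: int))"
          using diag[OF xy] 2 by simp
      qed (use corners top' left y_ge 2 r1 p in auto)
      then have "P \<in> triangles" by (simp add: triangles_def)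
      then show ?thesis by (rule reducible_triangle)
    next
      case False
      have "in_strip P"
        unfolding in_strip_def
      proof (intro allI impI)
        fix x y assume xy: "ipt P x y"
        then have "y \<noteq> 2" using False by auto
        then show "\<bar>y\<bar> \<le> 1" using yN[OF xy] y_ge[OF xy] 2 by simp
      qed
      then show ?thesis by (rule reducible_strip)
    qed
  next
    case 3
    have "in_strip P"
      unfolding in_strip_def
    proof (intro allI impI)
      fix x y assume xy: "ipt P x y"
      have "y \<le> 1"
      proof (rule ccontr)
        assume "\<not> y \<le> 1"
        then have "2 * 2 \<le> (N - 2) * y" using 3 by (intro mult_mono) auto
        then show False using yN[OF xy] by simp
      qed
      then show "\<bar>y\<bar> \<le> 1" using y_ge[OF xy] by simp
    qed
    then show ?thesis by (rule reducible_strip)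
  qed
qed

text \<open>All edges have height and length 1. If the polygon rises above 1, the two edges at its
  top vertex are so constrained that this vertex is \<open>(- 1, 2)\<close>, and then the polygon
  lies in the columns \<open>\<bar>x\<bar> \<le> 1\<close>.\<close>

lemma height_one_narrow:
  assumes r1: "r = 1" and N1: "N = 1" and p: "p = 0"
    and wid1: "\<And>u. u \<in> normals P \<Longrightarrow> wid P u \<le> 1"
  shows "reducible P"
proof -
  obtain t s where ts: "ipt P t s" "r \<le> s" "\<forall>x y. ipt P x y \<longrightarrow> y \<le> s" by (rule top)
  note top_le = ts(3)[rule_format]
  have y_ge: "- 1 \<le> y" if "ipt P x y" for x y using bottom[OF that] r1 by simp
  have c0: "ipt P 0 (- 1)" and c1: "ipt P 1 (- 1)" using corners r1 N1 p by auto
  show ?thesis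
  proof (cases "s \<le> 1")
    case True
    have "in_strip P"
      unfolding in_strip_def
    proof (intro allI impI)
      fix x y assume xy: "ipt P x y"
      then show "\<bar>y\<bar> \<le> 1" using top_le[OF xy] y_ge[OF xy] True by simp
    qed
    then show ?thesis by (rule reducible_strip)
  next
    case False
    \<comment> \<open>A horizontal top edge would have height \<open>s > 1\<close>, more than the
      maximum.\<close>
    have unique: "x = t" if x: "ipt P x s" for x
    proof (rule ccontr)
      assume "x \<noteq> t"
      have h: "hgt P (ivec 0 (- 1)) = of_int s"
        using hgt_ipt[OF P ts(1), of 0 "- 1"] top_le by simp
      have "ivec 0 (- 1) \<in> normals P"
      proof (rule normalsI[OF P])
        show "primitive (ivec 0 (- 1))" by (rule primitive_ivec[THEN iffD2]) simp
        show "ivec x s \<noteq> ivec t s" using \<open>x \<noteq> t\<close> by simp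
        show "ivec x s \<in> face P (ivec 0 (- 1))" "ivec t s \<in> face P (ivec 0 (- 1))"
          using x ts(1) h by (simp_all add: face_eq[OF fano_compact[OF P]] ipt_def)
      qed
      then have "int (nhgt P (ivec 0 (- 1))) \<le> 1" using max r1 by simp
      then show False using False h by (simp add: nhgt_def)
    qed
    have cop0: "coprime (0 :: int) (- 1)" by simp
    have min0: "0 * t + (- 1) * s \<le> 0 * x + (- 1) * y" if "ipt P x y" for x y
      using top_le[OF that] by simp
    have ext: "1 * ((- 1) * x - 0 * y) \<le> 1 * ((- 1) * t - 0 * s)"
      "(- 1) * ((- 1) * x - 0 * y) \<le> (- 1) * ((- 1) * t - 0 * s)"
      if "ipt P x y" "0 * x + (- 1) * y = 0 * t + (- 1) * s" for x y
      using unique[of x] that by simp_all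
    obtain A B h m where L: "h \<ge> 1" "m \<ge> 1" "1 * (0 * B - (- 1) * A) > 0"
      "A * t + B * s = - h" "\<And>x y. ipt P x y \<Longrightarrow> - h \<le> A * x + B * y"
      "\<And>x y. ipt P x y \<Longrightarrow> A * x + B * y = - h \<Longrightarrow> 1 * (B * x - A * y) \<le> 1 * (B * t - A * s) + m * h * (A * A + B * B)"
      "ivec A B \<in> normals P" "int (nhgt P (ivec A B)) = h" "int (wid P (ivec A B)) = m * h"
      by (rule adjacent_edge_ipt[OF P T cop0 _ ts(1) min0 ext(1)]) auto
    obtain A' B' h' m' where R: "h' \<ge> 1" "m' \<ge> 1" "(- 1) * (0 * B' - (- 1) * A') > 0"
      "A' * t + B' * s = - h'" "\<And>x y. ipt P x y \<Longrightarrow> - h' \<le> A' * x + B' * y"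
      "\<And>x y. ipt P x y \<Longrightarrow> A' * x + B' * y = - h' \<Longrightarrow>
        (- 1) * (B' * x - A' * y) \<le> (- 1) * (B' * t - A' * s) + m' * h' * (A' * A' + B' * B')"
      "ivec A' B' \<in> normals P" "int (nhgt P (ivec A' B')) = h'" "int (wid P (ivec A' B')) = m' * h'"
      by (rule adjacent_edge_ipt[OF P T cop0 _ ts(1) min0 ext(2)]) auto
    have h1: "h = 1" "h' = 1" using max[OF L(7)] max[OF R(7)] L(1,8) R(1,8) r1 by auto
    have m1: "m = 1" "m' = 1" using wid1[OF L(7)] wid1[OF R(7)] L(2,9) R(2,9) h1 by auto
    have A: "A \<ge> 1" "A' \<le> - 1" using L(3) R(3) by auto
    have Lt: "A * t + B * s = - 1" and Rt: "A' * t + B' * s = - 1" using L(4) R(4) h1 by auto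
    have "B \<le> 1" using L(5)[OF c0] h1 by simp
    \<comment> \<open>The corner \<open>(0, - 1)\<close> gives \<open>B \<le> 1\<close>. For
      \<open>B = 1\<close> it lies on the line of this edge, and the length 1 of the edge bounds
      \<open>t\<close> from below.\<close>
    have t_cases: "t = - 1 \<or> t \<ge> 1"
    proof -
      consider "B = 1" | "B = 0" | "B \<le> - 1" using \<open>B \<le> 1\<close> by linarith
      then show ?thesis
      proof cases
        case 1
        have s: "s = - 1 - A * t" using Lt 1 by simp
        have "A \<le> t - A * s + (A * A + 1)" using L(6)[OF c0] 1 h1 m1 by simp
        then have "0 \<le> (t + 1) * (A * A + 1)" by (simp add: s algebra_simps)
        moreover have "0 < A * A + 1" by (simp add: add_nonneg_pos)
        ultimately have "t \<ge> - 1" by (simp add: zero_le_mult_iff)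
        moreover have "A * t < 0" using s False by simp
        then have "t < 0" using A(1) by (simp add: mult_less_0_iff)
        ultimately show ?thesis by simp
      next
        case 2
        then have "A * (- t) = 1" using Lt by simp
        then have "A = 1 \<and> - t = 1 \<or> A = - 1 \<and> - t = - 1" by (simp only: zmult_eq_1_iff)
        then show ?thesis using A(1) by auto
      next
        case 3
        then have "B * s \<le> (- 1) * s" using False by (intro mult_right_mono) auto
        then have "A * t > 0" using Lt False by simp
        then have "t > 0" using A(1) by (simp add: zero_less_mult_iff)
        then show ?thesis by simp
      qed
    qed
    have B': "A' - B' \<ge> - 1" using R(5)[OF c1] h1 by simp
    \<comment> \<open>The mirrored argument: corner \<open>(1, - 1)\<close> in place of
      \<open>(0, - 1)\<close> and \<open>- (t + s)\<close> in place of \<open>t\<close>.\<close>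
    have ts_cases: "t + s = 1 \<or> t + s \<le> - 1"
    proof -
      consider "B' = A' + 1" | "B' = A'" | "B' \<le> A' - 1" using B' by linarith
      then show ?thesis
      proof cases
        case 1
        define k where "k = t + s"
        have Ak: "A' * k = - 1 - s" using Rt 1 by (simp add: k_def algebra_simps)
        have Bk: "B' * k = t - 1" using Ak 1 by (simp add: k_def algebra_simps)
        have "A' * 1 + B' * (- 1) = - h'" using 1 h1 by simp
        then have "(- 1) * (B' * 1 - A' * (- 1)) \<le> (- 1) * (B' * t - A' * s) + 1 * 1 * (A' * A' + B' * B')"
          using R(6)[OF c1] h1 m1 by simp
        then have "0 \<le> (A' * A' + B' * B') - B' * (t - 1) - A' * (- 1 - s)"
          by (simp add: algebra_simps)
        also have "\<dots> = (1 - k) * (A' * A' + B' * B')"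
          unfolding Ak[symmetric] Bk[symmetric] by (simp add: algebra_simps)
        finally have "0 \<le> (1 - k) * (A' * A' + B' * B')" .
        moreover have "0 < A' * A' + B' * B'" using A(2) by (simp add: add_pos_nonneg mult_neg_neg)
        ultimately have "k \<le> 1" by (simp add: zero_le_mult_iff)
        moreover have "A' * k < 0" using Ak False by simp
        then have "k > 0" using A(2) by (simp add: mult_less_0_iff)
        ultimately show ?thesis by (simp add: k_def)
      next
        case 2
        then have "(- A') * (t + s) = 1" using Rt by (simp add: algebra_simps)
        then have "- A' = 1 \<and> t + s = 1 \<or> - A' = - 1 \<and> t + s = - 1" by (simp only: zmult_eq_1_iff)
        then show ?thesis by auto
      next
        case 3
        have "1 * s \<le> (A' - B') * s" using 3 False by (intro mult_right_mono) auto
        then have "0 < A' * (t + s)" using Rt False by (simp add: algebra_simps)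
        then have "t + s < 0" using A(2) by (simp add: zero_less_mult_iff)
        then show ?thesis by simp
      qed
    qed
    have t: "t = - 1" and s: "s = 2" using t_cases ts_cases False by auto
    have "B = 0 \<or> B = 1" and Aeq: "A = 1 + 2 * B" using Lt A(1) \<open>B \<le> 1\<close> t s by auto
    have "B' = - 1 \<or> B' = - 2" and Aeq': "A' = 1 + 2 * B'" using Rt A(2) B' t s by auto
    show ?thesis
    proof (rule reducible_columns)
      fix x y assume xy: "ipt P x y"
      have y: "- 1 \<le> y" "y \<le> 2" using y_ge[OF xy] top_le[OF xy] s by auto
      have "- 1 \<le> x"
        using \<open>B = 0 \<or> B = 1\<close> L(5)[OF xy] h1 y by (auto simp: Aeq)
      moreover have "x \<le> 1"
        using \<open>B' = - 1 \<or> B' = - 2\<close>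
      proof
        assume "B' = - 1"
        then have "x + y \<le> 1" using R(5)[OF xy] h1 by (simp add: Aeq')
        moreover have "x \<le> 1" if "y = - 1" using bottom_line[of x] xy that r1 N1 p by simp
        ultimately show ?thesis using y by linarith
      next
        assume "B' = - 2"
        then have "3 * x + 2 * y \<le> 1" using R(5)[OF xy] h1 by (simp add: Aeq')
        then show ?thesis using y by linarith
      qed
      ultimately show "\<bar>x\<bar> \<le> 1" by simp
    qed
  qed
qed

end

lemma bottom_edge_reducible:
  assumes B: "bottom_edge P r p N"
    and wid1: "r = 1 \<Longrightarrow> N = 1 \<Longrightarrow> \<forall>u\<in>normals P. wid P u \<le> 1"
  shows "reducible P"
proof -
  interpret bottom_edge P r p N by fact
  let ?S = "\<lambda>j. imat 1 j 0 1"
  have u: "unimodular (?S j)" for j by (rule unimodular_imat) simp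
  have red: "reducible P" if "reducible (?S j ` P)" for j using that by (rule reducible_image[OF u])
  show ?thesis
  proof (cases "r = 1")
    case True
    show ?thesis
    proof (cases "N = 1")
      case N1: True
      have b: "bottom_edge (?S p ` P) r 0 N" using bottom_edge_shear[OF B, of p] True by simp
      have "reducible (?S p ` P)"
      proof (rule bottom_edge.height_one_narrow[OF b True N1 refl])
        show "wid (?S p ` P) x \<le> 1" if "x \<in> normals (?S p ` P)" for x
          using that wid1[OF True N1] unimodular.wid_image[OF u] unimodular.normals_image[OF u] by simp
      qed
      then show ?thesis by (rule red)
    next
      case False
      have "bottom_edge (?S (p + 1) ` P) r (- 1) N" using bottom_edge_shear[OF B, of "p + 1"] True by simp
      then have "reducible (?S (p + 1) ` P)"
        by (rule bottom_edge.height_one_wide[OF _ True]) (use N False in auto)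
      then show ?thesis by (rule red)
    qed
  next
    case False
    then have r2: "r \<ge> 2" using r by simp
    \<comment> \<open>The representative of \<open>p\<close> modulo \<open>r\<close> strictly
      between \<open>- r\<close> and 0, which exists as coprimality excludes the residue 0. It puts
      the ends of the edge on different sides of the axis \<open>x = 0\<close>, so that both
      neighbours lean inwards.\<close>
    define p' where "p' = p mod r - r"
    define j where "j = p div r + 1"
    have "p - j * r = p'" by (simp add: p'_def j_def algebra_simps minus_div_mult_eq_mod[symmetric])
    then have b: "bottom_edge (?S j ` P) r p' N" using bottom_edge_shear[OF B, of j] by simp
    have "p mod r \<noteq> 0"
    proof
      assume "p mod r = 0"
      then have "r dvd p" by auto
      then have "is_unit r" using cop by (metis coprime_absorb_right)
      then show False using r2 by simp
    qed
    moreover have "0 \<le> p mod r" "p mod r < r" using r2 by simp_all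
    ultimately have p': "- r < p'" "p' < 0" by (auto simp: p'_def)
    consider "N \<ge> 2" | "N = 1" "r = 2" | "N = 1" "r \<ge> 3" using N r2 by linarith
    then show ?thesis
    proof cases
      case 1
      then show ?thesis using bottom_edge.wide[OF b 1 p'] red by blast
    next
      case 2
      interpret b: bottom_edge "?S j ` P" r p' N by fact
      have p1: "p' = - 1" using p' 2 by simp
      have l: "\<forall>x y. ipt (?S j ` P) x y \<longrightarrow> p' \<le> x" by (rule b.left_edge_inward) (use p1 in simp)
      have r: "\<forall>x y. ipt (?S j ` P) x y \<longrightarrow> x \<le> p' + N * r"
        by (rule b.right_edge_inward) (use p1 2 in simp)
      have "reducible (?S j ` P)"
      proof (rule reducible_columns)
        fix x y assume "ipt (?S j ` P) x y"
        then have "p' \<le> x" "x \<le> p' + N * r" using l r by blast+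
        then show "\<bar>x\<bar> \<le> 1" using p1 2 by simp
      qed
      then show ?thesis by (rule red)
    next
      case 3
      then have "reducible (?S j ` P)" using bottom_edge_narrow[of "?S j ` P" r p'] b p' by simp
      then show ?thesis by (rule red)
    qed
  qed
qed

lemma bottom_edge_exists:
  assumes P: "fano_polygon P" and T: "only_T_singularities P" and M: "minimal P"
    and u: "u \<in> normals P" and max: "\<And>w. w \<in> normals P \<Longrightarrow> nhgt P w \<le> nhgt P u"
  obtains f p where "unimodular f"
    "bottom_edge (f ` P) (int (nhgt P u)) p (int (wid P u div nhgt P u))"
proof -
  have pu: "primitive u" and wu: "wid P u > 0" using u normalsD by auto
  obtain a b where ab: "u = ivec a b" "coprime a b" using pu by (auto simp: primitive_def)
  obtain i j where "i * a + j * b = 1"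
    using ab(2) bezout_int[of a b] by (metis coprime_imp_gcd_eq_1)
  then have det: "\<bar>j * b - (- i) * a\<bar> = 1" by (simp add: algebra_simps)
  \<comment> \<open>The second row is \<open>u\<close> itself, which becomes the height function;
    the first row completes it by Bezout coefficients.\<close>
  define f where "f = imat j (- i) a b"
  interpret unimodular f unfolding f_def by (rule unimodular_imat[OF det])
  have adj: "adjoint f (ivec 0 1) = u"
  proof -
    have "adjoint f (ivec 0 1) \<bullet> x = u \<bullet> x" for x
      unfolding inner_adjoint by (simp add: f_def imat_def ab inner_plane)
    then show ?thesis using vector_eq_rdot by (metis inner_commute)
  qed
  define Q where "Q = f ` P"
  define r where "r = int (nhgt P u)"
  define N where "N = int (wid P u div nhgt P u)"
  have Q: "fano_polygon Q" "only_T_singularities Q" "minimal Q"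
    using fano_image only_T_image minimal_image P T M by (auto simp: Q_def)
  have dv: "nhgt P u dvd wid P u" using T u only_T_iff[OF P] by blast
  have r1: "r \<ge> 1" using nhgt_pos[OF P pu] by (simp add: r_def)
  have Nr: "int (wid P u) = N * r" using dv by (simp add: N_def r_def flip: of_nat_mult)
  have N1: "N \<ge> 1"
  proof -
    have "0 < N * r" using Nr wu by simp
    then show ?thesis using r1 by (simp add: zero_less_mult_iff)
  qed
  have p01: "primitive (ivec 0 1)" by (rule primitive_ivec[THEN iffD2]) simp
  have hQ: "hgt Q (ivec 0 1) = of_int r"
    using adj real_nhgt[OF P pu] by (simp only: Q_def hgt_image r_def of_int_of_nat_eq)
  have wQ: "real (wid Q (ivec 0 1)) = of_int (N * r)"
    using adj Nr by (metis Q_def wid_image of_int_of_nat_eq)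
  have J: "quarter_turn (ivec 0 1) = (1, 0)" by (simp add: quarter_turn_def)
  obtain q where q: "q \<in> verts Q" "q + real (wid Q (ivec 0 1)) *\<^sub>R quarter_turn (ivec 0 1) \<in> verts Q"
    "face Q (ivec 0 1) = {q + t *\<^sub>R quarter_turn (ivec 0 1) | t. 0 \<le> t \<and> t \<le> real (wid Q (ivec 0 1))}"
    "ivec 0 1 \<bullet> q = - hgt Q (ivec 0 1)"
    by (rule fano_face_ends[OF Q(1) p01])
  obtain p y where py: "q = ivec p y" "ipt Q p y" "coprime p y" by (rule fano_iptE[OF Q(1) q(1)])
  have "real_of_int y = of_int (- r)" using q(4) hQ by (simp add: py inner_plane)
  then have y: "y = - r" by (simp only: of_int_eq_iff)
  have "bottom_edge Q r p N"
  proof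
    show "ipt Q p (- r)" using py y by simp
    have "ivec (p + N * r) (- r) \<in> verts Q" using q(2) unfolding wQ J by (simp add: py y)
    then show "ipt Q (p + N * r) (- r)" using fano_verts_subset[OF Q(1)] by (auto simp: ipt_def)
    show "- r \<le> y'" if "ipt Q x y'" for x y'
    proof -
      have "- hgt Q (ivec 0 1) \<le> ivec 0 1 \<bullet> ivec x y'"
        using that hgt_le[OF fano_compact[OF Q(1)]] unfolding ipt_def by blast
      then have "real_of_int (- r) \<le> of_int y'" unfolding hQ by (simp add: inner_plane)
      then show ?thesis by (simp only: of_int_le_iff)
    qed
    show "p \<le> x \<and> x \<le> p + N * r" if "ipt Q x (- r)" for x
    proof -
      have "ivec 0 1 \<bullet> ivec x (- r) = - hgt Q (ivec 0 1)" unfolding hQ by (simp add: inner_plane)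
      then have "ivec x (- r) \<in> face Q (ivec 0 1)"
        using that by (simp add: face_eq[OF fano_compact[OF Q(1)]] ipt_def del: inner_Pair)
      then obtain t where t: "ivec x (- r) = q + t *\<^sub>R quarter_turn (ivec 0 1)"
        "0 \<le> t" "t \<le> real (wid Q (ivec 0 1))"
        unfolding q(3) by blast
      have "real_of_int x = of_int p + t" using t(1) unfolding J py by simp
      then have "real_of_int p \<le> of_int x" "real_of_int x \<le> of_int (p + N * r)"
        using t(2,3) unfolding wQ by simp_all
      then show ?thesis by (simp only: of_int_le_iff)
    qed
    show "coprime p r" using py y by simp
    show "int (nhgt Q w) \<le> r" if "w \<in> normals Q" for w
    proof -
      have "adjoint f w \<in> normals P" using that normals_image by (simp add: Q_def)
      then have "nhgt P (adjoint f w) \<le> nhgt P u" by (rule max)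
      then show ?thesis by (simp only: Q_def r_def nhgt_def hgt_image of_nat_le_iff)
    qed
  qed (use Q r1 N1 in auto)
  then show thesis using that[of f p] unimodular_axioms by (simp add: Q_def r_def N_def)
qed

theorem minimal_reducible:
  assumes P: "fano_polygon P" and T: "only_T_singularities P" and M: "minimal P"
  shows "reducible P"
proof -
  have fin: "finite (normals P)" using P by (rule finite_normals)
  \<comment> \<open>An edge adjacent to the face in an arbitrary direction.\<close>
  have ne: "normals P \<noteq> {}"
  proof -
    have p10: "primitive (ivec 1 0)" by (rule primitive_ivec[THEN iffD2]) simp
    let ?J = "quarter_turn (ivec 1 0)"
    obtain q where q: "q + real (wid P (ivec 1 0)) *\<^sub>R ?J \<in> verts P"
      "face P (ivec 1 0) = {q + t *\<^sub>R ?J | t. 0 \<le> t \<and> t \<le> real (wid P (ivec 1 0))}"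
      by (rule fano_face_ends[OF P p10])
    have "0 \<le> ?J \<bullet> ?J" by simp
    then have ext: "1 * (?J \<bullet> x) \<le> 1 * (?J \<bullet> (q + real (wid P (ivec 1 0)) *\<^sub>R ?J))"
      if xF: "x \<in> face P (ivec 1 0)" for x
    proof -
      obtain t where "x = q + t *\<^sub>R ?J" "t \<le> real (wid P (ivec 1 0))" using xF unfolding q(2) by blast
      then show ?thesis using mult_right_mono[OF _ \<open>0 \<le> ?J \<bullet> ?J\<close>] by (simp add: inner_add_right)
    qed
    have "q + real (wid P (ivec 1 0)) *\<^sub>R ?J \<in> face P (ivec 1 0)"
      unfolding q(2) by force
    then obtain u where "u \<in> normals P"
      using adjacent_edge[OF P p10 _ _ ext] by metis
    then show ?thesis by blast
  qed
  obtain u where u: "u \<in> normals P" "\<And>w. w \<in> normals P \<Longrightarrow> nhgt P w \<le> nhgt P u"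
    using finite_argmin[OF fin ne, of "\<lambda>w. - real (nhgt P w)"] by auto
  \<comment> \<open>If all heights are 1, a longest edge is taken, so that a bottom edge of length 1
    means that all edges have length 1.\<close>
  obtain u' where u': "u' \<in> normals P" "\<And>w. w \<in> normals P \<Longrightarrow> nhgt P w \<le> nhgt P u'"
    "nhgt P u' = 1 \<Longrightarrow> \<forall>w\<in>normals P. wid P w \<le> wid P u'"
  proof (cases "nhgt P u = 1")
    case True
    obtain v where v: "v \<in> normals P" "\<And>w. w \<in> normals P \<Longrightarrow> wid P w \<le> wid P v"
      using finite_argmin[OF fin ne, of "\<lambda>w. - real (wid P w)"] by auto
    have "nhgt P v = 1"
      using u(2)[OF v(1)] True nhgt_pos[OF P normalsD(1)[OF v(1)]] by simp
    then show thesis using that[of v] v u True by simp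
  next
    case False
    then show thesis using that[of u] u by blast
  qed
  obtain f p where f: "unimodular f"
    "bottom_edge (f ` P) (int (nhgt P u')) p (int (wid P u' div nhgt P u'))"
    by (rule bottom_edge_exists[OF P T M u'(1,2)])
  have "reducible (f ` P)"
  proof (rule bottom_edge_reducible[OF f(2)])
    assume "int (nhgt P u') = 1" "int (wid P u' div nhgt P u') = 1"
    then have "\<forall>w\<in>normals P. wid P w \<le> 1" using u'(3) by simp
    then show "\<forall>w\<in>normals (f ` P). wid (f ` P) w \<le> 1"
      using unimodular.normals_image[OF f(1)] unimodular.wid_image[OF f(1)] by simp
  qed
  then show ?thesis by (rule reducible_image[OF f(1)])
qed

section \<open>Checkable certificates for explicit polygons\<close>

definition pt :: "int \<times> int \<Rightarrow> plane" where
  "pt p = (of_int (fst p), of_int (snd p))"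

definition ipoly :: "(int \<times> int) list \<Rightarrow> plane set" where
  "ipoly V = convex hull (pt ` set V)"

definition idot :: "int \<times> int \<Rightarrow> int \<times> int \<Rightarrow> int" where
  "idot p q = fst p * fst q + snd p * snd q"

definition idet :: "int \<times> int \<Rightarrow> int \<times> int \<Rightarrow> int" where
  "idet p q = fst p * snd q - snd p * fst q"

definition isub :: "int \<times> int \<Rightarrow> int \<times> int \<Rightarrow> int \<times> int" where
  "isub p q = (fst p - fst q, snd p - snd q)"

definition iadd :: "int \<times> int \<Rightarrow> int \<Rightarrow> int \<times> int \<Rightarrow> int \<times> int" where
  "iadd p k v = (fst p + k * fst v, snd p + k * snd v)"

text \<open>The barycentric coordinates of \<open>q\<close> with respect to \<open>a\<close>, \<open>b\<close>, \<open>c\<close> are proportional to the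
  determinants below.\<close>

definition in_tri :: "int \<times> int \<Rightarrow> int \<times> int \<Rightarrow> int \<times> int \<Rightarrow> int \<times> int \<Rightarrow> bool" where
  "in_tri a b c q \<longleftrightarrow> 0 \<le> idet (isub b q) (isub c q) \<and> 0 \<le> idet (isub c q) (isub a q) \<and>
     0 \<le> idet (isub a q) (isub b q) \<and>
     0 < idet (isub b q) (isub c q) + idet (isub c q) (isub a q) + idet (isub a q) (isub b q)"

definition mem_hull :: "(int \<times> int) list \<Rightarrow> int \<times> int \<Rightarrow> bool" where
  "mem_hull V q \<longleftrightarrow> q \<in> set V \<or> (\<exists>a\<in>set V. \<exists>b\<in>set V. \<exists>c\<in>set V. in_tri a b c q)"

text \<open>Positive determinants of consecutive vectors make them go around the origin with angles
  below a half-turn; \<open>c = d\<close> admits three vectors.\<close>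

definition fano_check :: "(int \<times> int) list \<Rightarrow> bool" where
  "fano_check V \<longleftrightarrow> (\<forall>p\<in>set V. gcd (fst p) (snd p) = 1) \<and>
     (\<exists>a\<in>set V. \<exists>b\<in>set V. \<exists>c\<in>set V. \<exists>d\<in>set V.
       0 < idet a b \<and> 0 < idet b c \<and> (c = d \<or> 0 < idet c d) \<and> 0 < idet d a)"

definition imap :: "int \<times> int \<Rightarrow> int \<times> int \<Rightarrow> int \<times> int \<Rightarrow> int \<times> int" where
  "imap r1 r2 p = (idot r1 p, idot r2 p)"

text \<open>The hypotheses of \<open>mut_equiv_points\<close> for lists of integer points, with
  \<open>iadd\<close> for the shears and \<open>mem_hull\<close> for the memberships, so that
  evaluation decides them.\<close>

definition mutation_check ::
  "(int \<times> int) list \<Rightarrow> (int \<times> int) list \<Rightarrow> int \<times> int \<Rightarrow> int \<times> int \<Rightarrow> nat \<Rightarrow> bool" where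
  "mutation_check V W w v j \<longleftrightarrow> gcd (fst w) (snd w) = 1 \<and> gcd (fst v) (snd v) = 1 \<and> idot w v = 0 \<and> j > 0 \<and>
     (\<forall>q\<in>set W. if idot w q < 0 then mem_hull V q \<and> mem_hull V (iadd q (- (idot w q * int j)) v)
        else mem_hull V q \<or> mem_hull V (iadd q (- (idot w q * int j)) v)) \<and>
     (\<forall>p\<in>set V. if idot w p < 0 then mem_hull W p \<or> mem_hull W (iadd p (idot w p * int j) v)
        else mem_hull W p \<and> mem_hull W (iadd p (idot w p * int j) v)) \<and>
     (\<exists>q\<in>set W. idot w q < 0 \<and> (\<forall>p\<in>set V. idot w q \<le> idot w p))"

text \<open>The mutation leads to the image of \<open>W\<close> under the matrix with rows
  \<open>r1\<close> and \<open>r2\<close>; a chain then continues from \<open>W\<close>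
  itself.\<close>

definition link_check :: "(int \<times> int) list \<Rightarrow> (int \<times> int) list \<Rightarrow>
    int \<times> int \<Rightarrow> int \<times> int \<Rightarrow> nat \<Rightarrow> int \<times> int \<Rightarrow> int \<times> int \<Rightarrow> bool" where
  "link_check V W w v j r1 r2 \<longleftrightarrow>
     \<bar>idet r1 r2\<bar> = 1 \<and> fano_check W \<and> mutation_check V (map (imap r1 r2) W) w v j"

lemma pt_inner: "pt p \<bullet> pt q = of_int (idot p q)"
  by (simp add: pt_def idot_def inner_plane)

lemma pt_iadd: "pt (iadd p k v) = pt p + of_int k *\<^sub>R pt v"
  by (simp add: pt_def iadd_def)

lemma primitive_pt: "gcd (fst p) (snd p) = 1 \<Longrightarrow> primitive (pt p)"
  by (auto simp: pt_def primitive_def coprime_iff_gcd_eq_1)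

lemma in_tri_hull:
  assumes "in_tri a b c q"
  shows "pt q \<in> convex hull {pt a, pt b, pt c}"
proof -
  let ?w1 = "idet (isub b q) (isub c q)" and ?w2 = "idet (isub c q) (isub a q)"
    and ?w3 = "idet (isub a q) (isub b q)"
  have "ivec (fst q) (snd q) \<in> convex hull
      {ivec (fst a) (snd a), ivec (fst b) (snd b), ivec (fst c) (snd c)}"
    by (rule mem_triangle[of ?w1 ?w2 ?w3 "?w1 + ?w2 + ?w3"])
      (use assms in \<open>auto simp: in_tri_def\<close>, simp_all add: idet_def isub_def algebra_simps)
  then show ?thesis by (simp add: pt_def)
qed

lemma mem_hull_ipoly:
  assumes "mem_hull V q"
  shows "pt q \<in> ipoly V"
  using assms unfolding mem_hull_def
proof
  assume "q \<in> set V"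
  then show ?thesis unfolding ipoly_def by (intro hull_inc imageI)
next
  assume "\<exists>a\<in>set V. \<exists>b\<in>set V. \<exists>c\<in>set V. in_tri a b c q"
  then obtain a b c where abc: "a \<in> set V" "b \<in> set V" "c \<in> set V" "in_tri a b c q" by blast
  then have "convex hull {pt a, pt b, pt c} \<subseteq> ipoly V"
    unfolding ipoly_def by (intro hull_mono) blast
  then show ?thesis using in_tri_hull[OF abc(4)] by blast
qed

lemma cramer:
  assumes "u \<bullet> pt a = 0" "u \<bullet> pt b = 0" "0 < idet a b"
  shows "u = 0"
proof -
  have "of_int (idet a b) * fst u = (u \<bullet> pt a) * snd (pt b) - (u \<bullet> pt b) * snd (pt a)"
    "of_int (idet a b) * snd u = (u \<bullet> pt b) * fst (pt a) - (u \<bullet> pt a) * fst (pt b)"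
    by (simp_all add: idet_def pt_def inner_plane algebra_simps)
  then show ?thesis using assms by (simp add: prod_eq_iff)
qed

text \<open>Cramer's relation between three plane vectors. With positive coefficients it forces a
  functional that is nonnegative on all three to vanish on them.\<close>

lemma det_relation:
  "of_int (idet b c) * (u \<bullet> pt a) + of_int (idet c a) * (u \<bullet> pt b) + of_int (idet a b) * (u \<bullet> pt c) = 0"
  by (simp add: idet_def pt_def inner_plane algebra_simps)

lemma triangle_surrounds:
  assumes "0 < idet a b" "0 < idet b c" "0 < idet c a" "0 \<le> u \<bullet> pt a" "0 \<le> u \<bullet> pt b" "0 \<le> u \<bullet> pt c"
  shows "u = 0"
proof -
  have "0 \<le> of_int (idet b c) * (u \<bullet> pt a)" "0 \<le> of_int (idet c a) * (u \<bullet> pt b)"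
    "0 \<le> of_int (idet a b) * (u \<bullet> pt c)"
    using assms by simp_all
  then have "of_int (idet b c) * (u \<bullet> pt a) = 0" "of_int (idet c a) * (u \<bullet> pt b) = 0"
    using det_relation[of b c u a] by linarith+
  then show ?thesis using assms by (intro cramer[of u a b]) simp_all
qed

text \<open>The sign of the diagonal determinant \<open>idet a c\<close> tells which of the
  triangles \<open>a b c\<close> and \<open>a c d\<close> surrounds the origin. If it is 0, then
  \<open>a\<close> and \<open>c\<close> are opposite, the functional vanishes on them, and the
  relation for \<open>d\<close>, \<open>a\<close>, \<open>b\<close> finishes.\<close>

lemma quadrilateral_surrounds:
  assumes d: "0 < idet a b" "0 < idet b c" "c = d \<or> 0 < idet c d" "0 < idet d a"
    and u: "0 \<le> u \<bullet> pt a" "0 \<le> u \<bullet> pt b" "0 \<le> u \<bullet> pt c" "0 \<le> u \<bullet> pt d"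
  shows "u = 0"
proof -
  have anti: "idet c a = - idet a c" by (simp add: idet_def)
  consider "c = d" | "idet a c < 0" | "idet a c > 0" "0 < idet c d" | "idet a c = 0" "0 < idet c d"
    using d(3) by linarith
  then show ?thesis
  proof cases
    case 1 then show ?thesis using triangle_surrounds d u by blast
  next
    case 2 then show ?thesis using triangle_surrounds[of a b c] d u anti by simp
  next
    case 3 then show ?thesis using triangle_surrounds[of a c d] d u by blast
  next
    case 4
    have "of_int (idet b c) * (u \<bullet> pt a) + of_int (idet a b) * (u \<bullet> pt c) = 0"
      using det_relation[of b c u a] 4 anti by simp
    moreover have "0 \<le> of_int (idet b c) * (u \<bullet> pt a)" "0 \<le> of_int (idet a b) * (u \<bullet> pt c)"
      using d u by simp_all
    ultimately have "of_int (idet b c) * (u \<bullet> pt a) = 0" by linarith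
    then have ua: "u \<bullet> pt a = 0" using d by simp
    have "of_int (idet d a) * (u \<bullet> pt b) + of_int (idet a b) * (u \<bullet> pt d) = 0"
      using det_relation[of d a u b] ua by (simp add: add.commute)
    moreover have "0 \<le> of_int (idet d a) * (u \<bullet> pt b)" "0 \<le> of_int (idet a b) * (u \<bullet> pt d)"
      using d u by simp_all
    ultimately have "of_int (idet d a) * (u \<bullet> pt b) = 0" by linarith
    then have "u \<bullet> pt b = 0" using d by simp
    then show ?thesis using cramer ua d(1) by blast
  qed
qed

lemma fano_check:
  assumes "fano_check V"
  shows "fano_polygon (ipoly V)"
  unfolding ipoly_def
proof (rule fano_polygonI)
  obtain a b c d where abc: "a \<in> set V" "b \<in> set V" "c \<in> set V" "d \<in> set V"
    "0 < idet a b" "0 < idet b c" "c = d \<or> 0 < idet c d" "0 < idet d a"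
    using assms unfolding fano_check_def by blast
  show "finite (pt ` set V)" "pt ` set V \<noteq> {}" using abc by auto
  show "primitive x" if "x \<in> pt ` set V" for x
    using that assms primitive_pt unfolding fano_check_def by blast
  fix u :: plane assume u: "u \<noteq> 0"
  have "\<exists>p\<in>set V. u \<bullet> pt p < 0"
    using quadrilateral_surrounds[OF abc(5-8), of u] abc(1-4) u by (meson not_less)
  then obtain p where p: "p \<in> set V" "u \<bullet> pt p < 0" by blast
  have "compact (convex hull (pt ` set V))" by (simp add: compact_convex_hull finite_imp_compact)
  then have "- hgt (convex hull (pt ` set V)) u \<le> u \<bullet> pt p"
    using p(1) by (intro hgt_le hull_inc imageI)
  then show "0 < hgt (convex hull (pt ` set V)) u" using p(2) by simp
qed

lemma verts_ipoly: "verts (ipoly V) \<subseteq> pt ` set V"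
  unfolding verts_def ipoly_def using extreme_point_of_convex_hull by blast

lemma mutation_check:
  assumes P: "fano_polygon (ipoly V)" and c: "mutation_check V W w v j"
  shows "ipoly V \<sim>\<^sub>m ipoly W"
proof -
  have pw: "primitive (pt w)" "primitive (pt v)" and wv: "pt w \<bullet> pt v = 0" and j: "j > 0"
    using c primitive_pt by (auto simp: mutation_check_def pt_inner)
  have A: "if idot w q < 0 then mem_hull V q \<and> mem_hull V (iadd q (- (idot w q * int j)) v)
        else mem_hull V q \<or> mem_hull V (iadd q (- (idot w q * int j)) v)" if "q \<in> set W" for q
    using c that unfolding mutation_check_def by blast
  have B: "if idot w p < 0 then mem_hull W p \<or> mem_hull W (iadd p (idot w p * int j) v)
        else mem_hull W p \<and> mem_hull W (iadd p (idot w p * int j) v)" if "p \<in> set V" for p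
    using c that unfolding mutation_check_def by blast
  obtain q where q: "q \<in> set W" "idot w q < 0" "\<And>p. p \<in> set V \<Longrightarrow> idot w q \<le> idot w p"
    using c unfolding mutation_check_def by blast
  have sh: "pt p - (pt w \<bullet> pt p) *\<^sub>R real j *\<^sub>R pt v = pt (iadd p (- (idot w p * int j)) v)"
    "pt p + (pt w \<bullet> pt p) *\<^sub>R real j *\<^sub>R pt v = pt (iadd p (idot w p * int j) v)" for p
    by (simp_all add: pt_iadd pt_inner)
  have neg: "pt w \<bullet> pt p < 0 \<longleftrightarrow> idot w p < 0" for p by (simp add: pt_inner)
  note mem = mem_hull_ipoly
  have "ipoly V \<sim>\<^sub>m convex hull (pt ` set W)"
  proof (rule mut_equiv_points[OF P pw wv j])
    show "finite (pt ` set W)" "pt ` set W \<noteq> {}" using q(1) by auto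
    show "x \<in> ipoly V \<and> x - (pt w \<bullet> x) *\<^sub>R real j *\<^sub>R pt v \<in> ipoly V"
      if x: "x \<in> pt ` set W" "pt w \<bullet> x < 0" for x
    proof -
      obtain p where p: "x = pt p" "p \<in> set W" using x by blast
      then have "idot w p < 0" using x(2) neg[of p] by simp
      then show ?thesis unfolding p(1) sh using A[OF p(2)] mem[of V] by (auto split: if_splits)
    qed
    show "x \<in> ipoly V \<or> x - (pt w \<bullet> x) *\<^sub>R real j *\<^sub>R pt v \<in> ipoly V"
      if x: "x \<in> pt ` set W" "0 \<le> pt w \<bullet> x" for x
    proof -
      obtain p where p: "x = pt p" "p \<in> set W" using x by blast
      then have "\<not> idot w p < 0" using x(2) neg[of p] by simp
      then have "mem_hull V p \<or> mem_hull V (iadd p (- (idot w p * int j)) v)" using A[OF p(2)] by simp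
      then show ?thesis unfolding p(1) sh using mem[of V] by blast
    qed
    show "x \<in> convex hull (pt ` set W) \<and> x + (pt w \<bullet> x) *\<^sub>R real j *\<^sub>R pt v \<in> convex hull (pt ` set W)"
      if x: "x \<in> verts (ipoly V)" "0 \<le> pt w \<bullet> x" for x
    proof -
      obtain p where p: "x = pt p" "p \<in> set V" using x verts_ipoly by blast
      then have "\<not> idot w p < 0" using x(2) neg[of p] by simp
      then show ?thesis unfolding p(1) sh ipoly_def[symmetric] using B[OF p(2)] mem[of W] by (auto split: if_splits)
    qed
    show "x \<in> convex hull (pt ` set W) \<or> x + (pt w \<bullet> x) *\<^sub>R real j *\<^sub>R pt v \<in> convex hull (pt ` set W)"
      if x: "x \<in> verts (ipoly V)" "pt w \<bullet> x < 0" for x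
    proof -
      obtain p where p: "x = pt p" "p \<in> set V" using x verts_ipoly by blast
      then have "idot w p < 0" using x(2) neg[of p] by simp
      then have "mem_hull W p \<or> mem_hull W (iadd p (idot w p * int j) v)" using B[OF p(2)] by simp
      then show ?thesis unfolding p(1) sh ipoly_def[symmetric] using mem[of W] by blast
    qed
    show "pt q \<in> pt ` set W" "pt w \<bullet> pt q < 0" using q neg by auto
    show "pt w \<bullet> pt q \<le> pt w \<bullet> x" if x: "x \<in> verts (ipoly V)" for x
    proof -
      obtain p where p: "x = pt p" "p \<in> set V" using x verts_ipoly by blast
      then show ?thesis using q(3) by (simp add: pt_inner)
    qed
  qed
  then show ?thesis by (simp add: ipoly_def)
qed

lemma ipoly_map:
  assumes P: "fano_polygon (ipoly V)" and det: "\<bar>idet r1 r2\<bar> = 1"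
  shows "ipoly V \<sim>\<^sub>m ipoly (map (imap r1 r2) V)"
proof -
  let ?f = "imat (fst r1) (snd r1) (fst r2) (snd r2)"
  have u: "unimodular ?f" using det by (intro unimodular_imat) (simp add: idet_def)
  have "?f (pt p) = pt (imap r1 r2 p)" for p
    by (simp add: imat_def pt_def imap_def idot_def)
  then have "?f ` ipoly V = ipoly (map (imap r1 r2) V)"
    unfolding ipoly_def convex_hull_linear_image[OF unimodular.lin[OF u]]
    by (simp add: image_image)
  then show ?thesis using mut_equiv_unimodular[OF u P] by simp
qed

lemma link:
  assumes "fano_polygon (ipoly V)" "link_check V W w v j r1 r2"
  shows "ipoly V \<sim>\<^sub>m ipoly W"
proof -
  have c: "\<bar>idet r1 r2\<bar> = 1" "fano_check W" "mutation_check V (map (imap r1 r2) W) w v j"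
    using assms(2) by (auto simp: link_check_def)
  show ?thesis
    using mutation_check[OF assms(1) c(3)] ipoly_map[OF fano_check[OF c(2)] c(1)]
      mut_equiv_sym mut_equiv_trans by blast
qed

lemma ipoly_cong: "set V = set W \<Longrightarrow> ipoly V = ipoly W"
  by (simp add: ipoly_def)

text \<open>All points lie to the left of the line from \<open>p\<close> to \<open>q\<close>, and
  those on it lie between \<open>p\<close> and \<open>q\<close>; the pair thus consists of the ends
  of the edge even if the list contains further points of it.\<close>

definition is_edge :: "(int \<times> int) list \<Rightarrow> int \<times> int \<Rightarrow> int \<times> int \<Rightarrow> bool" where
  "is_edge V p q \<longleftrightarrow> p \<noteq> q \<and> (\<forall>x\<in>set V. 0 \<le> idet (isub q p) (isub x p) \<and>
     (idet (isub q p) (isub x p) = 0 \<longrightarrow> idot (isub x p) (isub x q) \<le> 0))"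

definition edge_len :: "int \<times> int \<Rightarrow> int \<times> int \<Rightarrow> int" where
  "edge_len p q = gcd (fst q - fst p) (snd q - snd p)"

definition edge_normal :: "int \<times> int \<Rightarrow> int \<times> int \<Rightarrow> int \<times> int" where
  "edge_normal p q = (- (snd q - snd p) div edge_len p q, (fst q - fst p) div edge_len p q)"

definition edge_pairs :: "(int \<times> int) list \<Rightarrow> ((int \<times> int) \<times> (int \<times> int)) list" where
  "edge_pairs V = filter (\<lambda>(p, q). is_edge V p q) (List.product V V)"

lemma edge_len_pos: "p \<noteq> q \<Longrightarrow> edge_len p q > 0"
  by (auto simp: edge_len_def prod_eq_iff)

lemma edge_normal:
  assumes "p \<noteq> q"
  shows "primitive (pt (edge_normal p q))"
    and "pt q = pt p + of_int (edge_len p q) *\<^sub>R quarter_turn (pt (edge_normal p q))"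
    and "edge_len p q * idot (edge_normal p q) (isub x p) = idet (isub q p) (isub x p)"
proof -
  let ?g = "edge_len p q" and ?n = "edge_normal p q"
  have g: "?g > 0" using assms by (rule edge_len_pos)
  have d1: "?g dvd fst q - fst p" and d2: "?g dvd snd q - snd p" by (simp_all add: edge_len_def)
  obtain k where k: "snd q - snd p = ?g * k" using d2 by (rule dvdE)
  then have m: "- (snd q - snd p) = ?g * (- k)" by simp
  have fn: "fst ?n = - k"
    unfolding edge_normal_def fst_conv m using g by (intro nonzero_mult_div_cancel_left) simp
  have kd: "(snd q - snd p) div ?g = k" using k g by simp
  have n: "fst q - fst p = ?g * snd ?n" "snd q - snd p = - (?g * fst ?n)"
    using d1 k fn by (simp_all add: edge_normal_def)
  have "coprime ((fst q - fst p) div ?g) ((snd q - snd p) div ?g)"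
    unfolding edge_len_def using g by (intro div_gcd_coprime) (auto simp: edge_len_def)
  then have "gcd (fst ?n) (snd ?n) = 1"
    unfolding kd fn by (simp add: edge_normal_def gcd.commute coprime_iff_gcd_eq_1)
  then show "primitive (pt ?n)" by (rule primitive_pt)
  have "fst q = fst p + ?g * snd ?n" "snd q = snd p - ?g * fst ?n" using n by linarith+
  then have "pt q = (of_int (fst p + ?g * snd ?n), of_int (snd p - ?g * fst ?n))"
    unfolding pt_def by simp
  then show "pt q = pt p + of_int ?g *\<^sub>R quarter_turn (pt ?n)"
    by (simp add: quarter_turn_def pt_def)
  show "?g * idot ?n (isub x p) = idet (isub q p) (isub x p)"
    by (simp add: idot_def idet_def isub_def n algebra_simps)
qed

text \<open>The determinant of \<open>p\<close> and \<open>q\<close>, twice the area of their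
  triangle with the origin, is lattice length times height; dividing by the length gives the
  height.\<close>

lemma is_edge_face:
  assumes P: "fano_polygon (ipoly V)" and pq: "p \<in> set V" "q \<in> set V" "is_edge V p q"
  defines "u \<equiv> pt (edge_normal p q)"
  shows "u \<in> normals (ipoly V)" and "int (wid (ipoly V) u) = edge_len p q"
    and "int (nhgt (ipoly V) u) = idet p q div edge_len p q"
    and "\<And>x. x \<in> ipoly V \<Longrightarrow> u \<bullet> pt p \<le> u \<bullet> x"
    and "\<And>x. x \<in> set V \<Longrightarrow> u \<bullet> pt x = u \<bullet> pt p \<Longrightarrow> quarter_turn u \<bullet> pt p \<le> quarter_turn u \<bullet> pt x"
proof -
  have ne: "p \<noteq> q" using pq(3) by (simp add: is_edge_def)
  let ?g = "edge_len p q" and ?n = "edge_normal p q"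
  have g: "?g > 0" using ne by (rule edge_len_pos)
  have pu: "primitive u" unfolding u_def by (rule edge_normal(1)[OF ne])
  have qp: "pt q = pt p + of_int ?g *\<^sub>R quarter_turn u" unfolding u_def by (rule edge_normal(2)[OF ne])
  have JJ: "quarter_turn u \<bullet> quarter_turn u > 0" using pu primitive_nonzero[of "quarter_turn u"] by simp
  have sub: "pt (isub x p) = pt x - pt p" for x by (simp add: pt_def isub_def)
  have diff: "u \<bullet> (pt x - pt p) = of_int (idot ?n (isub x p))" for x
    unfolding u_def by (simp add: pt_inner flip: sub)
  have geV: "u \<bullet> pt p \<le> u \<bullet> pt x" if "x \<in> set V" for x
  proof -
    have "0 \<le> ?g * idot ?n (isub x p)"
      unfolding edge_normal(3)[OF ne] using that pq(3) by (simp add: is_edge_def)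
    then have "0 \<le> idot ?n (isub x p)" using g by (simp add: zero_le_mult_iff)
    then have "0 \<le> u \<bullet> (pt x - pt p)" using diff[of x] by simp
    then show ?thesis by (simp add: inner_diff_right)
  qed
  show ge: "u \<bullet> pt p \<le> u \<bullet> x" if "x \<in> ipoly V" for x
    using that unfolding ipoly_def by (rule convex_hull_inner_ge) (use geV in blast)
  have lineV: "0 \<le> t \<and> t \<le> of_int ?g" if x: "x \<in> set V" "pt x = pt p + t *\<^sub>R quarter_turn u" for x t
  proof -
    have "u \<bullet> (pt x - pt p) = 0" by (simp add: x(2))
    then have "idot ?n (isub x p) = 0" using diff[of x] by simp
    then have "idet (isub q p) (isub x p) = 0" using edge_normal(3)[OF ne, of x] by simp
    then have "idot (isub x p) (isub x q) \<le> 0" using pq(3) x(1) by (simp add: is_edge_def)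
    then have "pt (isub x p) \<bullet> pt (isub x q) \<le> 0" by (simp add: pt_inner)
    moreover have "pt (isub x q) = pt x - pt q" by (simp add: pt_def isub_def)
    then have "pt (isub x q) = (t - of_int ?g) *\<^sub>R quarter_turn u" by (simp add: x(2) qp algebra_simps)
    moreover have "pt (isub x p) = t *\<^sub>R quarter_turn u" by (simp add: sub x(2))
    ultimately have "t * (t - of_int ?g) * (quarter_turn u \<bullet> quarter_turn u) \<le> 0"
      by (simp add: ac_simps)
    then have "t * (t - of_int ?g) \<le> 0" using JJ by (simp add: mult_le_0_iff)
    then show ?thesis using g by (auto simp: mult_le_0_iff)
  qed
  have parV: "\<exists>t. pt x = pt p + t *\<^sub>R quarter_turn u" if "u \<bullet> pt x = u \<bullet> pt p" for x
  proof -
    have "u \<bullet> (pt x - pt p) = 0" using that by (simp add: inner_diff_right)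
    then obtain c where "pt x - pt p = c *\<^sub>R quarter_turn u"
      using orthogonal_multiple primitive_nonzero[OF pu] by metis
    then have "pt x = pt p + c *\<^sub>R quarter_turn u" by (simp add: algebra_simps)
    then show ?thesis ..
  qed
  show startV: "quarter_turn u \<bullet> pt p \<le> quarter_turn u \<bullet> pt x"
    if x: "x \<in> set V" "u \<bullet> pt x = u \<bullet> pt p" for x
  proof -
    obtain t where t: "pt x = pt p + t *\<^sub>R quarter_turn u" using parV[OF x(2)] by blast
    then have "0 \<le> t" using lineV[OF x(1) t] by blast
    then show ?thesis using JJ by (simp add: t inner_add_right)
  qed
  have inP: "pt x \<in> ipoly V" if "x \<in> set V" for x
    using that unfolding ipoly_def by (intro hull_inc imageI)
  have faceP: "pt p \<in> face (ipoly V) u" using inP[OF pq(1)] ge by (simp add: face_def)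
  have faceQ: "pt q \<in> face (ipoly V) u" using inP[OF pq(2)] ge by (simp add: face_def qp inner_add_right)
  have "pt p \<noteq> pt q" using ne by (simp add: pt_def prod_eq_iff)
  then show un: "u \<in> normals (ipoly V)" using normalsI[OF P pu faceP faceQ] by blast
  have hg: "hgt (ipoly V) u = - (u \<bullet> pt p)" using inP[OF pq(1)] ge by (intro hgt_eqI[of "pt p"]) auto
  obtain a where a: "a \<in> verts (ipoly V)" "a + real (wid (ipoly V) u) *\<^sub>R quarter_turn u \<in> verts (ipoly V)"
    "u \<bullet> a = - hgt (ipoly V) u"
    by (rule fano_face_ends[OF P pu])
  obtain x where x: "x \<in> set V" "a = pt x" using a(1) verts_ipoly by blast
  obtain y where y: "y \<in> set V" "a + real (wid (ipoly V) u) *\<^sub>R quarter_turn u = pt y"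
    using a(2) verts_ipoly by blast
  obtain t where t: "pt x = pt p + t *\<^sub>R quarter_turn u" using parV[of x] a(3) hg x(2) by auto
  have "0 \<le> t" using lineV[OF x(1) t] by blast
  have ty: "pt y = pt p + (t + real (wid (ipoly V) u)) *\<^sub>R quarter_turn u"
    using y(2) x(2) t by (simp add: algebra_simps)
  then have "t + real (wid (ipoly V) u) \<le> of_int ?g" using lineV[OF y(1)] by blast
  then have "real (wid (ipoly V) u) \<le> of_int ?g" using \<open>0 \<le> t\<close> by linarith
  moreover have "of_int ?g \<le> real (wid (ipoly V) u)"
    using face_length[OF P pu, of "quarter_turn u" "pt p" "of_int ?g"] pu faceP faceQ qp by simp
  ultimately show "int (wid (ipoly V) u) = ?g" by linarith
  have "?g * idot ?n (isub (0, 0) p) = idet (isub q p) (isub (0, 0) p)" by (rule edge_normal(3)[OF ne])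
  moreover have "idot ?n (isub (0, 0) p) = - idot ?n p" "idet (isub q p) (isub (0, 0) p) = idet p q"
    by (simp_all add: idot_def idet_def isub_def algebra_simps)
  ultimately have "idet p q = ?g * (- idot ?n p)" by simp
  then have "idet p q div ?g = - idot ?n p" using g by (metis less_irrefl nonzero_mult_div_cancel_left)
  moreover have "real (nhgt (ipoly V) u) = of_int (- idot ?n p)"
    using real_nhgt[OF P pu] hg by (simp add: u_def pt_inner)
  then have "int (nhgt (ipoly V) u) = - idot ?n p" by linarith
  ultimately show "int (nhgt (ipoly V) u) = idet p q div ?g" by simp
qed

lemma normals_edge:
  assumes P: "fano_polygon (ipoly V)" and u: "u \<in> normals (ipoly V)"
  obtains p q where "p \<in> set V" "q \<in> set V" "is_edge V p q" "u = pt (edge_normal p q)"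
proof -
  have pu: "primitive u" and w: "wid (ipoly V) u > 0" using u normalsD by auto
  obtain a where a: "a \<in> verts (ipoly V)" "a + real (wid (ipoly V) u) *\<^sub>R quarter_turn u \<in> verts (ipoly V)"
    "face (ipoly V) u = {a + t *\<^sub>R quarter_turn u | t. 0 \<le> t \<and> t \<le> real (wid (ipoly V) u)}"
    "u \<bullet> a = - hgt (ipoly V) u"
    by (rule fano_face_ends[OF P pu])
  obtain p where p: "p \<in> set V" "a = pt p" using a(1) verts_ipoly by blast
  obtain q where q: "q \<in> set V" "a + real (wid (ipoly V) u) *\<^sub>R quarter_turn u = pt q"
    using a(2) verts_ipoly by blast
  have J0: "quarter_turn u \<noteq> 0" using pu by (simp add: primitive_nonzero)
  have ne: "p \<noteq> q" using p(2) q(2) w J0 by auto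
  let ?g = "edge_len p q" and ?n = "edge_normal p q"
  have g: "?g > 0" using ne by (rule edge_len_pos)
  have eq: "of_int ?g *\<^sub>R quarter_turn (pt ?n) = real (wid (ipoly V) u) *\<^sub>R quarter_turn u"
    using edge_normal(2)[OF ne] q(2) p(2) by (metis add_left_cancel)
  have "u \<bullet> (of_int ?g *\<^sub>R quarter_turn (pt ?n)) = 0" unfolding eq by simp
  then have "u \<bullet> quarter_turn (pt ?n) = 0" using g by simp
  then have "u = pt ?n \<or> u = - pt ?n" using primitive_parallel pu edge_normal(1)[OF ne] by blast
  moreover have "u \<noteq> - pt ?n"
  proof
    assume "u = - pt ?n"
    then have "quarter_turn (pt ?n) = - quarter_turn u" by (simp add: quarter_turn_linear)
    then have "real (wid (ipoly V) u) *\<^sub>R quarter_turn u = of_int ?g *\<^sub>R (- quarter_turn u)"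
      using eq by simp
    then have "(of_int ?g + real (wid (ipoly V) u)) *\<^sub>R quarter_turn u = 0"
      unfolding scaleR_add_left by simp
    then show False using J0 g w by simp
  qed
  ultimately have un: "u = pt ?n" by blast
  have inP: "pt x \<in> ipoly V" if "x \<in> set V" for x
    using that unfolding ipoly_def by (intro hull_inc imageI)
  have "is_edge V p q"
    unfolding is_edge_def
  proof (intro conjI ballI impI)
    show "p \<noteq> q" by fact
    fix x assume x: "x \<in> set V"
    have sub: "pt (isub x y) = pt x - pt y" for x y by (simp add: pt_def isub_def)
    have diff: "u \<bullet> (pt x - pt p) = of_int (idot ?n (isub x p))" for x
      unfolding un by (simp add: pt_inner flip: sub)
    have "u \<bullet> pt p \<le> u \<bullet> pt x"
      using hgt_le[OF fano_compact[OF P] inP[OF x], of u] a(4) p(2) by simp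
    then have "0 \<le> idot ?n (isub x p)" using diff[of x] by (simp add: inner_diff_right)
    then show "0 \<le> idet (isub q p) (isub x p)" using edge_normal(3)[OF ne, of x] g
      by (metis less_imp_le zero_le_mult_iff)
    assume "idet (isub q p) (isub x p) = 0"
    then have "idot ?n (isub x p) = 0" using edge_normal(3)[OF ne, of x] g by simp
    then have "u \<bullet> pt x = u \<bullet> pt p" using diff[of x] by (simp add: inner_diff_right)
    then have "pt x \<in> face (ipoly V) u"
      using inP[OF x] a(4) p(2) by (simp add: face_eq[OF fano_compact[OF P]])
    then obtain t where t: "pt x = a + t *\<^sub>R quarter_turn u" "0 \<le> t" "t \<le> real (wid (ipoly V) u)"
      using a(3) by blast
    have "pt (isub x p) = t *\<^sub>R quarter_turn u" by (simp add: sub t(1) p(2))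
    moreover have "pt (isub x q) = (t - real (wid (ipoly V) u)) *\<^sub>R quarter_turn u"
      by (simp add: sub t(1) q(2)[symmetric] algebra_simps)
    ultimately have "pt (isub x p) \<bullet> pt (isub x q)
      = t * (t - real (wid (ipoly V) u)) * (quarter_turn u \<bullet> quarter_turn u)" by simp
    also have "\<dots> \<le> 0" using t(2,3) by (intro mult_nonpos_nonneg mult_nonneg_nonpos) auto
    finally show "idot (isub x p) (isub x q) \<le> 0" by (simp add: pt_inner)
  qed
  then show thesis using that p(1) q(1) un by blast
qed

text \<open>The normal determines the pair: the start is the extremal point of the face along
  \<open>quarter_turn\<close>, and the length then gives the end.\<close>

lemma bij_edge_pairs:
  assumes P: "fano_polygon (ipoly V)"
  shows "bij_betw (\<lambda>(p, q). pt (edge_normal p q)) (set (edge_pairs V)) (normals (ipoly V))"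
  unfolding bij_betw_def
proof
  have E: "set (edge_pairs V) = {(p, q). p \<in> set V \<and> q \<in> set V \<and> is_edge V p q}"
    by (auto simp: edge_pairs_def)
  show "inj_on (\<lambda>(p, q). pt (edge_normal p q)) (set (edge_pairs V))"
  proof (rule inj_onI)
    fix e e' assume e: "e \<in> set (edge_pairs V)" "e' \<in> set (edge_pairs V)"
      "(case e of (p, q) \<Rightarrow> pt (edge_normal p q)) = (case e' of (p, q) \<Rightarrow> pt (edge_normal p q))"
    obtain p q p' q' where pq: "e = (p, q)" "e' = (p', q')" by (metis surj_pair)
    have in': "p \<in> set V" "q \<in> set V" "is_edge V p q" "p' \<in> set V" "q' \<in> set V" "is_edge V p' q'"
      using e(1,2) by (auto simp: E pq)
    let ?u = "pt (edge_normal p q)"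
    have u': "pt (edge_normal p' q') = ?u" using e(3) by (simp add: pq)
    note f = is_edge_face[OF P in'(1-3)] and f' = is_edge_face[OF P in'(4-6), unfolded u']
    have inP: "pt x \<in> ipoly V" if "x \<in> set V" for x
      using that unfolding ipoly_def by (intro hull_inc imageI)
    have up: "?u \<bullet> pt p = ?u \<bullet> pt p'" using f(4)[OF inP[OF in'(4)]] f'(4)[OF inP[OF in'(1)]] by simp
    have "quarter_turn ?u \<bullet> pt p = quarter_turn ?u \<bullet> pt p'"
      using f(5)[OF in'(4)] f'(5)[OF in'(1)] up by simp
    have pu: "primitive ?u" using f(1) normalsD by blast
    have "?u \<bullet> (pt p - pt p') = 0" using up by (simp add: inner_diff_right)
    then obtain c where c: "pt p - pt p' = c *\<^sub>R quarter_turn ?u"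
      using orthogonal_multiple primitive_nonzero[OF pu] by metis
    have "quarter_turn ?u \<bullet> (pt p - pt p') = 0"
      using \<open>quarter_turn ?u \<bullet> pt p = quarter_turn ?u \<bullet> pt p'\<close> by (simp add: inner_diff_right)
    then have "c = 0" using pu primitive_nonzero[of "quarter_turn ?u"] by (simp add: c)
    then have "pt p = pt p'" using c by simp
    then have pp: "p = p'" by (simp add: pt_def prod_eq_iff)
    have gg: "edge_len p q = edge_len p' q'" using f(2) f'(2) by simp
    have "pt q = pt q'"
      using edge_normal(2)[of p q] edge_normal(2)[of p' q'] in' gg pp u' by (simp add: is_edge_def)
    then have "q = q'" by (simp add: pt_def prod_eq_iff)
    then show "e = e'" using pp pq by simp
  qed
  show "(\<lambda>(p, q). pt (edge_normal p q)) ` set (edge_pairs V) = normals (ipoly V)"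
  proof (intro set_eqI iffI)
    fix u assume "u \<in> (\<lambda>(p, q). pt (edge_normal p q)) ` set (edge_pairs V)"
    then show "u \<in> normals (ipoly V)" using is_edge_face(1)[OF P] by (auto simp: E)
  next
    fix u assume "u \<in> normals (ipoly V)"
    then obtain p q where "p \<in> set V" "q \<in> set V" "is_edge V p q" "u = pt (edge_normal p q)"
      by (rule normals_edge[OF P])
    then show "u \<in> (\<lambda>(p, q). pt (edge_normal p q)) ` set (edge_pairs V)"
      unfolding E by (intro image_eqI[of _ _ "(p, q)"]) auto
  qed
qed

text \<open>Distinctness of the list makes the edge pairs distinct, so that the list sum counts
  every edge once.\<close>

definition euler_check :: "(int \<times> int) list \<Rightarrow> nat \<Rightarrow> bool" where
  "euler_check V n \<longleftrightarrow> distinct V \<and> fano_check V \<and>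
     (\<forall>(p, q)\<in>set (edge_pairs V). (idet p q div edge_len p q) dvd edge_len p q) \<and>
     sum_list (map (\<lambda>(p, q). edge_len p q div (idet p q div edge_len p q)) (edge_pairs V)) = int n"

lemma euler_check:
  assumes "euler_check V n"
  shows "fano_polygon (ipoly V)" "only_T_singularities (ipoly V)" "smoothing_euler_number (ipoly V) = n"
proof -
  show P: "fano_polygon (ipoly V)" using assms fano_check by (simp add: euler_check_def)
  have E: "set (edge_pairs V) = {(p, q). p \<in> set V \<and> q \<in> set V \<and> is_edge V p q}"
    by (auto simp: edge_pairs_def)
  let ?n = "\<lambda>(p, q). pt (edge_normal p q)"
  have data: "int (wid (ipoly V) (?n e)) = (case e of (p, q) \<Rightarrow> edge_len p q)"
    "int (nhgt (ipoly V) (?n e)) = (case e of (p, q) \<Rightarrow> idet p q div edge_len p q)"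
    if "e \<in> set (edge_pairs V)" for e
    using that is_edge_face(2,3)[OF P] by (auto simp: E)
  show "only_T_singularities (ipoly V)"
    unfolding only_T_iff[OF P]
  proof
    fix u assume "u \<in> normals (ipoly V)"
    then obtain e where e: "e \<in> set (edge_pairs V)" "u = ?n e"
      using bij_betw_imp_surj_on[OF bij_edge_pairs[OF P]] by blast
    have "int (nhgt (ipoly V) u) dvd int (wid (ipoly V) u)"
      using assms e data[OF e(1)] unfolding euler_check_def by fastforce
    then show "nhgt (ipoly V) u dvd wid (ipoly V) u" by simp
  qed
  have dist: "distinct (edge_pairs V)"
    using assms by (simp add: edge_pairs_def distinct_product euler_check_def)
  have "int (smoothing_euler_number (ipoly V))
      = (\<Sum>u\<in>normals (ipoly V). int (wid (ipoly V) u div nhgt (ipoly V) u))"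
    by (simp add: smoothing_euler_number_eq[OF P] normal_sum_def)
  also have "\<dots> = (\<Sum>e\<in>set (edge_pairs V). int (wid (ipoly V) (?n e) div nhgt (ipoly V) (?n e)))"
    by (rule sum.reindex_bij_betw[OF bij_edge_pairs[OF P], symmetric])
  also have "\<dots> = (\<Sum>e\<in>set (edge_pairs V). (case e of (p, q) \<Rightarrow> edge_len p q div (idet p q div edge_len p q)))"
    by (rule sum.cong) (use data in \<open>auto simp: zdiv_int\<close>)
  also have "\<dots> = int n"
    using assms dist by (simp add: euler_check_def sum_list_distinct_conv_sum_set)
  finally show "smoothing_euler_number (ipoly V) = n" by simp
qed

definition parity_check :: "(int \<times> int) list \<Rightarrow> bool" where
  "parity_check V \<longleftrightarrow> (\<forall>(p, q)\<in>set (edge_pairs V). \<forall>(p', q')\<in>set (edge_pairs V).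
     even (fst (edge_normal p q) - fst (edge_normal p' q')) \<and>
     even (snd (edge_normal p q) - snd (edge_normal p' q')))"

text \<open>With T-singularities every edge is at least as long as high, so the condition on lengths
  in \<open>mod2_constant\<close> holds for all normals.\<close>

lemma parity_check:
  assumes P: "fano_polygon (ipoly V)" "only_T_singularities (ipoly V)"
  shows "mod2_constant (ipoly V) \<longleftrightarrow> parity_check V"
proof -
  let ?n = "\<lambda>(p, q). pt (edge_normal p q)"
  have long: "nhgt (ipoly V) u \<le> wid (ipoly V) u" if "u \<in> normals (ipoly V)" for u
    using that P only_T_iff normalsD(2) by (metis dvd_imp_le)
  have par: "(\<exists>t\<in>lattice_pts. pt a - pt b = 2 *\<^sub>R t) \<longleftrightarrow>
      even (fst a - fst b) \<and> even (snd a - snd b)" for a b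
  proof
    assume "\<exists>t\<in>lattice_pts. pt a - pt b = 2 *\<^sub>R t"
    then obtain i j :: int where "pt a - pt b = 2 *\<^sub>R (of_int i, of_int j)" by (metis lattice_ptsE)
    then have "real_of_int (fst a - fst b) = of_int (2 * i)" "real_of_int (snd a - snd b) = of_int (2 * j)"
      by (simp_all add: pt_def)
    then have "fst a - fst b = 2 * i" "snd a - snd b = 2 * j" by (simp_all only: of_int_eq_iff)
    then show "even (fst a - fst b) \<and> even (snd a - snd b)" by simp
  next
    assume "even (fst a - fst b) \<and> even (snd a - snd b)"
    then obtain i j where ij: "fst a - fst b = 2 * i" "snd a - snd b = 2 * j"
      unfolding dvd_def by blast
    then have "real_of_int (fst a - fst b) = of_int (2 * i)" "real_of_int (snd a - snd b) = of_int (2 * j)"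
      by (simp_all only:)
    then have "pt a - pt b = 2 *\<^sub>R (of_int i, of_int j)" by (simp add: pt_def)
    then show "\<exists>t\<in>lattice_pts. pt a - pt b = 2 *\<^sub>R t" by (metis lattice_pts_of_int)
  qed
  have N: "normals (ipoly V) = ?n ` set (edge_pairs V)"
    using bij_betw_imp_surj_on[OF bij_edge_pairs[OF P(1)]] by simp
  have "mod2_constant (ipoly V) \<longleftrightarrow> (\<forall>u\<in>normals (ipoly V). \<forall>u'\<in>normals (ipoly V).
      \<exists>t\<in>lattice_pts. u - u' = 2 *\<^sub>R t)"
    unfolding mod2_constant_def using long by blast
  also have "\<dots> \<longleftrightarrow> (\<forall>e\<in>set (edge_pairs V). \<forall>e'\<in>set (edge_pairs V).
      \<exists>t\<in>lattice_pts. ?n e - ?n e' = 2 *\<^sub>R t)" unfolding N by blast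
  also have "\<dots> \<longleftrightarrow> parity_check V"
    unfolding parity_check_def by (simp add: case_prod_unfold par)
  finally show ?thesis .
qed

section \<open>Polygons in the strip\<close>

text \<open>The possible right-hand boundaries, below the top vertex \<open>(0, 1)\<close>, of a polygon in the strip
  \<open>-1 \<le> y \<le> 1\<close>; they meet the axis \<open>y = 0\<close> at \<open>1/2\<close>, \<open>2\<close> and \<open>1\<close>.  The left-hand boundaries are
  their mirror images.\<close>

datatype side = Half | Two | Split int

fun side_pts :: "side \<Rightarrow> (int \<times> int) list" where
  "side_pts Half = [(1, -1)]"
| "side_pts Two = [(4, -1)]"
| "side_pts (Split b) = [(1, 0), (2 - b, -1)]"

fun side_end :: "side \<Rightarrow> int" where
  "side_end Half = 1"
| "side_end Two = 4"
| "side_end (Split b) = 2 - b"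

text \<open>In \<open>Split b\<close> the edge below the axis has inner normal
  \<open>(- 1, b - 1)\<close>; for \<open>b = 0\<close> it continues the edge above.\<close>

fun side_bound :: "side \<Rightarrow> int \<Rightarrow> int \<Rightarrow> bool" where
  "side_bound Half x y \<longleftrightarrow> 2 * x + y \<le> 1"
| "side_bound Two x y \<longleftrightarrow> x + 2 * y \<le> 2"
| "side_bound (Split b) x y \<longleftrightarrow> x + y \<le> 1 \<and> x - (b - 1) * y \<le> 1"

fun side_ok :: "side \<Rightarrow> bool" where
  "side_ok (Split b) \<longleftrightarrow> 0 \<le> b"
| "side_ok _ \<longleftrightarrow> True"

definition form :: "side \<Rightarrow> side \<Rightarrow> (int \<times> int) list" where
  "form L R = (0, 1) # map (\<lambda>p. (- fst p, snd p)) (side_pts L) @ side_pts R"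

text \<open>The two heights are positive integers, so a bound by 1 is an equality. In this form the
  strip is visibly kept by mutations whose factor is horizontal.\<close>

lemma in_strip_iff:
  assumes P: "fano_polygon P"
  shows "in_strip P \<longleftrightarrow> hgt P (ivec 0 1) = 1 \<and> hgt P (ivec 0 (-1)) = 1"
proof
  assume s: "in_strip P"
  have "hgt P (ivec 0 k) = 1" if k: "\<bar>k\<bar> = 1" for k
  proof -
    have pk: "primitive (ivec 0 k)" using k by (intro primitive_ivec[THEN iffD2]) auto
    obtain q where q: "q \<in> verts P" "ivec 0 k \<bullet> q = - hgt P (ivec 0 k)" by (rule fano_face_ends[OF P pk])
    obtain x y where xy: "q = ivec x y" "ipt P x y" by (rule fano_iptE[OF P q(1)])
    have "\<bar>y\<bar> \<le> 1" using s xy(2) by (auto simp: in_strip_def)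
    moreover have h: "hgt P (ivec 0 k) = of_int (- (k * y))" using q(2) by (simp add: xy inner_plane)
    moreover have "hgt P (ivec 0 k) > 0" using fano_hgt_pos[OF P primitive_nonzero[OF pk]] .
    ultimately have "0 < - (k * y)" by (simp only: of_int_0_less_iff)
    moreover have "\<bar>k * y\<bar> \<le> 1" using k \<open>\<bar>y\<bar> \<le> 1\<close> by (simp add: abs_mult)
    ultimately have "- (k * y) = 1" by linarith
    then show ?thesis using h by (simp only: of_int_1)
  qed
  from this[of 1] this[of "- 1"] show "hgt P (ivec 0 1) = 1 \<and> hgt P (ivec 0 (-1)) = 1" by simp
next
  assume h: "hgt P (ivec 0 1) = 1 \<and> hgt P (ivec 0 (-1)) = 1"
  show "in_strip P"
    unfolding in_strip_def
  proof (intro allI impI)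
    fix x y assume "ipt P x y"
    then have "- hgt P (ivec 0 1) \<le> ivec 0 1 \<bullet> ivec x y" "- hgt P (ivec 0 (-1)) \<le> ivec 0 (-1) \<bullet> ivec x y"
      using hgt_le[OF fano_compact[OF P]] unfolding ipt_def by blast+
    then show "\<bar>y\<bar> \<le> 1" using h by (simp add: inner_plane)
  qed
qed

text \<open>A top edge has height 1, so it can be mutated as many times as its length and shrinks to
  a vertex. Both vertical directions are orthogonal to the factor and keep their heights.\<close>

lemma strip_sharp_top:
  assumes P: "fano_polygon P" and T: "only_T_singularities P" and S: "in_strip P"
  obtains Q where "P \<sim>\<^sub>m Q" "only_T_singularities Q" "in_strip Q" "wid Q (ivec 0 (-1)) = 0"
proof (cases "wid P (ivec 0 (-1)) = 0")
  case True
  then show thesis using that mut_equiv_refl[OF P] T S by blast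
next
  case False
  let ?w = "ivec 0 (-1)" and ?v = "ivec 1 0"
  have pw: "primitive ?w" and pv: "primitive ?v" by (intro primitive_ivec[THEN iffD2], simp)+
  have wv: "?w \<bullet> ?v = 0" by (simp add: inner_plane)
  have wn: "?w \<in> normals P" using pw False by (simp add: normals_def)
  have h: "hgt P (ivec 0 1) = 1" "hgt P ?w = 1" using S in_strip_iff[OF P] by auto
  have nh: "nhgt P ?w = 1" using h(2) by (simp add: nhgt_def)
  obtain Q where Q: "P \<sim>\<^sub>m Q" "same_hgt ?w (real (wid P ?w) *\<^sub>R ?v) P Q" "wid Q ?w + wid P ?w * nhgt P ?w = wid P ?w"
    "only_T_singularities P \<longrightarrow> only_T_singularities Q"
    using multi_mutation[OF P wn pv wv, of "wid P ?w"] nh by auto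
  have FQ: "fano_polygon Q" using Q(1) mut_equivD by blast
  have "hgt Q u = hgt P u" if "u \<bullet> ?v = 0" for u
  proof -
    have "bend ?w (real (wid P ?w) *\<^sub>R ?v) u = u" by (rule bend_nonneg) (simp only: inner_scaleR_right that mult_zero_right order_refl)
    then show ?thesis using Q(2) unfolding same_hgt_def by metis
  qed
  from this[of "ivec 0 1"] this[of ?w] have "in_strip Q"
    using h in_strip_iff[OF FQ] by (simp add: inner_plane)
  then show thesis using that Q T nh by simp
qed

text \<open>The boundary is followed clockwise from the top vertex. An edge with data
  \<open>A\<close>, \<open>m\<close>, \<open>h\<close> descends by \<open>m * h * A\<close>, and
  only a descent of 2 is available in the strip.\<close>

lemma strip_side:
  assumes P: "fano_polygon P" and T: "only_T_singularities P" and S: "in_strip P"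
    and top: "ipt P 0 1" "\<And>x. ipt P x 1 \<Longrightarrow> x = 0"
  shows "\<exists>R. side_ok R \<and> (\<forall>p\<in>set (side_pts R). ipt P (fst p) (snd p)) \<and> (\<forall>x y. ipt P x y \<longrightarrow> side_bound R x y)"
proof -
  have y: "- 1 \<le> y" "y \<le> 1" if "ipt P x y" for x y using S that unfolding in_strip_def by force+
  have cop0: "coprime (0 :: int) (- 1)" by simp
  have min0: "0 * 0 + (- 1) * 1 \<le> 0 * x + (- 1) * y" if "ipt P x y" for x y
    using y(2)[OF that] by simp
  have ext0: "(- 1) * ((- 1) * x - 0 * y) \<le> (- 1) * ((- 1) * 0 - 0 * 1)"
    if "ipt P x y" "0 * x + (- 1) * y = 0 * 0 + (- 1) * 1" for x y
    using top(2)[of x] that by simp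
  obtain a b m h where F: "coprime a b" "h \<ge> 1" "m \<ge> 1" "(- 1) * (0 * b - (- 1) * a) > 0"
    "a * 0 + b * 1 = - h" "\<And>x y. ipt P x y \<Longrightarrow> - h \<le> a * x + b * y"
    "ipt P (0 + (- 1) * (m * h * b)) (1 - (- 1) * (m * h * a))"
    "\<And>x y. ipt P x y \<Longrightarrow> a * x + b * y = - h \<Longrightarrow>
      (- 1) * (b * x - a * y) \<le> (- 1) * (b * 0 - a * 1) + m * h * (a * a + b * b)"
    by (rule adjacent_edge_ipt[OF P T cop0 _ top(1) min0 ext0]) auto
  define A where "A = - a"
  have A: "A \<ge> 1" "a = - A" and b: "b = - h" using F(4,5) by (auto simp: A_def)
  have pt1: "ipt P (m * h * h) (1 - m * h * A)" using F(7) by (simp add: A b)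
  have bd: "A * x + h * y \<le> h" if "ipt P x y" for x y using F(6)[OF that] by (simp add: A b)
  have mhA: "m * h * A \<le> 2" using y(1)[OF pt1] by simp
  have "m * h \<ge> 1" using F(2,3) by (metis mult_mono' mult_1 zero_le_one)
  then have "1 * A \<le> m * h * A" "m * h * 1 \<le> m * h * A"
    using A(1) by (intro mult_right_mono mult_left_mono; simp)+
  moreover have "m \<le> m * h" "h \<le> m * h" using F(2,3) by auto
  ultimately have le2: "A \<le> 2" "m \<le> 2" "h \<le> 2" using mhA by linarith+
  \<comment> \<open>\<open>m * h * A \<le> 2\<close> allows at most one of the three factors to be
    2.\<close>
  then have "A = 1 \<or> A = 2" "m = 1 \<or> m = 2" "h = 1 \<or> h = 2" using A(1) F(2,3) by arith+
  then consider "A = 1" "m = 1" "h = 1" | "A = 1" "m = 2" "h = 1" | "A = 2" "m = 1" "h = 1" | "A = 1" "m = 1" "h = 2"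
    using mhA by fastforce
  then show ?thesis
  proof cases
    case 1
    \<comment> \<open>The edge stops on the axis. The next one starts at \<open>(1, 0)\<close>, so
      the first entry of its normal is \<open>- h2\<close> and it descends by
      \<open>m2 * h2 * h2\<close>, which has to be 1.\<close>
    have p10: "ipt P 1 0" using pt1 1 by simp
    have bd1: "x + y \<le> 1" if "ipt P x y" for x y using bd[OF that] 1 by simp
    have cop1: "coprime (- 1 :: int) (- 1)" by simp
    have min1: "(- 1) * 1 + (- 1) * 0 \<le> (- 1) * x + (- 1) * y" if "ipt P x y" for x y
      using bd1[OF that] by simp
    have ext1: "(- 1) * ((- 1) * x - (- 1) * y) \<le> (- 1) * ((- 1) * 1 - (- 1) * 0)"
      if "ipt P x y" "(- 1) * x + (- 1) * y = (- 1) * 1 + (- 1) * 0" for x y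
      using F(8)[OF that(1)] that(2) 1 by (simp add: A b)
    obtain a2 b2 m2 h2 where G: "coprime a2 b2" "h2 \<ge> 1" "m2 \<ge> 1" "(- 1) * ((- 1) * b2 - (- 1) * a2) > 0"
      "a2 * 1 + b2 * 0 = - h2" "\<And>x y. ipt P x y \<Longrightarrow> - h2 \<le> a2 * x + b2 * y"
      "ipt P (1 + (- 1) * (m2 * h2 * b2)) (0 - (- 1) * (m2 * h2 * a2))"
      by (rule adjacent_edge_ipt[OF P T cop1 _ p10 min1 ext1]) auto
    have a2: "a2 = - h2" using G(5) by simp
    have "m2 * h2 * h2 \<le> 1" using y(1)[OF G(7)] by (simp add: a2)
    moreover have "m2 * h2 \<ge> 1" using G(2,3) by (metis mult_mono' mult_1 zero_le_one)
    then have "1 * h2 \<le> m2 * h2 * h2" "m2 * h2 * 1 \<le> m2 * h2 * h2"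
      using G(2) by (intro mult_right_mono mult_left_mono; simp)+
    moreover have "m2 \<le> m2 * h2" using G(2,3) by auto
    ultimately have h2: "h2 = 1" "m2 = 1" using G(2,3) by linarith+
    have b2: "b2 \<ge> 0" using G(4) a2 h2 by simp
    show ?thesis
    proof (intro exI[of _ "Split (b2 + 1)"] conjI ballI allI impI)
      show "side_ok (Split (b2 + 1))" using b2 by simp
      fix p assume "p \<in> set (side_pts (Split (b2 + 1)))"
      then show "ipt P (fst p) (snd p)" using p10 G(7) h2 a2 by (auto simp: algebra_simps)
    next
      fix x y assume "ipt P x y"
      then show "side_bound (Split (b2 + 1)) x y" using bd1[of x y] G(6)[of x y] h2 a2 by simp
    qed
  next
    case 2
    have p2: "ipt P 2 (- 1)" using pt1 2 by simp
    have "(1 / 2) *\<^sub>R ivec 0 1 + (1 / 2) *\<^sub>R ivec 2 (- 1) \<in> P"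
      using p2 top(1) by (intro convexD[OF fano_convex[OF P]]) (auto simp: ipt_def)
    then have p10: "ipt P 1 0" by (simp add: ipt_def)
    show ?thesis
    proof (intro exI[of _ "Split 0"] conjI ballI allI impI)
      show "side_ok (Split 0)" by simp
      fix p assume "p \<in> set (side_pts (Split 0))"
      then show "ipt P (fst p) (snd p)" using p10 p2 by auto
    next
      fix x y assume "ipt P x y"
      then show "side_bound (Split 0) x y" using bd[of x y] 2 by simp
    qed
  next
    case 3
    show ?thesis
    proof (intro exI[of _ Half] conjI ballI allI impI)
      fix p assume "p \<in> set (side_pts Half)"
      then show "ipt P (fst p) (snd p)" using pt1 3 by auto
    next
      fix x y assume "ipt P x y"
      then show "side_bound Half x y" using bd[of x y] 3 by simp
    qed simp
  next
    case 4
    show ?thesis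
    proof (intro exI[of _ Two] conjI ballI allI impI)
      fix p assume "p \<in> set (side_pts Two)"
      then show "ipt P (fst p) (snd p)" using pt1 4 by auto
    next
      fix x y assume "ipt P x y"
      then show "side_bound Two x y" using bd[of x y] 4 by simp
    qed simp
  qed
qed

text \<open>For \<open>Half\<close> the crossing with the axis is not a lattice point, so the middle
  row is bounded by a real number.\<close>

lemma side_axis:
  obtains c where "c > 0" "(c, 0) \<in> convex hull (pt ` set ((0, 1) # side_pts R))"
    "\<And>x. side_bound R x 0 \<Longrightarrow> of_int x \<le> c"
proof -
  have mid: "(1 / 2) *\<^sub>R pt p + (1 / 2) *\<^sub>R pt q \<in> convex hull (pt ` set V)"
    if "p \<in> set V" "q \<in> set V" for p q V
    using that by (intro convexD[OF convex_convex_hull] hull_inc) auto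
  show thesis
  proof (cases R)
    case Half
    then show thesis
      using mid[of "(0, 1)" "(0, 1) # side_pts R" "(1, - 1)"] by (intro that[of "1 / 2"]) (auto simp: pt_def)
  next
    case Two
    then show thesis
      using mid[of "(0, 1)" "(0, 1) # side_pts R" "(4, - 1)"] by (intro that[of 2]) (auto simp: pt_def)
  next
    case (Split b)
    then show thesis
      using mid[of "(1, 0)" "(0, 1) # side_pts R" "(1, 0)"] by (intro that[of 1]) (auto simp: pt_def)
  qed
qed

lemma side_end_bound: "side_bound R x (- 1) \<Longrightarrow> x \<le> side_end R"
  by (cases R) auto

lemma side_end_in: "(side_end R, - 1) \<in> set (side_pts R)"
  by (cases R) auto

text \<open>Integer points are checked row by row: the top row is the vertex, the middle row lies
  between the crossings of the boundary with the axis, and the bottom row between the two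
  ends.\<close>

lemma strip_form:
  assumes P: "fano_polygon P" and S: "in_strip P"
    and top: "ipt P 0 1" "\<And>x. ipt P x 1 \<Longrightarrow> x = 0"
    and L: "\<And>p. p \<in> set (side_pts L) \<Longrightarrow> ipt P (- fst p) (snd p)" "\<And>x y. ipt P x y \<Longrightarrow> side_bound L (- x) y"
    and R: "\<And>p. p \<in> set (side_pts R) \<Longrightarrow> ipt P (fst p) (snd p)" "\<And>x y. ipt P x y \<Longrightarrow> side_bound R x y"
  shows "P = ipoly (form L R)" and "0 \<le> side_end L + side_end R"
proof -
  have "side_bound R (- side_end L) (- 1)" using R(2)[OF L(1)[OF side_end_in]] by simp
  then show e: "0 \<le> side_end L + side_end R" using side_end_bound by fastforce
  let ?H = "convex hull (pt ` set (form L R))"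
  have mirror_hull: "(- fst z, snd z) \<in> ?H" if z: "z \<in> convex hull (pt ` set ((0, 1) # side_pts L))" for z
  proof -
    let ?f = "\<lambda>z :: plane. (- fst z, snd z)"
    have lin: "linear ?f" by (rule linearI) auto
    have "?f z \<in> convex hull (?f ` pt ` set ((0, 1) # side_pts L))"
      using z convex_hull_linear_image[OF lin] by (metis (no_types, lifting) imageI)
    moreover have "?f ` pt ` set ((0, 1) # side_pts L) \<subseteq> pt ` set (form L R)"
    proof
      fix y assume "y \<in> ?f ` pt ` set ((0, 1) # side_pts L)"
      then obtain p where p: "p \<in> set ((0, 1) # side_pts L)" "y = ?f (pt p)" by blast
      have "(- fst p, snd p) \<in> set (form L R)" using p(1) by (auto simp: form_def)
      then have "pt (- fst p, snd p) \<in> pt ` set (form L R)" by (rule imageI)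
      then show "y \<in> pt ` set (form L R)" unfolding p(2) by (simp add: pt_def)
    qed
    ultimately show ?thesis using hull_mono by blast
  qed
  have sub: "convex hull (pt ` set ((0, 1) # side_pts R)) \<subseteq> ?H"
    by (intro hull_mono) (auto simp: form_def)
  obtain c where c: "c > 0" "(c, 0) \<in> ?H" "\<And>x. side_bound R x 0 \<Longrightarrow> of_int x \<le> c"
    using side_axis[of R] sub by (metis subsetD)
  obtain d where d: "d > 0" "(- d, 0) \<in> ?H" "\<And>x. side_bound L x 0 \<Longrightarrow> of_int x \<le> d"
    using side_axis[of L] mirror_hull by (metis fst_conv snd_conv)
  have "P = ?H"
  proof (rule fano_eq_hull[OF P])
    fix v assume "v \<in> pt ` set (form L R)"
    then show "v \<in> P" using top(1) L(1) R(1) by (auto simp: form_def pt_def ipt_def)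
  next
    fix x y assume xy: "ipt P x y"
    then have "\<bar>y\<bar> \<le> 1" using S by (simp add: in_strip_def)
    then consider "y = 1" | "y = 0" | "y = - 1" by linarith
    then show "ivec x y \<in> ?H"
    proof cases
      case 1
      then have "x = 0" using top(2) xy by simp
      then show ?thesis using 1 by (auto simp: form_def pt_def intro!: hull_inc)
    next
      case 2
      have x1: "of_int x \<le> c" using c(3) R(2)[OF xy] 2 by simp
      have x2: "- of_int x \<le> d" using d(3)[of "- x"] L(2)[OF xy] 2 by simp
      define l where "l = (c - of_int x) / (c + d)"
      have l: "0 \<le> l" "l \<le> 1" using c(1) d(1) x1 x2 by (auto simp: l_def field_simps)
      have "l *\<^sub>R (- d, 0) + (1 - l) *\<^sub>R (c, 0) \<in> ?H"
        using l by (intro convexD[OF convex_convex_hull d(2) c(2)]) auto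
      moreover have "l *\<^sub>R (- d, 0) + (1 - l) *\<^sub>R (c, 0) = (of_int x, 0 :: real)"
      proof -
        have "l * (c + d) = c - of_int x" using c(1) d(1) by (simp add: l_def)
        then show ?thesis by (simp add: algebra_simps)
      qed
      ultimately show ?thesis using 2 by simp
    next
      case 3
      have x1: "x \<le> side_end R" using side_end_bound R(2)[OF xy] 3 by simp
      have x2: "- x \<le> side_end L" using side_end_bound L(2)[OF xy] 3 by simp
      have "(- side_end L, - 1) \<in> set (form L R)" "(side_end R, - 1) \<in> set (form L R)"
        using side_end_in[of L] side_end_in[of R] unfolding form_def by force+
      then have "pt (- side_end L, - 1) \<in> pt ` set (form L R)" "pt (side_end R, - 1) \<in> pt ` set (form L R)"
        by (auto intro: imageI)
      then have in': "ivec (- side_end L) (- 1) \<in> pt ` set (form L R)" "ivec (side_end R) (- 1) \<in> pt ` set (form L R)"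
        by (simp_all add: pt_def)
      show ?thesis
      proof (cases "side_end L + side_end R = 0")
        case True
        then have "x = side_end R" using x1 x2 by simp
        then show ?thesis using in'(2) 3 by (simp add: hull_inc)
      next
        case False
        have "ivec x y \<in> convex hull {ivec (- side_end L) (- 1), ivec (side_end R) (- 1), ivec (side_end R) (- 1)}"
          by (rule mem_triangle[of "side_end R - x" "x + side_end L" 0 "side_end L + side_end R"])
            (use x1 x2 3 e False in \<open>auto simp: algebra_simps\<close>)
        moreover have "{ivec (- side_end L) (- 1), ivec (side_end R) (- 1), ivec (side_end R) (- 1)}
            \<subseteq> pt ` set (form L R)" using in' by simp
        ultimately show ?thesis using hull_mono by (metis subsetD)
      qed
    qed
  qed
  then show "P = ipoly (form L R)" by (simp add: ipoly_def)
qed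

theorem strip_equiv_form:
  assumes P: "fano_polygon P" and T: "only_T_singularities P" and S: "in_strip P"
  shows "\<exists>L R. side_ok L \<and> side_ok R \<and> 0 \<le> side_end L + side_end R \<and> P \<sim>\<^sub>m ipoly (form L R)"
proof -
  obtain Q where Q: "P \<sim>\<^sub>m Q" "only_T_singularities Q" "in_strip Q" "wid Q (ivec 0 (-1)) = 0"
    using strip_sharp_top[OF P T S] .
  have FQ: "fano_polygon Q" using Q(1) mut_equivD by blast
  have pw: "primitive (ivec 0 (-1))" by (rule primitive_ivec[THEN iffD2]) simp
  have hw: "hgt Q (ivec 0 (-1)) = 1" using Q(3) in_strip_iff[OF FQ] by blast
  obtain q where q: "q \<in> verts Q" "ivec 0 (-1) \<bullet> q = - hgt Q (ivec 0 (-1))"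
    "face Q (ivec 0 (-1)) = {q + t *\<^sub>R quarter_turn (ivec 0 (-1)) | t. 0 \<le> t \<and> t \<le> real (wid Q (ivec 0 (-1)))}"
    by (rule fano_face_ends[OF FQ pw])
  obtain x0 y0 where xy0: "q = ivec x0 y0" "ipt Q x0 y0" by (rule fano_iptE[OF FQ q(1)])
  have y0: "y0 = 1" using q(2) hw by (simp add: xy0 inner_plane)
  have face1: "face Q (ivec 0 (-1)) = {q}" unfolding q(3) Q(4) by auto
  have uniq: "x = x0" if "ipt Q x 1" for x
  proof -
    have "ivec 0 (-1) \<bullet> ivec x 1 = - hgt Q (ivec 0 (-1))" unfolding hw by (simp add: inner_plane)
    then have "ivec x 1 \<in> face Q (ivec 0 (-1))"
      using that by (simp add: face_eq[OF fano_compact[OF FQ]] ipt_def del: inner_Pair)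
    then show ?thesis unfolding face1 xy0 by simp
  qed
  \<comment> \<open>A shear that moves the top vertex to \<open>(0, 1)\<close> and preserves the
    strip.\<close>
  let ?f = "imat 1 (- x0) 0 1"
  have u: "unimodular ?f" by (rule unimodular_imat) simp
  define A where "A = ?f ` Q"
  have ipt_A: "ipt A x y \<longleftrightarrow> (\<exists>i j. ipt Q i j \<and> x = i - x0 * j \<and> y = j)" for x y
    by (simp add: A_def ipt_image)
  have A: "fano_polygon A" "only_T_singularities A"
    using unimodular.fano_image[OF u FQ] unimodular.only_T_image[OF u FQ Q(2)] by (auto simp: A_def)
  have SA: "in_strip A" using Q(3) by (auto simp: in_strip_def ipt_A)
  have topA: "ipt A 0 1" using xy0 y0 by (auto simp: ipt_A)
  have uniqA: "x = 0" if "ipt A x 1" for x using that uniq by (auto simp: ipt_A)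
  obtain R where R: "side_ok R" "\<And>p. p \<in> set (side_pts R) \<Longrightarrow> ipt A (fst p) (snd p)"
    "\<And>x y. ipt A x y \<Longrightarrow> side_bound R x y"
    using strip_side[OF A SA topA uniqA] by blast
  \<comment> \<open>The left-hand boundary is obtained as the right-hand boundary of the mirror
    image.\<close>
  let ?g = "imat (- 1) 0 0 1"
  have v: "unimodular ?g" by (rule unimodular_imat) simp
  define B where "B = ?g ` A"
  have ipt_B: "ipt B x y \<longleftrightarrow> ipt A (- x) y" for x y
  proof -
    have "ipt B x y \<longleftrightarrow> (\<exists>i j. ipt A i j \<and> x = - i \<and> y = j)" by (simp add: B_def ipt_image)
    also have "\<dots> \<longleftrightarrow> ipt A (- x) y" by (metis minus_minus)
    finally show ?thesis .
  qed
  have B: "fano_polygon B" "only_T_singularities B"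
    using unimodular.fano_image[OF v A(1)] unimodular.only_T_image[OF v A] by (auto simp: B_def)
  have SB: "in_strip B" using SA by (simp add: in_strip_def ipt_B)
  have topB: "ipt B 0 1" using topA by (simp add: ipt_B)
  have uniqB: "x = 0" if "ipt B x 1" for x using uniqA[of "- x"] that by (simp add: ipt_B)
  obtain L where L: "side_ok L" "\<And>p. p \<in> set (side_pts L) \<Longrightarrow> ipt B (fst p) (snd p)"
    "\<And>x y. ipt B x y \<Longrightarrow> side_bound L x y"
    using strip_side[OF B SB topB uniqB] by blast
  have L': "ipt A (- fst p) (snd p)" if "p \<in> set (side_pts L)" for p using L(2)[OF that] by (simp add: ipt_B)
  have L'': "side_bound L (- x) y" if "ipt A x y" for x y using L(3)[of "- x" y] that by (simp add: ipt_B)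
  have form: "A = ipoly (form L R)" "0 \<le> side_end L + side_end R"
    by (rule strip_form[OF A(1) SA topA uniqA L' L'' R(2,3)]; assumption)+
  have "P \<sim>\<^sub>m A" using Q(1) mut_equiv_unimodular[OF u FQ] mut_equiv_trans unfolding A_def by blast
  then show ?thesis using L(1) R(1) form by blast
qed

section \<open>Reduction to one polygon in each family\<close>

text \<open>From four blow-ups on singular representatives are used: those for 4 and 5 are
  \<open>form Half Two\<close> and \<open>form (Split 0) (Split 0)\<close>, those for 6, 7 and 8 are
  members of \<open>triangles\<close>.\<close>

fun rep :: "surface_family \<Rightarrow> (int \<times> int) list" where
  "rep P1xP1 = [(1, 0), (0, 1), (- 1, 0), (0, - 1)]"
| "rep (Blowup i) = (if i \<le> 3 then take (3 + i) [(1, 0), (0, 1), (- 1, - 1), (0, - 1), (- 1, 0), (1, 1)]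
     else if i = 4 then [(0, 1), (- 1, - 1), (4, - 1)] else if i = 5 then [(0, 1), (- 1, 0), (- 2, - 1), (1, 0), (2, - 1)] else if i = 6 then [(- 1, - 1), (2, - 1), (- 1, 2)]
     else if i = 7 then [(- 1, - 2), (3, - 2), (- 1, 2)] else [(- 1, - 3), (5, - 3), (- 1, 3)])"

text \<open>A step with \<open>j = 0\<close> compares hulls instead of lists, since the same polygon
  can be listed in another order or with additional points.\<close>

fun path_check :: "(int \<times> int) list \<Rightarrow> ((int \<times> int) list \<times> (int \<times> int) \<times> (int \<times> int) \<times> nat \<times>
    (int \<times> int) \<times> (int \<times> int)) list \<Rightarrow> (int \<times> int) list \<Rightarrow> bool" where
  "path_check V [] R \<longleftrightarrow> V = R"
| "path_check V ((W, w, v, j, r1, r2) # ps) R \<longleftrightarrow>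
     (if j = 0 then \<bar>idet r1 r2\<bar> = 1 \<and> fano_check W \<and>
        (\<forall>q\<in>set (map (imap r1 r2) W). mem_hull V q) \<and> (\<forall>p\<in>set V. mem_hull (map (imap r1 r2) W) p)
      else link_check V W w v j r1 r2) \<and> path_check W ps R"

lemma ipoly_subset: "(\<And>q. q \<in> set W \<Longrightarrow> mem_hull V q) \<Longrightarrow> ipoly W \<subseteq> ipoly V"
  unfolding ipoly_def[of W] using mem_hull_ipoly[of V]
  by (intro hull_minimal) (auto simp: ipoly_def)

lemma path_check:
  "fano_polygon (ipoly V) \<Longrightarrow> path_check V ps R \<Longrightarrow> ipoly V \<sim>\<^sub>m ipoly R"
proof (induction V ps R rule: path_check.induct)
  case (1 V R)
  then show ?case using mut_equiv_refl by simp
next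
  case (2 V W w v j r1 r2 ps R)
  have VW: "ipoly V \<sim>\<^sub>m ipoly W"
  proof (cases "j = 0")
    case True
    then have c: "\<bar>idet r1 r2\<bar> = 1" "fano_check W"
      "\<And>q. q \<in> set (map (imap r1 r2) W) \<Longrightarrow> mem_hull V q"
      "\<And>p. p \<in> set V \<Longrightarrow> mem_hull (map (imap r1 r2) W) p"
      using "2.prems"(2) by (simp_all add: mult.commute del: set_map)
    have "ipoly V = ipoly (map (imap r1 r2) W)"
      using ipoly_subset c(3,4) by (intro antisym) blast+
    then show ?thesis using ipoly_map[OF fano_check[OF c(2)] c(1)] mut_equiv_sym by simp
  next
    case False
    then have "link_check V W w v j r1 r2" using "2.prems"(2) by simp
    then show ?thesis by (rule link[OF "2.prems"(1)])
  qed
  moreover have "ipoly W \<sim>\<^sub>m ipoly R"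
    using "2.IH" "2.prems"(2) mut_equivD(2)[OF VW] by simp
  ultimately show ?case by (rule mut_equiv_trans)
qed

definition known :: "(int \<times> int) list \<Rightarrow> bool" where
  "known V \<longleftrightarrow> (\<exists>S\<in>smooth_del_pezzo_families. ipoly V \<sim>\<^sub>m ipoly (rep S))"

lemma knownI:
  assumes "fano_check V" "path_check V ps (rep S)" "S \<in> smooth_del_pezzo_families"
  shows "known V"
  using path_check[OF fano_check[OF assms(1)] assms(2)] assms(3) by (auto simp: known_def)

text \<open>Each step of a path lists the next polygon, the direction \<open>w\<close>, the vector \<open>v\<close> and the number
  of mutations, and the rows of a unimodular matrix that carries the next polygon to the mutated
  one; a step with no mutation is a change of basis.\<close>

lemma known_Half_Half: "known (form Half Half)"
  by (rule knownI[where S = "P1xP1" and ps = "[([(1, 0), (0, 1), (- 1, 0), (0, - 1)], (0, 1), (1, 0), 1, (1, 0), (1, 1))]"])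
    (code_simp, code_simp, simp add: smooth_del_pezzo_families_def)

lemma known_Half_Two: "known (form Half Two)"
  by (rule knownI[where S = "Blowup 4" and ps = "[([(0, 1), (- 1, - 1), (4, - 1)], (1, 0), (0, 1), 0, (1, 0), (0, 1))]"])
    (code_simp, code_simp, simp add: smooth_del_pezzo_families_def)

lemma known_Half_0: "known (form Half (Split 0))"
  by (rule knownI[where S = "Blowup 3" and ps = "[([(1, 0), (0, 1), (- 2, - 1), (0, - 1)], (0, 1), (1, 0), 1, (0, - 1), (1, - 1)),
      ([(1, 0), (0, 1), (- 2, 1), (- 1, 0), (1, - 1)], (0, 1), (1, 0), 1, (1, 0), (1, 1)),
      ([(1, 0), (0, 1), (- 1, - 1), (0, - 1), (- 1, 0), (1, 1)], (0, - 1), (- 1, 0), 1, (1, 0), (- 1, 1))]"])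
    (code_simp, code_simp, simp add: smooth_del_pezzo_families_def)

lemma known_Half_1: "known (form Half (Split 1))"
  by (rule knownI[where S = "Blowup 2" and ps = "[([(1, 0), (0, 1), (- 1, - 1), (0, - 1), (- 1, 0)], (0, 1), (1, 0), 1, (0, - 1), (1, - 1))]"])
    (code_simp, code_simp, simp add: smooth_del_pezzo_families_def)

lemma known_Half_2: "known (form Half (Split 2))"
  by (rule knownI[where S = "Blowup 1" and ps = "[([(1, 0), (0, 1), (- 1, - 1), (0, - 1)], (1, 0), (0, 1), 0, (1, 0), (0, 1))]"])
    (code_simp, code_simp, simp add: smooth_del_pezzo_families_def)

lemma known_Half_3: "known (form Half (Split 3))"
  by (rule knownI[where S = "Blowup 0" and ps = "[([(1, 0), (0, 1), (- 1, - 1)], (1, 0), (0, 1), 0, (1, 0), (0, 1))]"])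
    (code_simp, code_simp, simp add: smooth_del_pezzo_families_def)

lemma known_Two_Two: "known (form Two Two)"
  by (rule knownI[where S = "Blowup 7" and ps = "[([(1, 0), (1, 4), (- 1, 0), (- 1, - 4)], (0, 1), (1, 0), 4, (0, 1), (1, 0)),
      ([(- 1, - 2), (3, - 2), (- 1, 2)], (2, - 1), (- 1, - 2), 1, (1, 1), (2, 3))]"])
    (code_simp, code_simp, simp add: smooth_del_pezzo_families_def)

lemma known_Two_0: "known (form Two (Split 0))"
  by (rule knownI[where S = "Blowup 6" and ps = "[([(1, 0), (1, 2), (- 2, - 1), (- 2, - 3)], (0, 1), (1, 0), 3, (- 1, 2), (- 1, 1)),
      ([(- 1, - 1), (2, - 1), (- 1, 2)], (1, 0), (0, - 1), 1, (1, 1), (0, 1))]"])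
    (code_simp, code_simp, simp add: smooth_del_pezzo_families_def)

lemma known_Two_1: "known (form Two (Split 1))"
  by (rule knownI[where S = "Blowup 5" and ps = "[([(1, 0), (0, 1), (- 3, 1), (- 1, - 1), (1, - 1)], (0, 1), (1, 0), 2, (1, - 1), (0, - 1)),
      ([(1, 0), (0, 1), (- 2, 1), (1, - 2)], (1, 1), (1, - 1), 1, (2, 1), (- 1, - 1)),
      ([(0, 1), (- 1, 0), (- 2, - 1), (1, 0), (2, - 1)], (- 1, - 1), (- 1, 1), 1, (1, 1), (- 1, 0))]"])
    (code_simp, code_simp, simp add: smooth_del_pezzo_families_def)

lemma known_Two_2: "known (form Two (Split 2))"
  by (rule knownI[where S = "Blowup 4" and ps = "[([(1, 0), (0, 1), (- 4, - 3), (0, - 1)], (1, - 2), (- 2, - 1), 1, (1, 0), (0, 1)),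
      ([(0, 1), (- 1, - 1), (4, - 1)], (1, - 1), (- 1, - 1), 4, (- 1, 0), (- 1, 1))]"])
    (code_simp, code_simp, simp add: smooth_del_pezzo_families_def)

lemma known_Two_3: "known (form Two (Split 3))"
  by (rule knownI[where S = "Blowup 3" and ps = "[([(1, 0), (0, 1), (- 4, 3), (- 2, 1), (1, - 1)], (0, 1), (1, 0), 1, (1, 0), (1, 1)),
      ([(1, 0), (0, 1), (- 2, 1), (- 1, 0), (1, - 1)], (- 1, - 2), (- 2, 1), 1, (1, 0), (0, 1)),
      ([(1, 0), (0, 1), (- 1, - 1), (0, - 1), (- 1, 0), (1, 1)], (0, - 1), (- 1, 0), 1, (1, 0), (- 1, 1))]"])
    (code_simp, code_simp, simp add: smooth_del_pezzo_families_def)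

lemma known_Two_4: "known (form Two (Split 4))"
  by (rule knownI[where S = "Blowup 2" and ps = "[([(1, 0), (0, 1), (- 4, 3), (- 3, 2), (1, - 1)], (0, 1), (1, 0), 1, (1, 0), (1, 1)),
      ([(1, 0), (0, 1), (- 1, - 1), (0, - 1), (- 1, 0)], (- 1, - 2), (- 2, 1), 1, (- 1, 1), (0, - 1))]"])
    (code_simp, code_simp, simp add: smooth_del_pezzo_families_def)

lemma known_Two_5: "known (form Two (Split 5))"
  by (rule knownI[where S = "Blowup 1" and ps = "[([(1, 0), (0, 1), (- 1, - 1), (0, - 1)], (1, - 2), (- 2, - 1), 1, (0, 1), (1, 0))]"])
    (code_simp, code_simp, simp add: smooth_del_pezzo_families_def)

lemma known_Two_6: "known (form Two (Split 6))"
  by (rule knownI[where S = "Blowup 0" and ps = "[([(1, 0), (0, 1), (- 1, - 1)], (1, - 2), (- 2, - 1), 1, (1, 0), (0, 1))]"])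
    (code_simp, code_simp, simp add: smooth_del_pezzo_families_def)

lemma known_0_0: "known (form (Split 0) (Split 0))"
  by (rule knownI[where S = "Blowup 5" and ps = "[([(0, 1), (- 1, 0), (- 2, - 1), (1, 0), (2, - 1)], (1, 0), (0, 1), 0, (1, 0), (0, 1))]"])
    (code_simp, code_simp, simp add: smooth_del_pezzo_families_def)

lemma known_0_1: "known (form (Split 0) (Split 1))"
  by (rule knownI[where S = "Blowup 4" and ps = "[([(1, 0), (0, 1), (- 3, - 2), (- 1, - 2)], (- 1, 0), (0, 1), 1, (0, 1), (1, - 1)),
      ([(0, 1), (- 1, - 1), (4, - 1)], (1, - 1), (- 1, - 1), 3, (- 1, 0), (- 1, 1))]"])
    (code_simp, code_simp, simp add: smooth_del_pezzo_families_def)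

lemma known_0_2: "known (form (Split 0) (Split 2))"
  by (rule knownI[where S = "Blowup 3" and ps = "[([(1, 0), (0, 1), (- 2, 1), (- 1, 0), (1, - 1)], (0, 1), (1, 0), 1, (1, 0), (1, 1)),
      ([(1, 0), (0, 1), (- 1, - 1), (0, - 1), (- 1, 0), (1, 1)], (0, - 1), (- 1, 0), 1, (1, 0), (- 1, 1))]"])
    (code_simp, code_simp, simp add: smooth_del_pezzo_families_def)

lemma known_0_3: "known (form (Split 0) (Split 3))"
  by (rule knownI[where S = "Blowup 2" and ps = "[([(1, 0), (0, 1), (- 1, - 1), (0, - 1), (- 1, 0)], (1, - 1), (- 1, - 1), 1, (1, 0), (0, 1))]"])
    (code_simp, code_simp, simp add: smooth_del_pezzo_families_def)

lemma known_0_4: "known (form (Split 0) (Split 4))"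
  by (rule knownI[where S = "P1xP1" and ps = "[([(1, 0), (0, 1), (- 1, 0), (0, - 1)], (1, - 1), (- 1, - 1), 1, (1, 0), (0, 1))]"])
    (code_simp, code_simp, simp add: smooth_del_pezzo_families_def)

lemma known_1_1: "known (form (Split 1) (Split 1))"
  by (rule knownI[where S = "Blowup 3" and ps = "[([(1, 0), (0, 1), (- 1, - 1), (0, - 1), (- 1, 0), (1, 1)], (0, 1), (1, 0), 1, (1, 0), (0, 1))]"])
    (code_simp, code_simp, simp add: smooth_del_pezzo_families_def)

lemma known_1_2: "known (form (Split 1) (Split 2))"
  by (rule knownI[where S = "Blowup 2" and ps = "[([(1, 0), (0, 1), (- 1, - 1), (0, - 1), (- 1, 0)], (1, 0), (0, 1), 0, (1, 0), (0, 1))]"])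
    (code_simp, code_simp, simp add: smooth_del_pezzo_families_def)

lemma known_1_3: "known (form (Split 1) (Split 3))"
  by (rule knownI[where S = "Blowup 1" and ps = "[([(1, 0), (0, 1), (- 1, - 1), (0, - 1)], (1, 0), (0, 1), 0, (0, 1), (1, 0))]"])
    (code_simp, code_simp, simp add: smooth_del_pezzo_families_def)

lemma known_2_2: "known (form (Split 2) (Split 2))"
  by (rule knownI[where S = "P1xP1" and ps = "[([(1, 0), (0, 1), (- 1, 0), (0, - 1)], (1, 0), (0, 1), 0, (1, 0), (0, 1))]"])
    (code_simp, code_simp, simp add: smooth_del_pezzo_families_def)

lemma known_triangle_1: "known ([(- 1, - 1), (2, - 1), (- 1, 2)])"
  by (rule knownI[where S = "Blowup 6" and ps = "[([(- 1, - 1), (2, - 1), (- 1, 2)], (1, 0), (0, 1), 0, (1, 0), (0, 1))]"])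
    (code_simp, code_simp, simp add: smooth_del_pezzo_families_def)

lemma known_triangle_2: "known ([(- 1, - 3), (2, - 3), (- 1, 3)])"
  by (rule knownI[where S = "Blowup 7" and ps = "[([(1, 0), (1, 3), (- 3, - 5), (- 3, - 8)], (1, 0), (0, - 1), 2, (2, - 1), (- 3, 2)),
      ([(- 1, - 2), (3, - 2), (- 1, 2)], (1, 0), (0, - 1), 1, (1, 1), (1, 2))]"])
    (code_simp, code_simp, simp add: smooth_del_pezzo_families_def)

lemma known_triangle_3: "known ([(- 1, - 3), (2, - 3), (- 1, 6)])"
  by (rule knownI[where S = "Blowup 8" and ps = "[([(1, 0), (1, 6), (- 2, - 3), (- 2, - 9)], (1, 0), (0, - 1), 3, (- 1, 0), (0, 1)),
      ([(- 1, - 3), (5, - 3), (- 1, 3)], (3, - 1), (- 1, - 3), 1, (- 1, 0), (- 3, 1))]"])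
    (code_simp, code_simp, simp add: smooth_del_pezzo_families_def)

lemma known_triangle_4: "known ([(- 1, - 2), (3, - 2), (- 1, 2)])"
  by (rule knownI[where S = "Blowup 7" and ps = "[([(- 1, - 2), (3, - 2), (- 1, 2)], (1, 0), (0, 1), 0, (1, 0), (0, 1))]"])
    (code_simp, code_simp, simp add: smooth_del_pezzo_families_def)

lemma known_triangle_5: "known ([(- 1, - 3), (5, - 3), (- 1, 3)])"
  by (rule knownI[where S = "Blowup 8" and ps = "[([(- 1, - 3), (5, - 3), (- 1, 3)], (1, 0), (0, 1), 0, (1, 0), (0, 1))]"])
    (code_simp, code_simp, simp add: smooth_del_pezzo_families_def)

lemma known_triangle_6: "known ([(- 1, - 4), (3, - 4), (- 1, 4)])"
  by (rule knownI[where S = "Blowup 8" and ps = "[([(1, 0), (1, 6), (- 3, - 10), (- 3, - 16)], (1, 0), (0, - 1), 2, (- 1, 0), (- 2, 1)),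
      ([(- 1, - 3), (5, - 3), (- 1, 3)], (- 4, 1), (1, 4), 1, (0, 1), (1, 5))]"])
    (code_simp, code_simp, simp add: smooth_del_pezzo_families_def)

lemma known_triangle_7: "known ([(- 2, - 5), (3, - 5), (- 2, 5)])"
  by (rule knownI[where S = "Blowup 8" and ps = "[([(1, 0), (1, 5), (- 5, - 13), (- 5, - 18)], (1, 0), (0, - 1), 2, (3, - 1), (- 5, 2)),
      ([(- 1, - 3), (5, - 3), (- 1, 3)], (1, 0), (0, - 1), 1, (- 1, 0), (- 2, 1))]"])
    (code_simp, code_simp, simp add: smooth_del_pezzo_families_def)

lemma known_swap:
  assumes "known (form L R)"
  shows "known (form R L)"
proof -
  obtain S where S: "S \<in> smooth_del_pezzo_families" "ipoly (form L R) \<sim>\<^sub>m ipoly (rep S)"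
    using assms by (auto simp: known_def)
  have "set (map (imap (- 1, 0) (0, 1)) (form L R)) = set (form R L)"
  proof -
    have "imap (- 1, 0) (0, 1) = (\<lambda>p. (- fst p, snd p))" by (auto simp: imap_def idot_def)
    then show ?thesis by (auto simp: form_def image_iff)
  qed
  then have "ipoly (map (imap (- 1, 0) (0, 1)) (form L R)) = ipoly (form R L)" by (rule ipoly_cong)
  moreover have "ipoly (form L R) \<sim>\<^sub>m ipoly (map (imap (- 1, 0) (0, 1)) (form L R))"
    by (rule ipoly_map[OF mut_equivD(1)[OF S(2)]]) (simp add: idet_def)
  ultimately have "ipoly (form L R) \<sim>\<^sub>m ipoly (form R L)" by simp
  then show ?thesis using S mut_equiv_sym mut_equiv_trans unfolding known_def by blast
qed

lemma known_split_split:
  assumes "0 \<le> b" "b \<le> c" "b + c \<le> 4"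
  shows "known (form (Split b) (Split c))"
proof -
  have "b = 0 \<and> (c = 0 \<or> c = 1 \<or> c = 2 \<or> c = 3 \<or> c = 4) \<or>
      b = 1 \<and> (c = 1 \<or> c = 2 \<or> c = 3) \<or> b = 2 \<and> c = 2"
    using assms by arith
  then show ?thesis
    using known_0_0 known_0_1 known_0_2 known_0_3 known_0_4 known_1_1 known_1_2 known_1_3 known_2_2
    by auto
qed

text \<open>The bottom row has nonnegative length, and the end of \<open>Split c\<close> is
  \<open>2 - c\<close>. Hence \<open>c \<le> 3\<close> opposite \<open>Half\<close>,
  \<open>c \<le> 6\<close> opposite \<open>Two\<close> and \<open>b + c \<le> 4\<close> for two
  split sides: a finite list.\<close>

lemma known_form:
  assumes "side_ok L" "side_ok R" "0 \<le> side_end L + side_end R"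
  shows "known (form L R)"
proof -
  have half: "known (form Half (Split c))" if "0 \<le> c" "c \<le> 3" for c
  proof -
    have "c \<in> {0, 1, 2, 3}" using that by auto
    then show ?thesis using known_Half_0 known_Half_1 known_Half_2 known_Half_3 by auto
  qed
  have two: "known (form Two (Split c))" if "0 \<le> c" "c \<le> 6" for c
  proof -
    have "c \<in> {0, 1, 2, 3, 4, 5, 6}" using that by auto
    then show ?thesis
      using known_Two_0 known_Two_1 known_Two_2 known_Two_3 known_Two_4 known_Two_5 known_Two_6 by auto
  qed
  show ?thesis
  proof (cases L)
    case Half
    then show ?thesis using assms half known_Half_Half known_Half_Two by (cases R) auto
  next
    case Two
    then show ?thesis
      using assms two known_swap[OF known_Half_Two] known_Two_Two by (cases R) auto
  next
    case (Split b)
    show ?thesis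
    proof (cases R)
      case Half
      then show ?thesis using assms Split known_swap[OF half] by simp
    next
      case Two
      then show ?thesis using assms Split known_swap[OF two] by simp
    next
      case (Split c)
      then show ?thesis
        using assms \<open>L = Split b\<close> known_split_split[of b c] known_swap[OF known_split_split[of c b]]
        by (cases "b \<le> c") auto
    qed
  qed
qed

section \<open>Existence and uniqueness of the representative\<close>

lemma triangles_known:
  assumes "P \<in> triangles"
  shows "\<exists>V. P = ipoly V \<and> known V"
proof -
  have "ipoly [(a, b), (c, d), (e, f)] = convex hull {ivec a b, ivec c d, ivec e f}" for a b c d e f
    by (simp add: ipoly_def pt_def)
  then show ?thesis
    using assms known_triangle_1 known_triangle_2 known_triangle_3 known_triangle_4 known_triangle_5
      known_triangle_6 known_triangle_7
    unfolding triangles_def insert_iff empty_iff by metis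
qed

theorem T_polygon_equiv_rep:
  assumes P: "fano_polygon P" and T: "only_T_singularities P"
  shows "\<exists>S\<in>smooth_del_pezzo_families. P \<sim>\<^sub>m ipoly (rep S)"
proof -
  obtain Q where Q: "P \<sim>\<^sub>m Q" "only_T_singularities Q" "minimal Q"
    using mut_equiv_minimal[OF P T] by blast
  have FQ: "fano_polygon Q" using Q(1) mut_equivD by blast
  obtain f where f: "unimodular f" "in_strip (f ` Q) \<or> f ` Q \<in> triangles"
    using minimal_reducible[OF FQ Q(2,3)] by (auto simp: reducible_def)
  have fQ: "fano_polygon (f ` Q)" "only_T_singularities (f ` Q)"
    using unimodular.fano_image[OF f(1) FQ] unimodular.only_T_image[OF f(1) FQ Q(2)] by auto
  have "\<exists>V. f ` Q \<sim>\<^sub>m ipoly V \<and> known V"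
    using f(2)
  proof
    assume "in_strip (f ` Q)"
    then show ?thesis using strip_equiv_form[OF fQ] known_form by blast
  next
    assume "f ` Q \<in> triangles"
    then show ?thesis using triangles_known mut_equiv_refl[OF fQ(1)] by metis
  qed
  then show ?thesis
    using Q(1) mut_equiv_unimodular[OF f(1) FQ] mut_equiv_trans unfolding known_def by meson
qed

lemma rep_euler:
  assumes "S \<in> smooth_del_pezzo_families"
  shows "euler_check (rep S) (euler_number S)"
proof -
  have "S \<in> {P1xP1, Blowup 0, Blowup 1, Blowup 2, Blowup 3, Blowup 4, Blowup 5, Blowup 6, Blowup 7, Blowup 8}"
    using assms by (auto simp: smooth_del_pezzo_families_def)
  moreover have "euler_check (rep P1xP1) (euler_number P1xP1)" by code_simp
  moreover have "euler_check (rep (Blowup 0)) (euler_number (Blowup 0))" by code_simp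
  moreover have "euler_check (rep (Blowup 1)) (euler_number (Blowup 1))" by code_simp
  moreover have "euler_check (rep (Blowup 2)) (euler_number (Blowup 2))" by code_simp
  moreover have "euler_check (rep (Blowup 3)) (euler_number (Blowup 3))" by code_simp
  moreover have "euler_check (rep (Blowup 4)) (euler_number (Blowup 4))" by code_simp
  moreover have "euler_check (rep (Blowup 5)) (euler_number (Blowup 5))" by code_simp
  moreover have "euler_check (rep (Blowup 6)) (euler_number (Blowup 6))" by code_simp
  moreover have "euler_check (rep (Blowup 7)) (euler_number (Blowup 7))" by code_simp
  moreover have "euler_check (rep (Blowup 8)) (euler_number (Blowup 8))" by code_simp
  ultimately show ?thesis by blast
qed

lemma rep_inequivalent:
  assumes S: "S \<in> smooth_del_pezzo_families" "S' \<in> smooth_del_pezzo_families"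
    and eq: "ipoly (rep S) \<sim>\<^sub>m ipoly (rep S')"
  shows "S = S'"
proof -
  note e = euler_check[OF rep_euler[OF S(1)]] and e' = euler_check[OF rep_euler[OF S(2)]]
  have n: "euler_number S = euler_number S'"
    using mut_equiv_smoothing_euler_number[OF eq] e(3) e'(3) by simp
  have m: "mod2_constant (ipoly (rep S)) = mod2_constant (ipoly (rep S'))"
    using mut_equiv_mod2_constant[OF eq] .
  have par: "parity_check (rep S) = parity_check (rep S')"
    using m parity_check[OF e(1,2)] parity_check[OF e'(1,2)] by simp
  \<comment> \<open>\<open>P1xP1\<close> and \<open>Blowup 1\<close> are the only two families with
    the same Euler number.\<close>
  have "parity_check (rep P1xP1)" "\<not> parity_check (rep (Blowup 1))" by code_simp+
  then show ?thesis using n par by (cases S; cases S') auto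
qed

lemma toric_polygon_rep:
  assumes "S \<in> smooth_toric_families"
  shows "toric_polygon S = ipoly (rep S)"
proof -
  have "S \<in> {P1xP1, Blowup 0, Blowup 1, Blowup 2, Blowup 3}"
    using assms by (auto simp: smooth_toric_families_def)
  then show ?thesis by (auto simp: ipoly_def pt_def numeral_eq_Suc)
qed

lemma equiv_mutation_equivalence:
  "equiv {P. fano_polygon P} mutation_equivalence"
proof (rule equivI)
  show "mutation_equivalence \<subseteq> {P. fano_polygon P} \<times> {P. fano_polygon P}" using mut_equivD by auto
  show "refl_on {P. fano_polygon P} mutation_equivalence"
    using mut_equiv_refl by (auto simp: refl_on_def)
  show "sym mutation_equivalence" using mut_equiv_sym by (auto simp: sym_def)
  show "trans mutation_equivalence" using mut_equiv_trans by (rule transI)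
qed

text \<open>A bare bijection of ten-element sets would not refer to surfaces. The Euler number fixes
  the family except for the value 4, and there the toric polygons of \<open>P1xP1\<close> and
  \<open>Blowup 1\<close> decide, so the bijection is unique.\<close>

theorem theorem1p2:
  shows "card T_classes = 10 \<and>
    (\<exists>family. bij_betw family T_classes smooth_del_pezzo_families \<and>
       (\<forall>P. fano_polygon P \<and> only_T_singularities P \<longrightarrow>
          euler_number (family (mutation_equivalence `` {P})) = smoothing_euler_number P) \<and>
       (\<forall>S \<in> smooth_toric_families.
          family (mutation_equivalence `` {toric_polygon S}) = S))"
proof -
  let ?F = smooth_del_pezzo_families
  let ?c = "\<lambda>S. mutation_equivalence `` {ipoly (rep S)}"
  have class_eq: "mutation_equivalence `` {P} = mutation_equivalence `` {Q} \<longleftrightarrow> P \<sim>\<^sub>m Q"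
    if "fano_polygon P" "fano_polygon Q" for P Q
    using equiv_class_eq_iff[OF equiv_mutation_equivalence] that by blast
  have F: "fano_polygon (ipoly (rep S))" "only_T_singularities (ipoly (rep S))"
    "smoothing_euler_number (ipoly (rep S)) = euler_number S" if "S \<in> ?F" for S
    using euler_check[OF rep_euler[OF that]] by auto
  have inj: "inj_on ?c ?F"
    using class_eq F(1) rep_inequivalent by (auto simp: inj_on_def)
  have cls: "\<exists>S\<in>?F. mutation_equivalence `` {P} = ?c S \<and> smoothing_euler_number P = euler_number S"
    if P: "fano_polygon P" "only_T_singularities P" for P
  proof -
    obtain S where S: "S \<in> ?F" "P \<sim>\<^sub>m ipoly (rep S)" using T_polygon_equiv_rep[OF P] by blast
    then have "mutation_equivalence `` {P} = ?c S" using class_eq P(1) F(1) by blast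
    moreover have "smoothing_euler_number P = euler_number S"
      using mut_equiv_smoothing_euler_number[OF S(2)] F(3)[OF S(1)] by simp
    ultimately show ?thesis using S(1) by blast
  qed
  have image: "T_classes = ?c ` ?F"
  proof (intro set_eqI iffI)
    fix X assume "X \<in> T_classes"
    then obtain P where "fano_polygon P" "only_T_singularities P" "X = mutation_equivalence `` {P}"
      by (auto simp: T_classes_def quotient_def)
    then show "X \<in> ?c ` ?F" using cls by blast
  next
    fix X assume "X \<in> ?c ` ?F"
    then show "X \<in> T_classes" using F by (auto simp: T_classes_def quotient_def)
  qed
  have "card ?F = 10"
  proof -
    have "card (Blowup ` {0..8}) = 9" by (subst card_image) (auto simp: inj_on_def)
    moreover have "P1xP1 \<notin> Blowup ` {0..8}" by auto
    ultimately show ?thesis by (simp add: smooth_del_pezzo_families_def)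
  qed
  then have card: "card T_classes = 10" using image card_image[OF inj] by simp
  define family where "family = inv_into ?F ?c"
  have fam: "family (?c S) = S" if "S \<in> ?F" for S
    using inv_into_f_f[OF inj that] by (simp add: family_def)
  have "bij_betw family T_classes ?F"
    unfolding family_def image using inj by (intro bij_betw_inv_into) (simp add: bij_betw_def)
  moreover have "euler_number (family (mutation_equivalence `` {P})) = smoothing_euler_number P"
    if "fano_polygon P" "only_T_singularities P" for P
    using cls[OF that] fam by auto
  moreover have "family (mutation_equivalence `` {toric_polygon S}) = S" if "S \<in> smooth_toric_families" for S
  proof -
    have "S \<in> ?F" using that by (auto simp: smooth_toric_families_def smooth_del_pezzo_families_def)
    then show ?thesis using toric_polygon_rep[OF that] fam by simp
  qed
  ultimately show ?thesis using card by blast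
qed

end
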